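(* Let $\boldsymbol X_1,\dots,\boldsymbol X_n$ be independent copies of a random vector $\boldsymbol X=(X_1,\dots,X_d)$ with continuous marginal distribution functions $F_1,\dots,F_d$, in the max-domain of attraction of a multivariate Pareto distribution $\boldsymbol Y$, and satisfying conditions (B) and (T) below. Let $k=k_n$ satisfy $k\ge n^\theta$ for some $\theta>0$ and $k/n\to q\in[0,1]$. Then for any $m,i,j\in V=\{1,\dots,d\}$, $\hat\Gamma^{(m)}_{ij}=\Gamma^{(m)}_{ij}(q)+o_{\mathbb P}(1)$, where $\Gamma^{(m)}_{ij}(0):=\Gamma^{(m)}_{ij}$. (B): there is $\xi>0$ such that for every $I\subset V$ with $|I|\in\{2,3\}$, $\sup_{\boldsymbol x\in[0,1]^{|I|}}\big|q^{-1}\mathbb P(F_I(\boldsymbol X_I)\nleq\boldsymbol 1-q\boldsymbol x)-\ell_I(\boldsymbol x)\big|=O(q^\xi)$ as $q\to0$. (T): there is $\gamma>0$ such that $\mathbb E[(W^m_i)^{-\gamma}]<\infty$ for all $i,m\in V$.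
   Context: Write $F(\boldsymbol X)=(F_i(X_i))_{i\in V}$, $F_I(\boldsymbol X_I)=(F_i(X_i))_{i\in I}$; $\boldsymbol a\nleq\boldsymbol b$ means $a_i>b_i$ for some $i$. $\boldsymbol X$ is in the max-domain of attraction of $\boldsymbol Y$ if $\ell(\boldsymbol x)=\lim_{q\to0}q^{-1}\mathbb P(F(\boldsymbol X)\nleq\boldsymbol1-q\boldsymbol x)$ exists for all $\boldsymbol x\ge0$ and $\boldsymbol Y$ is the random vector on $\{\boldsymbol x\ge0:\|\boldsymbol x\|_\infty>1\}$ with $\mathbb P(\boldsymbol Y\le\boldsymbol x)=\{\ell(1/\boldsymbol x\wedge\boldsymbol1)-\ell(1/\boldsymbol x)\}/\ell(\boldsymbol1)$; $\ell_I$ is the analogous limit for $\boldsymbol X_I$. $\boldsymbol Y^m$ is $\boldsymbol Y$ conditioned on $\{Y_m>1\}$; $\boldsymbol W^m$ is the non-negative random vector with $W^m_m=1$ a.s. and $\boldsymbol Y^m\stackrel{(d)}{=}P\boldsymbol W^m$, $P$ standard Pareto independent of $\boldsymbol W^m$. Extremal variogram: $\Gamma^{(m)}_{ij}=\operatorname{Var}\{\log Y^m_i-\log Y^m_j\}$. Pre-asymptotic variogram: $\Gamma^{(m)}_{ij}(q)=\operatorname{Var}[\log\{1-F_i(X_i)\}-\log\{1-F_j(X_j)\}\mid F_m(X_m)>1-q]$. Estimator: writing $X_{ti}$ for the $i$-th entry of $\boldsymbol X_t$ and $\tilde U_{ti}:=n^{-1}\#\{s\le n: X_{si}\ge X_{ti}\}\in[1/n,1]$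 (i.e. $1-\tilde F_i(X_{ti})$ with $\tilde F_i$ the left-continuous empirical distribution function), $\hat\Gamma^{(m)}_{ij}$ is the sample variance of $\{\log\tilde U_{ti}-\log\tilde U_{tj}: t \text{ with } \tilde U_{tm}\le k/n\}$. *)

theory Defs
  imports "HOL-Probability.Probability"
begin

definition marg_cdf :: "'a measure \<Rightarrow> ('a \<Rightarrow> real^'d) \<Rightarrow> 'd \<Rightarrow> real \<Rightarrow> real" where
  "marg_cdf M X i x = measure M {\<omega> \<in> space M. X \<omega> $ i \<le> x}"

definition exc_prob :: "'a measure \<Rightarrow> ('a \<Rightarrow> real^'d) \<Rightarrow> 'd set \<Rightarrow> real \<Rightarrow> real^'d \<Rightarrow> real" where
  "exc_prob M X I q x =
     measure M {\<omega> \<in> space M. \<exists>i\<in>I. marg_cdf M X i (X \<omega> $ i) > 1 - q * x $ i}"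

definition stdf :: "'a measure \<Rightarrow> ('a \<Rightarrow> real^'d) \<Rightarrow> 'd set \<Rightarrow> real^'d \<Rightarrow> real" where
  "stdf M X I x = Lim (at_right 0) (\<lambda>q. exc_prob M X I q x / q)"

definition cond_exp_ev :: "'a measure \<Rightarrow> 'a set \<Rightarrow> ('a \<Rightarrow> real) \<Rightarrow> real" where
  "cond_exp_ev M A f = (\<integral>\<omega>. indicator A \<omega> * f \<omega> \<partial>M) / measure M A"

definition cond_var_ev :: "'a measure \<Rightarrow> 'a set \<Rightarrow> ('a \<Rightarrow> real) \<Rightarrow> real" where
  "cond_var_ev M A f = cond_exp_ev M A (\<lambda>\<omega>. (f \<omega> - cond_exp_ev M A f)\<^sup>2)"

definition cond_measure :: "'a measure \<Rightarrow> 'a set \<Rightarrow> 'a measure" where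
  "cond_measure M A = density M (\<lambda>\<omega>. ennreal (indicator A \<omega> / measure M A))"

definition std_pareto :: "real measure" where
  "std_pareto = density lborel (\<lambda>p. ennreal (indicator {1..} p / p\<^sup>2))"

definition is_mpareto_law :: "(real^'d \<Rightarrow> real) \<Rightarrow> (real^'d) measure \<Rightarrow> bool" where
  "is_mpareto_law ell \<mu> \<longleftrightarrow>
     prob_space \<mu> \<and> sets \<mu> = sets borel \<and>
     (AE y in \<mu>. (\<forall>i. 0 \<le> y $ i) \<and> (\<exists>i. y $ i > 1)) \<and>
     (\<forall>x::real^'d. (\<forall>i. 0 < x $ i) \<longrightarrow>
        measure \<mu> {y. \<forall>i. y $ i \<le> x $ i} =
          (ell (\<chi> i. 1 / min (x $ i) 1) - ell (\<chi> i. 1 / x $ i)) / ell (\<chi> i. 1))"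

text \<open>Law of W^m: non-negative, W_m = 1 a.s., and Y^m =d P W^m with P standard Pareto
  independent of W^m.\<close>
definition is_W_law :: "(real^'d) measure \<Rightarrow> 'd \<Rightarrow> (real^'d) measure \<Rightarrow> bool" where
  "is_W_law \<mu>Y m \<mu>W \<longleftrightarrow>
     prob_space \<mu>W \<and> sets \<mu>W = sets borel \<and>
     (AE w in \<mu>W. w $ m = 1 \<and> (\<forall>i. 0 \<le> w $ i)) \<and>
     distr (\<mu>W \<Otimes>\<^sub>M std_pareto) borel (\<lambda>(w, p). p *\<^sub>R w)
       = cond_measure \<mu>Y {y. y $ m > 1}"

definition ext_variogram :: "(real^'d) measure \<Rightarrow> 'd \<Rightarrow> 'd \<Rightarrow> 'd \<Rightarrow> real" where
  "ext_variogram \<mu>Y m i j = cond_var_ev \<mu>Y {y. y $ m > 1} (\<lambda>y. ln (y $ i) - ln (y $ j))"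

definition pre_variogram :: "'a measure \<Rightarrow> ('a \<Rightarrow> real^'d) \<Rightarrow> 'd \<Rightarrow> 'd \<Rightarrow> 'd \<Rightarrow> real \<Rightarrow> real" where
  "pre_variogram M X m i j q =
     cond_var_ev M {\<omega> \<in> space M. marg_cdf M X m (X \<omega> $ m) > 1 - q}
       (\<lambda>\<omega>. ln (1 - marg_cdf M X i (X \<omega> $ i)) - ln (1 - marg_cdf M X j (X \<omega> $ j)))"

definition emp_U :: "(nat \<Rightarrow> real^'d) \<Rightarrow> nat \<Rightarrow> nat \<Rightarrow> 'd \<Rightarrow> real" where
  "emp_U xs n t i = real (card {s \<in> {1..n}. xs s $ i \<ge> xs t $ i}) / real n"

definition emp_variogram :: "(nat \<Rightarrow> real^'d) \<Rightarrow> nat \<Rightarrow> nat \<Rightarrow> 'd \<Rightarrow> 'd \<Rightarrow> 'd \<Rightarrow> real" where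
  "emp_variogram xs n k m i j =
     (let S = {t \<in> {1..n}. emp_U xs n t m \<le> real k / real n};
          D = (\<lambda>t. ln (emp_U xs n t i) - ln (emp_U xs n t j));
          mu = (\<Sum>t\<in>S. D t) / real (card S)
      in (\<Sum>t\<in>S. (D t - mu)\<^sup>2) / real (card S))"

end

theory Submission
  imports Defs "HOL-Real_Asymp.Real_Asymp"
begin

text \<open>
  Write \<open>U\<^sub>i = 1 - F\<^sub>i(X\<^sub>i)\<close> for the uniform margins. Conditions (B) and (T) give a polynomial joint tail
  \<open>P(U\<^sub>i > q z, U\<^sub>m < q) \<le> C q z powr (-\<delta>)\<close> for \<open>z \<ge> 1\<close>, uniformly in \<open>q\<close>.
  Hence \<open>log (U\<^sub>i / q)\<close> has exponential tails given \<open>U\<^sub>m < q\<close>, and the first two moments of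
  \<open>log U\<^sub>i - log U\<^sub>j\<close> converge to those of the multivariate Pareto law by dominated convergence in a bivariate
  layer-cake formula, so that no weak convergence theory on \<open>\<real>\<^sup>d\<close> is required.

  For the sample, a rank is 1 plus a binomial count given its own observation. Chebyshev's inequality bounds the expected
  sum over all \<open>n\<close> observations of the squared error of replacing \<open>log U\<close> by the logarithm of the rank by a power of
  \<open>log n\<close>, which is \<open>o(k)\<close> as \<open>k \<ge> n powr \<theta>\<close>. The observations selected by rank and those with
  \<open>U\<^sub>m \<le> k/n\<close> form nested sets whose sizes differ by \<open>o(k)\<close>, and fourth moments control the difference of the sums
  over them; for the latter set Chebyshev's inequality gives a law of large numbers.
\<close>

text \<open>The obstacle is that the logarithm is unbounded at both ends. Small values of
  \<open>U\<^sub>i\<close> are governed by its uniform law. Large values of \<open>U\<^sub>i\<close>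
  given a small \<open>U\<^sub>m\<close> are not governed by the margins, and weak convergence does
  not exclude escaping mass there: this is the purpose of the joint tail bound. (T) supplies it for
  the limit law and (B) carries it to finite levels.

  The replacement error is summed over all \<open>n\<close> observations although only about
  \<open>k\<close> are selected. The selection depends on the same ranks as the error, and a sum
  over all indices dominates the sum over any random subset, so that no conditioning on the
  selection arises. This is affordable because the mean squared error per observation is a power of
  \<open>log n\<close> over \<open>n\<close>.

  Fourth moments appear because squared log-ratios are averaged and their variances must be
  finite.\<close>

section \<open>Convergence in probability\<close>

text \<open>Deviations are only required to lie in measurable sets of small measure, so that no measurability of \<open>f\<close> is needed.\<close>
definition conv_prob :: "'a measure \<Rightarrow> (nat \<Rightarrow> 'a \<Rightarrow> 'b::metric_space) \<Rightarrow> 'b \<Rightarrow> bool" where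
  "conv_prob M f c \<longleftrightarrow> (\<forall>\<epsilon>>0. \<exists>A. (\<forall>n. A n \<in> sets M) \<and>
     (\<forall>n. {\<omega> \<in> space M. dist (f n \<omega>) c \<ge> \<epsilon>} \<subseteq> A n) \<and> (\<lambda>n. measure M (A n)) \<longlonglongrightarrow> 0)"

lemma conv_probE:
  assumes "conv_prob M f c" "\<epsilon> > 0"
  obtains A where "\<And>n. A n \<in> sets M" "\<And>n \<omega>. \<omega> \<in> space M \<Longrightarrow> \<omega> \<notin> A n \<Longrightarrow> dist (f n \<omega>) c < \<epsilon>"
    "(\<lambda>n. measure M (A n)) \<longlonglongrightarrow> 0"
proof -
  from assms obtain A where "\<forall>n. A n \<in> sets M" "\<forall>n. {\<omega> \<in> space M. dist (f n \<omega>) c \<ge> \<epsilon>} \<subseteq> A n"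
    "(\<lambda>n. measure M (A n)) \<longlonglongrightarrow> 0" unfolding conv_prob_def by blast
  then show thesis by (intro that[of A]) (auto simp: subset_eq not_le[symmetric])
qed

lemma conv_probI:
  assumes "\<And>\<epsilon>. \<epsilon> > 0 \<Longrightarrow> \<exists>A. (\<forall>n. A n \<in> sets M) \<and>
     (\<forall>n. \<forall>\<omega>\<in>space M. \<omega> \<notin> A n \<longrightarrow> dist (f n \<omega>) c < \<epsilon>) \<and> (\<lambda>n. measure M (A n)) \<longlonglongrightarrow> 0"
  shows "conv_prob M f c"
  unfolding conv_prob_def
proof (intro allI impI)
  fix \<epsilon> :: real assume "\<epsilon> > 0"
  from assms[OF this] obtain A where A: "\<forall>n. A n \<in> sets M" "\<forall>n. \<forall>\<omega>\<in>space M. \<omega> \<notin> A n \<longrightarrow> dist (f n \<omega>) c < \<epsilon>"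
     "(\<lambda>n. measure M (A n)) \<longlonglongrightarrow> 0" by blast
  then show "\<exists>A. (\<forall>n. A n \<in> sets M) \<and>
     (\<forall>n. {\<omega> \<in> space M. dist (f n \<omega>) c \<ge> \<epsilon>} \<subseteq> A n) \<and> (\<lambda>n. measure M (A n)) \<longlonglongrightarrow> 0"
    by (intro exI[of _ A]) (auto simp: subset_eq not_le[symmetric])
qed

context prob_space
begin

lemma conv_prob_tendsto:
  assumes "x \<longlonglongrightarrow> c"
  shows "conv_prob M (\<lambda>n _. x n) c"
proof (rule conv_probI)
  fix \<epsilon> :: real assume "\<epsilon> > 0"
  with assms have "\<forall>\<^sub>F n in sequentially. dist (x n) c < \<epsilon>" by (auto simp: tendsto_iff)
  then have "\<forall>\<^sub>F n in sequentially. measure M (if dist (x n) c < \<epsilon> then {} else space M) = 0"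
    by eventually_elim simp
  then show "\<exists>A. (\<forall>n. A n \<in> sets M) \<and>
     (\<forall>n. \<forall>\<omega>\<in>space M. \<omega> \<notin> A n \<longrightarrow> dist (x n) c < \<epsilon>) \<and> (\<lambda>n. measure M (A n)) \<longlonglongrightarrow> 0"
    by (intro exI[of _ "\<lambda>n. if dist (x n) c < \<epsilon> then {} else space M"]) (auto intro: tendsto_eventually)
qed

lemma measure_Un_tendsto_0:
  assumes "\<And>n. A n \<in> sets M" "\<And>n. B n \<in> sets M"
    and "(\<lambda>n. measure M (A n)) \<longlonglongrightarrow> 0" "(\<lambda>n. measure M (B n)) \<longlonglongrightarrow> 0"
  shows "(\<lambda>n. measure M (A n \<union> B n)) \<longlonglongrightarrow> 0"
proof (rule tendsto_sandwich[OF _ _ tendsto_const])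
  show "(\<lambda>n. measure M (A n) + measure M (B n)) \<longlonglongrightarrow> 0"
    using tendsto_add[OF assms(3,4)] by simp
  show "\<forall>\<^sub>F n in sequentially. prob (A n \<union> B n) \<le> prob (A n) + prob (B n)"
    using assms by (intro always_eventually allI measure_Un_le) auto
qed simp

lemma conv_prob_compose:
  fixes f :: "nat \<Rightarrow> 'a \<Rightarrow> 'b::metric_space" and g :: "'b \<Rightarrow> 'c::metric_space"
  assumes "conv_prob M f c" "isCont g c"
  shows "conv_prob M (\<lambda>n \<omega>. g (f n \<omega>)) (g c)"
proof (rule conv_probI)
  fix \<epsilon> :: real assume "\<epsilon> > 0"
  with assms(2) obtain d where d: "d > 0" "\<And>x. dist x c < d \<Longrightarrow> dist (g x) (g c) < \<epsilon>"
    unfolding continuous_at by (metis continuous_at continuous_at_eps_delta)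
  from conv_probE[OF assms(1) d(1)] obtain A where "\<And>n. A n \<in> sets M" "\<And>n \<omega>. \<omega> \<in> space M \<Longrightarrow> \<omega> \<notin> A n \<Longrightarrow> dist (f n \<omega>) c < d"
    "(\<lambda>n. measure M (A n)) \<longlonglongrightarrow> 0" by blast
  then show "\<exists>A. (\<forall>n. A n \<in> sets M) \<and>
     (\<forall>n. \<forall>\<omega>\<in>space M. \<omega> \<notin> A n \<longrightarrow> dist (g (f n \<omega>)) (g c) < \<epsilon>) \<and> (\<lambda>n. measure M (A n)) \<longlonglongrightarrow> 0"
    using d(2) by (intro exI[of _ A]) auto
qed

lemma conv_prob_Pair:
  assumes "conv_prob M f c" "conv_prob M g d"
  shows "conv_prob M (\<lambda>n \<omega>. (f n \<omega>, g n \<omega>)) (c, d)"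
proof (rule conv_probI)
  fix \<epsilon> :: real assume \<epsilon>: "\<epsilon> > 0"
  then have e2: "\<epsilon>/2 > 0" by simp
  from conv_probE[OF assms(1) e2] obtain A where A: "\<And>n. A n \<in> sets M" "\<And>n \<omega>. \<omega> \<in> space M \<Longrightarrow> \<omega> \<notin> A n \<Longrightarrow> dist (f n \<omega>) c < \<epsilon>/2"
    "(\<lambda>n. measure M (A n)) \<longlonglongrightarrow> 0" by blast
  from conv_probE[OF assms(2) e2] obtain B where B: "\<And>n. B n \<in> sets M" "\<And>n \<omega>. \<omega> \<in> space M \<Longrightarrow> \<omega> \<notin> B n \<Longrightarrow> dist (g n \<omega>) d < \<epsilon>/2"
    "(\<lambda>n. measure M (B n)) \<longlonglongrightarrow> 0" by blast
  have *: "dist (x, y) (c, d) < \<epsilon>" if "dist x c < \<epsilon>/2" "dist y d < \<epsilon>/2" for x y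
  proof -
    have "dist (x, y) (c, d) \<le> \<bar>dist x c\<bar> + \<bar>dist y d\<bar>"
      unfolding dist_Pair_Pair by (rule sqrt_sum_squares_le_sum_abs)
    then show ?thesis using that by simp
  qed
  show "\<exists>A. (\<forall>n. A n \<in> sets M) \<and>
     (\<forall>n. \<forall>\<omega>\<in>space M. \<omega> \<notin> A n \<longrightarrow> dist (f n \<omega>, g n \<omega>) (c, d) < \<epsilon>) \<and> (\<lambda>n. measure M (A n)) \<longlonglongrightarrow> 0"
    using A B by (intro exI[of _ "\<lambda>n. A n \<union> B n"]) (auto intro!: * measure_Un_tendsto_0)
qed

lemma conv_prob_compose2:
  assumes "conv_prob M f c" "conv_prob M g d" "isCont (\<lambda>(x, y). h x y) (c, d)"
  shows "conv_prob M (\<lambda>n \<omega>. h (f n \<omega>) (g n \<omega>)) (h c d)"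
  using conv_prob_compose[OF conv_prob_Pair[OF assms(1,2)] assms(3)] by simp

lemma conv_prob_add:
  fixes f g :: "nat \<Rightarrow> 'a \<Rightarrow> real"
  assumes "conv_prob M f c" "conv_prob M g d"
  shows "conv_prob M (\<lambda>n \<omega>. f n \<omega> + g n \<omega>) (c + d)"
  by (rule conv_prob_compose2[OF assms]) (auto simp: case_prod_unfold intro!: continuous_intros)

lemma conv_prob_diff:
  fixes f g :: "nat \<Rightarrow> 'a \<Rightarrow> real"
  assumes "conv_prob M f c" "conv_prob M g d"
  shows "conv_prob M (\<lambda>n \<omega>. f n \<omega> - g n \<omega>) (c - d)"
  by (rule conv_prob_compose2[OF assms]) (auto simp: case_prod_unfold intro!: continuous_intros)

lemma conv_prob_mult:
  fixes f g :: "nat \<Rightarrow> 'a \<Rightarrow> real"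
  assumes "conv_prob M f c" "conv_prob M g d"
  shows "conv_prob M (\<lambda>n \<omega>. f n \<omega> * g n \<omega>) (c * d)"
  by (rule conv_prob_compose2[OF assms]) (auto simp: case_prod_unfold intro!: continuous_intros)

lemma conv_prob_divide:
  fixes f g :: "nat \<Rightarrow> 'a \<Rightarrow> real"
  assumes "conv_prob M f c" "conv_prob M g d" "d \<noteq> 0"
  shows "conv_prob M (\<lambda>n \<omega>. f n \<omega> / g n \<omega>) (c / d)"
proof (rule conv_prob_compose2[OF assms(1,2)])
  show "isCont (\<lambda>(x, y). x / y) (c, d)"
    using assms(3) by (auto simp: case_prod_unfold intro!: continuous_intros)
qed

lemma conv_prob_squeeze:
  fixes g :: "nat \<Rightarrow> 'a \<Rightarrow> real"
  assumes "conv_prob M g 0"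
    and "\<And>n. A n \<in> sets M" "(\<lambda>n. measure M (A n)) \<longlonglongrightarrow> 0"
    and "\<forall>\<^sub>F n in sequentially. \<forall>\<omega>\<in>space M - A n. dist (f n \<omega>) c \<le> g n \<omega>"
  shows "conv_prob M f c"
proof (rule conv_probI)
  fix \<epsilon> :: real assume \<epsilon>: "\<epsilon> > 0"
  from conv_probE[OF assms(1) \<epsilon>] obtain B where B: "\<And>n. B n \<in> sets M" "\<And>n \<omega>. \<omega> \<in> space M \<Longrightarrow> \<omega> \<notin> B n \<Longrightarrow> dist (g n \<omega>) 0 < \<epsilon>"
    "(\<lambda>n. measure M (B n)) \<longlonglongrightarrow> 0" by blast
  from assms(4) obtain N where N: "\<And>n \<omega>. n \<ge> N \<Longrightarrow> \<omega>\<in>space M - A n \<Longrightarrow> dist (f n \<omega>) c \<le> g n \<omega>"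
    by (auto simp: eventually_sequentially)
  \<comment> \<open>The bound may fail for the finitely many \<open>n < N\<close>; declaring the
    whole space exceptional there keeps \<open>C\<close> a valid cover for every index without
    changing the limit.\<close>
  define C where "C n = (if n \<ge> N then A n \<union> B n else space M)" for n
  have "(\<lambda>n. measure M (C n)) \<longlonglongrightarrow> 0"
  proof (rule Lim_transform_eventually[OF measure_Un_tendsto_0[OF assms(2) B(1) assms(3) B(3)]])
    show "\<forall>\<^sub>F n in sequentially. prob (A n \<union> B n) = prob (C n)"
      using eventually_ge_at_top[of N] by eventually_elim (simp add: C_def)
  qed
  moreover have "dist (f n \<omega>) c < \<epsilon>" if "\<omega> \<in> space M" "\<omega> \<notin> C n" for n \<omega>
    using that N[of n \<omega>] B(2)[of \<omega> n] by (auto simp: C_def dist_real_def split: if_splits)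
  moreover have "C n \<in> sets M" for n using assms(2) B(1) by (auto simp: C_def)
  ultimately show "\<exists>A. (\<forall>n. A n \<in> sets M) \<and>
     (\<forall>n. \<forall>\<omega>\<in>space M. \<omega> \<notin> A n \<longrightarrow> dist (f n \<omega>) c < \<epsilon>) \<and> (\<lambda>n. measure M (A n)) \<longlonglongrightarrow> 0"
    by (intro exI[of _ C]) auto
qed

lemma conv_prob_squeeze':
  fixes g :: "nat \<Rightarrow> 'a \<Rightarrow> real"
  assumes "conv_prob M g 0"
    and "\<And>n \<omega>. \<omega> \<in> space M \<Longrightarrow> dist (f n \<omega>) c \<le> g n \<omega>"
  shows "conv_prob M f c"
  by (rule conv_prob_squeeze[OF assms(1), of "\<lambda>_. {}"]) (use assms(2) in auto)

lemma conv_prob_L1: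
  fixes Z :: "nat \<Rightarrow> 'a \<Rightarrow> real"
  assumes [measurable]: "\<And>n. integrable M (Z n)" and nonneg: "\<And>n \<omega>. \<omega> \<in> space M \<Longrightarrow> 0 \<le> Z n \<omega>"
    and lim: "(\<lambda>n. expectation (Z n)) \<longlonglongrightarrow> 0"
  shows "conv_prob M Z 0"
proof (rule conv_probI)
  fix \<epsilon> :: real assume \<epsilon>: "\<epsilon> > 0"
  have le: "prob {\<omega> \<in> space M. Z n \<omega> \<ge> \<epsilon>} \<le> expectation (Z n) / \<epsilon>" for n
    using \<epsilon> by (intro integral_Markov_inequality_measure[where A="{}"])
      (auto intro: assms intro!: AE_I2 nonneg)
  have "(\<lambda>n. prob {\<omega> \<in> space M. Z n \<omega> \<ge> \<epsilon>}) \<longlonglongrightarrow> 0"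
    by (rule tendsto_sandwich[OF _ always_eventually tendsto_const tendsto_divide_zero[OF lim, of \<epsilon>]])
      (use le \<epsilon> in auto)
  then show "\<exists>A. (\<forall>n. A n \<in> sets M) \<and>
     (\<forall>n. \<forall>\<omega>\<in>space M. \<omega> \<notin> A n \<longrightarrow> dist (Z n \<omega>) 0 < \<epsilon>) \<and> (\<lambda>n. measure M (A n)) \<longlonglongrightarrow> 0"
    using nonneg by (intro exI[of _ "\<lambda>n. {\<omega> \<in> space M. Z n \<omega> \<ge> \<epsilon>}"]) (auto simp: dist_real_def)
qed

text \<open>A sequence bounded in mean is tight, so a factor tending to zero in probability wins.
  The truncation level of \<open>Z\<close> depends on the tolerated mass, hence so do the
  exceptional sets; \<open>conv_prob\<close> asks for a single sequence of sets, which a diagonal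
  intersection supplies.\<close>

lemma conv_prob_mult_bounded:
  fixes Z f :: "nat \<Rightarrow> 'a \<Rightarrow> real"
  assumes f: "conv_prob M f 0" and [measurable]: "\<And>n. integrable M (Z n)"
    and nonneg: "\<And>n \<omega>. \<omega> \<in> space M \<Longrightarrow> 0 \<le> Z n \<omega>"
    and bound: "\<And>n. expectation (Z n) \<le> C"
  shows "conv_prob M (\<lambda>n \<omega>. f n \<omega> * Z n \<omega>) 0"
proof -
  have C: "C \<ge> 0" using bound[of 0] Bochner_Integration.integral_nonneg[of M "Z 0"] nonneg by fastforce
  have ev: "\<exists>A. (\<forall>n. A n \<in> sets M) \<and>
      (\<forall>n. \<forall>\<omega>\<in>space M. \<omega> \<notin> A n \<longrightarrow> dist (f n \<omega> * Z n \<omega>) 0 < \<epsilon>) \<and> (\<forall>\<^sub>F n in sequentially. measure M (A n) < \<eta>)"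
    if \<epsilon>: "\<epsilon> > 0" and \<eta>: "\<eta> > 0" for \<epsilon> \<eta> :: real
  proof -
    \<comment> \<open>Markov's inequality leaves mass at most \<open>\<eta> / 2\<close> where
      \<open>Z\<close> reaches \<open>K\<close>; the added 1 keeps \<open>K\<close> positive when
      \<open>C = 0\<close>.\<close>
    define K where "K = 2 * (C + 1) / \<eta>"
    have K: "K > 0" using C \<eta> by (simp add: K_def)
    have eK: "\<epsilon> / K > 0" using K \<epsilon> by simp
    from conv_probE[OF f eK] obtain B where B: "\<And>n. B n \<in> sets M" "\<And>n \<omega>. \<omega> \<in> space M \<Longrightarrow> \<omega> \<notin> B n \<Longrightarrow> dist (f n \<omega>) 0 < \<epsilon>/K"
      "(\<lambda>n. measure M (B n)) \<longlonglongrightarrow> 0" by blast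
    define D where "D n = {\<omega> \<in> space M. Z n \<omega> \<ge> K}" for n
    have D[measurable]: "D n \<in> sets M" for n by (auto simp: D_def)
    have le: "prob (D n) \<le> \<eta> / 2" for n
    proof -
      have "prob (D n) \<le> expectation (Z n) / K"
        unfolding D_def using K by (intro integral_Markov_inequality_measure[where A="{}"])
          (auto intro: assms intro!: AE_I2 nonneg)
      also have "\<dots> \<le> (C + 1) / K" using bound[of n] K by (intro divide_right_mono) auto
      also have "\<dots> = \<eta> / 2" using C \<eta> by (simp add: K_def field_simps)
      finally show ?thesis .
    qed
    have small: "\<forall>\<^sub>F n in sequentially. prob (B n) < \<eta> / 2"
      using B(3) \<eta> by (intro order_tendstoD(2)) auto
    have "dist (f n \<omega> * Z n \<omega>) 0 < \<epsilon>" if "\<omega> \<in> space M" "\<omega> \<notin> B n \<union> D n" for n \<omega>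
    proof -
      have z: "0 \<le> Z n \<omega>" "Z n \<omega> < K" and ff: "\<bar>f n \<omega>\<bar> < \<epsilon> / K"
        using that nonneg B(2)[of \<omega> n] by (auto simp: D_def)
      have "\<bar>f n \<omega> * Z n \<omega>\<bar> \<le> \<bar>f n \<omega>\<bar> * K" using z by (auto simp: abs_mult intro!: mult_left_mono)
      also have "\<dots> < \<epsilon>" using ff K by (simp add: field_simps)
      finally show ?thesis by simp
    qed
    moreover have "\<forall>\<^sub>F n in sequentially. measure M (B n \<union> D n) < \<eta>"
      using small
    proof eventually_elim
      case (elim n)
      have "measure M (B n \<union> D n) \<le> prob (B n) + prob (D n)"
        by (intro measure_Un_le B D)
      then show ?case using elim le[of n] by linarith
    qed
    ultimately show ?thesis using B(1) by (intro exI[of _ "\<lambda>n. B n \<union> D n"]) auto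
  qed
  show ?thesis
  proof (rule conv_probI)
    fix \<epsilon> :: real assume \<epsilon>: "\<epsilon> > 0"
    obtain A where A: "\<And>r n. A r n \<in> sets M" "\<And>r n \<omega>. \<omega>\<in>space M \<Longrightarrow> \<omega> \<notin> A r n \<Longrightarrow> dist (f n \<omega> * Z n \<omega>) 0 < \<epsilon>"
      "\<And>r::nat. \<forall>\<^sub>F n in sequentially. measure M (A r n) < inverse (Suc r)"
    proof -
      have "\<forall>r::nat. \<exists>A. (\<forall>n. A n \<in> sets M) \<and>
        (\<forall>n. \<forall>\<omega>\<in>space M. \<omega> \<notin> A n \<longrightarrow> dist (f n \<omega> * Z n \<omega>) 0 < \<epsilon>) \<and> (\<forall>\<^sub>F n in sequentially. measure M (A n) < inverse (Suc r))"
        using ev[OF \<epsilon>] by simp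
      then show ?thesis using that by metis
    qed
    \<comment> \<open>A point outside \<open>B n\<close> avoids some \<open>A r n\<close>, and any
      one of these controls the product. For fixed \<open>r\<close> and \<open>n \<ge> r\<close> the
      set \<open>B n\<close> lies in \<open>A r n\<close>, so its mass is eventually below every
      \<open>inverse (Suc r)\<close>.\<close>
    define B where "B n = space M \<inter> (\<Inter>r\<in>{..n}. A r n)" for n
    have B: "B n \<in> sets M" for n unfolding B_def using A(1) by (intro sets.Int sets.finite_INT) auto
    have "(\<lambda>n. measure M (B n)) \<longlonglongrightarrow> 0"
    proof (rule LIMSEQ_I)
      fix e :: real assume "e > 0"
      then obtain r where r: "inverse (real (Suc r)) < e" using reals_Archimedean by blast
      from A(3)[of r] obtain N where N: "\<And>n. n \<ge> N \<Longrightarrow> measure M (A r n) < inverse (Suc r)"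
        by (auto simp: eventually_sequentially)
      show "\<exists>no. \<forall>n\<ge>no. norm (measure M (B n) - 0) < e"
      proof (intro exI[of _ "max N r"] allI impI)
        fix n assume n: "n \<ge> max N r"
        have "measure M (B n) \<le> measure M (A r n)"
          using n A(1) by (intro finite_measure_mono) (auto simp: B_def)
        then show "norm (measure M (B n) - 0) < e" using N[of n] n r by simp
      qed
    qed
    then show "\<exists>A. (\<forall>n. A n \<in> sets M) \<and>
       (\<forall>n. \<forall>\<omega>\<in>space M. \<omega> \<notin> A n \<longrightarrow> dist (f n \<omega> * Z n \<omega>) 0 < \<epsilon>) \<and> (\<lambda>n. measure M (A n)) \<longlonglongrightarrow> 0"
      using B A(2) by (intro exI[of _ B]) (auto simp: B_def)
  qed
qed

text \<open>A non-measurable set has \<open>measure\<close> 0 by convention, so monotonicity only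
  asks the covering sets \<open>A n\<close> to be measurable and the deviation event itself may be
  arbitrary.\<close>

lemma conv_probD:
  fixes f :: "nat \<Rightarrow> 'a \<Rightarrow> real"
  assumes "conv_prob M f c" "\<epsilon> > 0"
  shows "(\<lambda>n. measure M {\<omega> \<in> space M. \<bar>f n \<omega> - c\<bar> > \<epsilon>}) \<longlonglongrightarrow> 0"
proof -
  from conv_probE[OF assms] obtain A where A: "\<And>n. A n \<in> sets M" "\<And>n \<omega>. \<omega> \<in> space M \<Longrightarrow> \<omega> \<notin> A n \<Longrightarrow> dist (f n \<omega>) c < \<epsilon>"
    "(\<lambda>n. measure M (A n)) \<longlonglongrightarrow> 0" by blast
  have "prob {\<omega> \<in> space M. \<bar>f n \<omega> - c\<bar> > \<epsilon>} \<le> prob (A n)" for n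
    using A(1)[of n] A(2)[of _ n] by (intro finite_measure_mono) (force simp: dist_real_def)+
  then show ?thesis
    by (intro tendsto_sandwich[OF _ _ tendsto_const A(3)]) auto
qed

end

section \<open>Layer-cake integrals\<close>

lemma summable_power4_exp:
  fixes \<delta> :: real
  assumes "\<delta> > 0"
  shows "summable (\<lambda>n. (real n + 1) ^ 4 * exp (- \<delta> * real n))"
proof (rule summable_comparison_test_bigo)
  show "summable (\<lambda>n. norm (1 / real n ^ 2))"
    using inverse_power_summable[of 2] by (simp add: inverse_eq_divide)
  show "(\<lambda>n. (real n + 1) ^ 4 * exp (- \<delta> * real n)) \<in> O(\<lambda>n. 1 / real n ^ 2)"
    using assms by real_asymp
qed

text \<open>Layer cake over the integer levels of \<open>Z\<close>.\<close>
lemma (in finite_measure) fourth_moment_le: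
  fixes Z :: "'a \<Rightarrow> real"
  assumes [measurable]: "Z \<in> borel_measurable M" "A \<in> sets M" and nonneg: "\<And>x. x \<in> space M \<Longrightarrow> 0 \<le> Z x"
    and \<delta>: "\<delta> > 0" and tail: "\<And>n::nat. measure M {x \<in> A. Z x \<ge> real n} \<le> c * exp (- \<delta> * real n)"
  shows "integrable M (\<lambda>x. indicator A x * Z x ^ 4)"
    and "(\<integral>x. indicator A x * Z x ^ 4 \<partial>M) \<le> c * (\<Sum>n. (real n + 1) ^ 4 * exp (- \<delta> * real n))"
proof -
  let ?S = "\<Sum>n. (real n + 1) ^ 4 * exp (- \<delta> * real n)"
  have AM: "A \<subseteq> space M" using sets.sets_into_space[OF assms(2)] .
  have c: "c \<ge> 0" using order.trans[OF measure_nonneg tail[of 0]] by simp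
  have L[measurable]: "{x \<in> A. Z x \<ge> real n} \<in> sets M" for n
  proof -
    have "{x \<in> A. Z x \<ge> real n} = A \<inter> {x \<in> space M. Z x \<ge> real n}" using AM by auto
    then show ?thesis by simp
  qed
  have "(\<integral>\<^sup>+x. ennreal (indicator A x * Z x ^ 4) \<partial>M)
     \<le> (\<integral>\<^sup>+x. (\<Sum>n. ennreal ((real n + 1) ^ 4) * indicator {x \<in> A. Z x \<ge> real n} x) \<partial>M)"
  proof (rule nn_integral_mono)
    fix x assume x: "x \<in> space M"
    show "ennreal (indicator A x * Z x ^ 4) \<le> (\<Sum>n. ennreal ((real n + 1) ^ 4) * indicator {x \<in> A. Z x \<ge> real n} x)"
    proof (cases "x \<in> A")
      case True
      define n where "n = nat \<lfloor>Z x\<rfloor>"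
      have n: "real n \<le> Z x" "Z x \<le> real n + 1" using nonneg[OF x] by (auto simp: n_def)
      have "ennreal (indicator A x * Z x ^ 4) \<le> ennreal ((real n + 1) ^ 4)"
        using True n nonneg[OF x] by (intro ennreal_leI) (auto intro!: power_mono)
      also have "\<dots> = (\<Sum>k\<in>{n}. ennreal ((real k + 1) ^ 4) * indicator {x \<in> A. Z x \<ge> real k} x)"
        using True n by simp
      also have "\<dots> \<le> (\<Sum>n. ennreal ((real n + 1) ^ 4) * indicator {x \<in> A. Z x \<ge> real n} x)"
        by (rule sum_le_suminf) auto
      finally show ?thesis .
    qed simp
  qed
  also have "\<dots> = (\<Sum>n. ennreal ((real n + 1) ^ 4) * emeasure M {x \<in> A. Z x \<ge> real n})"
    by (subst nn_integral_suminf) (auto simp: nn_integral_cmult_indicator)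
  also have "\<dots> \<le> (\<Sum>n. ennreal (c * ((real n + 1) ^ 4 * exp (- \<delta> * real n))))"
  proof (intro suminf_le allI)
    fix n
    have "ennreal ((real n + 1) ^ 4) * emeasure M {x \<in> A. Z x \<ge> real n} = ennreal ((real n + 1) ^ 4 * measure M {x \<in> A. Z x \<ge> real n})"
      by (simp add: emeasure_eq_measure ennreal_mult)
    also have "\<dots> \<le> ennreal ((real n + 1) ^ 4 * (c * exp (- \<delta> * real n)))"
      by (intro ennreal_leI mult_left_mono tail) auto
    finally show "ennreal ((real n + 1) ^ 4) * emeasure M {x \<in> A. Z x \<ge> real n} \<le> ennreal (c * ((real n + 1) ^ 4 * exp (- \<delta> * real n)))"
      by (simp add: mult_ac)
  qed auto
  also have "\<dots> = ennreal (c * ?S)"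
    using summable_power4_exp[OF \<delta>] c
    by (subst suminf_ennreal2) (auto simp: suminf_mult intro!: summable_mult)
  finally have *: "(\<integral>\<^sup>+x. ennreal (indicator A x * Z x ^ 4) \<partial>M) \<le> ennreal (c * ?S)" .
  show int: "integrable M (\<lambda>x. indicator A x * Z x ^ 4)"
    using * by (intro integrableI_bounded) (auto simp: top_unique less_top[symmetric] abs_mult)
  have "ennreal (\<integral>x. indicator A x * Z x ^ 4 \<partial>M) = (\<integral>\<^sup>+x. ennreal (indicator A x * Z x ^ 4) \<partial>M)"
    by (rule nn_integral_eq_integral[symmetric, OF int]) auto
  also note *
  finally show "(\<integral>x. indicator A x * Z x ^ 4 \<partial>M) \<le> c * ?S"
    using c summable_power4_exp[OF \<delta>]
    by (subst (asm) ennreal_le_iff) (auto intro!: mult_nonneg_nonneg suminf_nonneg)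
qed

section \<open>Bivariate layer-cake formula and its passage to the limit\<close>

lemma (in pair_sigma_finite) integrable_fst_mult_snd:
  fixes u :: "'a \<Rightarrow> real" and v :: "'b \<Rightarrow> real"
  assumes "integrable M1 u" "integrable M2 v"
  shows "integrable (M1 \<Otimes>\<^sub>M M2) (\<lambda>p. u (fst p) * v (snd p))"
    and "(\<integral>p. u (fst p) * v (snd p) \<partial>(M1 \<Otimes>\<^sub>M M2)) = (\<integral>x. u x \<partial>M1) * (\<integral>y. v y \<partial>M2)"
proof -
  have [measurable]: "u \<in> borel_measurable M1" "v \<in> borel_measurable M2" using assms by auto
  show int: "integrable (M1 \<Otimes>\<^sub>M M2) (\<lambda>p. u (fst p) * v (snd p))"
    using assms by (intro Fubini_integrable) (auto simp: abs_mult)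
  show "(\<integral>p. u (fst p) * v (snd p) \<partial>(M1 \<Otimes>\<^sub>M M2)) = (\<integral>x. u x \<partial>M1) * (\<integral>y. v y \<partial>M2)"
    using integral_fst'[OF int] by simp
qed

lemma integrable_exp_neg_abs:
  fixes c :: real
  assumes "c > 0"
  shows "integrable lborel (\<lambda>s::real. exp (- c * \<bar>s\<bar>))"
proof -
  have ed: "integrable lborel (exponential_density c)"
  proof -
    interpret prob_space "density lborel (exponential_density c)"
      by (rule prob_space_exponential_density[OF assms])
    have "integrable (density lborel (exponential_density c)) (\<lambda>_. 1::real)" by simp
    then show ?thesis
      using assms by (subst (asm) integrable_density) (auto simp: exponential_density_def[abs_def])
  qed
  from lborel_integrable_real_affine[OF ed, of "-1" 0]
  have ed': "integrable lborel (\<lambda>s. exponential_density c (- s))" by simp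
  show ?thesis
  proof (rule Bochner_Integration.integrable_bound)
    show "integrable lborel (\<lambda>s. (exponential_density c s + exponential_density c (- s)) / c)"
      using ed ed' by simp
    show "AE s in lborel. norm (exp (- c * \<bar>s\<bar>)) \<le> norm ((exponential_density c s + exponential_density c (- s)) / c)"
      using assms by (intro AE_I2) (auto simp: exponential_density_def mult.commute field_simps split: if_splits)
  qed simp
qed

text \<open>Signed layer-cake kernel: as a function of \<open>s\<close> it is the indicator of the
  interval between 0 and \<open>x\<close>, negated for negative \<open>x\<close>. Subtracting the
  indicator of \<open>s < 0\<close> makes it integrable over the whole line, with integral
  \<open>x\<close> for either sign.\<close>

definition layer :: "real \<Rightarrow> real \<Rightarrow> real" where
  "layer s x = (if x > s then 1 else 0) - (if s < 0 then 1 else 0)"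

lemma measurable_layer[measurable]:
  "(\<lambda>x. layer (f x) (g x)) \<in> borel_measurable N"
  if [measurable]: "f \<in> borel_measurable N" "g \<in> borel_measurable N"
  unfolding layer_def by measurable

lemma abs_layer_le: "\<bar>layer s x\<bar> \<le> 1"
  by (auto simp: layer_def)

lemma layer_eq_indicator: "layer s x = indicator {0..<x} s - indicator {x..<0} s"
  by (auto simp: layer_def indicator_def)

lemma integral_layer:
  "integrable lborel (\<lambda>s. layer s x)" "(\<integral>s. layer s x \<partial>lborel) = x"
  unfolding layer_eq_indicator by (cases "x \<ge> 0"; simp)+

text \<open>A minimum is at most the geometric mean. Two bounds that each decay in one variable only
  thus become a product decaying in both, which is integrable over the plane; the rate is halved in
  return.\<close>

lemma min_le_exp_mult:
  fixes z C \<delta> s t :: real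
  assumes "z \<le> C * exp (- \<delta> * \<bar>s\<bar>)" "z \<le> C * exp (- \<delta> * \<bar>t\<bar>)" "C \<ge> 0" "\<delta> > 0"
  shows "z \<le> C * (exp (- (\<delta>/2) * \<bar>s\<bar>) * exp (- (\<delta>/2) * \<bar>t\<bar>))"
proof -
  have *: "exp (- \<delta> * \<bar>u\<bar>) \<le> exp (- (\<delta>/2) * \<bar>s\<bar>) * exp (- (\<delta>/2) * \<bar>t\<bar>)" if "\<bar>u\<bar> \<ge> \<bar>s\<bar>" "\<bar>u\<bar> \<ge> \<bar>t\<bar>" for u
  proof -
    have "\<delta> * (\<bar>s\<bar> + \<bar>t\<bar>) \<le> \<delta> * (2 * \<bar>u\<bar>)" using that assms by (intro mult_left_mono) auto
    then show ?thesis unfolding exp_add[symmetric] by (simp add: algebra_simps)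
  qed
  show ?thesis
  proof (cases "\<bar>s\<bar> \<ge> \<bar>t\<bar>")
    case True
    with *[of s] assms(1,3) show ?thesis by (meson order.refl order.trans mult_left_mono)
  next
    case False
    with *[of t] assms(2,3) show ?thesis by (meson order.refl order.trans mult_left_mono linear)
  qed
qed

text \<open>Fubini applied to \<open>a x * b x\<close> written as a double integral of kernels. Each
  kernel is at most 1 in absolute value, so the product is controlled by either marginal tail, and
  the smaller of the two gives an integrable majorant. The majorant is recorded as the third claim
  because dominated convergence reuses it.\<close>

lemma (in prob_space) expectation_mult_layer:
  fixes a b :: "'a \<Rightarrow> real"
  assumes [measurable]: "a \<in> borel_measurable M" "b \<in> borel_measurable M"
    and C: "C \<ge> 0" "\<delta> > 0"
    and ta: "\<And>s. expectation (\<lambda>x. \<bar>layer s (a x)\<bar>) \<le> C * exp (- \<delta> * \<bar>s\<bar>)"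
    and tb: "\<And>s. expectation (\<lambda>x. \<bar>layer s (b x)\<bar>) \<le> C * exp (- \<delta> * \<bar>s\<bar>)"
  shows "integrable M (\<lambda>x. a x * b x)"
    and "(\<integral>p. expectation (\<lambda>x. layer (fst p) (a x) * layer (snd p) (b x)) \<partial>(lborel \<Otimes>\<^sub>M lborel)) = expectation (\<lambda>x. a x * b x)"
    and "\<And>s t. \<bar>expectation (\<lambda>x. layer s (a x) * layer t (b x))\<bar> \<le> C * (exp (- (\<delta>/2) * \<bar>s\<bar>) * exp (- (\<delta>/2) * \<bar>t\<bar>))"
proof -
  let ?L = "lborel \<Otimes>\<^sub>M lborel :: (real \<times> real) measure"
  let ?f = "\<lambda>p x. layer (fst p) (a x) * layer (snd p) (b x)"
  let ?w = "\<lambda>p. C * (exp (- (\<delta>/2) * \<bar>fst p\<bar>) * exp (- (\<delta>/2) * \<bar>snd p\<bar>))"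
  interpret P: pair_sigma_finite ?L M ..
  have bint: "integrable M (\<lambda>x. ?f p x)" "integrable M (\<lambda>x. \<bar>?f p x\<bar>)"
    "integrable M (\<lambda>x. \<bar>layer s (a x)\<bar>)" "integrable M (\<lambda>x. \<bar>layer s (b x)\<bar>)" for p s
    by (rule integrable_const_bound[where B=1]; auto simp: abs_mult intro!: mult_le_one abs_layer_le)+
  have bnd: "expectation (\<lambda>x. \<bar>?f p x\<bar>) \<le> ?w p" for p
  proof (rule min_le_exp_mult[OF _ _ C])
    show "expectation (\<lambda>x. \<bar>?f p x\<bar>) \<le> C * exp (- \<delta> * \<bar>fst p\<bar>)"
      by (rule order.trans[OF integral_mono ta])
        (auto intro: bint bint(2)[unfolded abs_mult] simp: abs_mult intro!: mult_left_le abs_layer_le)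
    show "expectation (\<lambda>x. \<bar>?f p x\<bar>) \<le> C * exp (- \<delta> * \<bar>snd p\<bar>)"
      by (rule order.trans[OF integral_mono tb])
        (auto intro: bint bint(2)[unfolded abs_mult] simp: abs_mult intro!: mult_left_le_one_le abs_layer_le)
  qed
  show "\<bar>expectation (\<lambda>x. layer s (a x) * layer t (b x))\<bar> \<le> C * (exp (- (\<delta>/2) * \<bar>s\<bar>) * exp (- (\<delta>/2) * \<bar>t\<bar>))" for s t
    using order.trans[OF integral_abs_bound bnd[of "(s,t)"]] by simp
  have w: "integrable ?L ?w"
    using C by (intro integrable_mult_right lborel_pair.integrable_fst_mult_snd integrable_exp_neg_abs) auto
  have int: "integrable (?L \<Otimes>\<^sub>M M) (\<lambda>z. ?f (fst z) (snd z))"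
  proof (rule P.Fubini_integrable)
    show "integrable ?L (\<lambda>p. \<integral>x. norm (?f (fst (p, x)) (snd (p, x))) \<partial>M)"
    proof (rule Bochner_Integration.integrable_bound[OF w])
      show "AE p in ?L. norm (\<integral>x. norm (?f (fst (p, x)) (snd (p, x))) \<partial>M) \<le> norm (?w p)"
        using bnd C by (intro AE_I2) auto
    qed (simp, measurable)
    show "AE p in ?L. integrable M (\<lambda>x. ?f (fst (p, x)) (snd (p, x)))"
      using bint by simp
  qed measurable
  have inner: "(\<integral>p. ?f p x \<partial>?L) = a x * b x" for x
    using lborel_pair.integrable_fst_mult_snd(2)[OF integral_layer(1) integral_layer(1)] integral_layer(2) by simp
  from int have int': "integrable (?L \<Otimes>\<^sub>M M) (case_prod ?f)" by (simp add: case_prod_unfold)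
  from P.integrable_snd[OF int'] show "integrable M (\<lambda>x. a x * b x)" by (simp add: inner)
  from P.Fubini_integral[OF int'] show "(\<integral>p. expectation (?f p) \<partial>?L) = expectation (\<lambda>x. a x * b x)"
    by (simp add: inner)
qed

text \<open>The absolute kernel is the indicator of the tail event on the side of \<open>s\<close>,
  so a bound on its mean for all \<open>s\<close> encodes both tails in one hypothesis.\<close>

lemma (in prob_space) expectation_layer:
  assumes [measurable]: "a \<in> borel_measurable M"
  shows "expectation (\<lambda>x. \<bar>layer s (a x)\<bar>) = (if s < 0 then prob {x \<in> space M. a x \<le> s} else prob {x \<in> space M. a x > s})"
proof (cases "s < 0")
  case True
  have "expectation (\<lambda>x. \<bar>layer s (a x)\<bar>) = expectation (indicator {x \<in> space M. a x \<le> s})"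
    using True by (intro Bochner_Integration.integral_cong) (auto simp: layer_def)
  then show ?thesis using True by simp
next
  case False
  have "expectation (\<lambda>x. \<bar>layer s (a x)\<bar>) = expectation (indicator {x \<in> space M. a x > s})"
    using False by (intro Bochner_Integration.integral_cong) (auto simp: layer_def)
  then show ?thesis using False by simp
qed

text \<open>Only joint and marginal survival probabilities enter, and their pointwise convergence
  therefore passes to the integrand of the layer-cake formula.\<close>

lemma (in prob_space) expectation_layer_mult:
  assumes [measurable]: "a \<in> borel_measurable M" "b \<in> borel_measurable M"
  shows "expectation (\<lambda>x. layer s (a x) * layer t (b x)) =
     prob {x \<in> space M. a x > s \<and> b x > t} - (if t < 0 then prob {x \<in> space M. a x > s} else 0)
      - (if s < 0 then prob {x \<in> space M. b x > t} else 0) + (if s < 0 \<and> t < 0 then 1 else 0)"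
proof -
  have "expectation (\<lambda>x. layer s (a x) * layer t (b x)) =
    expectation (\<lambda>x. indicator {x \<in> space M. a x > s \<and> b x > t} x
      - (if t < 0 then 1 else 0) * indicator {x \<in> space M. a x > s} x
      - (if s < 0 then 1 else 0) * indicator {x \<in> space M. b x > t} x + (if s < 0 \<and> t < 0 then 1 else 0))"
    by (intro Bochner_Integration.integral_cong) (auto simp: layer_def)
  also have "\<dots> = prob {x \<in> space M. a x > s \<and> b x > t} - (if t < 0 then prob {x \<in> space M. a x > s} else 0)
      - (if s < 0 then prob {x \<in> space M. b x > t} else 0) + (if s < 0 \<and> t < 0 then 1 else 0)"
    by (subst Bochner_Integration.integral_add Bochner_Integration.integral_diff; (simp add: prob_space less_top[symmetric])?)+
  finally show ?thesis .
qed

text \<open>The underlying spaces \<open>N n\<close> may change with \<open>n\<close>, since the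
  limit is taken by dominated convergence in the levels \<open>(s, t)\<close>, which live on one
  fixed plane.\<close>

lemma tendsto_expectation_mult:
  fixes N :: "nat \<Rightarrow> 'b measure" and N' :: "'c measure" and a b :: "nat \<Rightarrow> 'b \<Rightarrow> real" and a' b' :: "'c \<Rightarrow> real"
  assumes P: "\<And>n. prob_space (N n)" "prob_space N'"
    and m: "\<And>n. a n \<in> borel_measurable (N n)" "\<And>n. b n \<in> borel_measurable (N n)"
    and m': "a' \<in> borel_measurable N'" "b' \<in> borel_measurable N'"
    and C: "C \<ge> 0" "\<delta> > 0"
    and tails: "\<And>n s. (\<integral>x. \<bar>layer s (a n x)\<bar> \<partial>N n) \<le> C * exp (- \<delta> * \<bar>s\<bar>)"
      "\<And>n s. (\<integral>x. \<bar>layer s (b n x)\<bar> \<partial>N n) \<le> C * exp (- \<delta> * \<bar>s\<bar>)"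
    and lim_a: "\<And>s. (\<lambda>n. measure (N n) {x \<in> space (N n). a n x > s}) \<longlonglongrightarrow> measure N' {x \<in> space N'. a' x > s}"
    and lim_b: "\<And>s. (\<lambda>n. measure (N n) {x \<in> space (N n). b n x > s}) \<longlonglongrightarrow> measure N' {x \<in> space N'. b' x > s}"
    and lim: "\<And>s t. (\<lambda>n. measure (N n) {x \<in> space (N n). a n x > s \<and> b n x > t}) \<longlonglongrightarrow> measure N' {x \<in> space N'. a' x > s \<and> b' x > t}"
  shows "integrable N' (\<lambda>x. a' x * b' x)" and "(\<lambda>n. \<integral>x. a n x * b n x \<partial>N n) \<longlonglongrightarrow> (\<integral>x. a' x * b' x \<partial>N')"
proof -
  interpret N': prob_space N' by (rule P)
  \<comment> \<open>Both tail probabilities under \<open>N'\<close> are limits of those under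
    \<open>N n\<close>, so the limit law inherits the exponential bound and its integrability
    becomes a conclusion.\<close>
  have tail': "(\<integral>x. \<bar>layer s (g' x)\<bar> \<partial>N') \<le> C * exp (- \<delta> * \<bar>s\<bar>)"
    if [measurable]: "\<And>n. g n \<in> borel_measurable (N n)" "g' \<in> borel_measurable N'"
      and t: "\<And>n s. (\<integral>x. \<bar>layer s (g n x)\<bar> \<partial>N n) \<le> C * exp (- \<delta> * \<bar>s\<bar>)"
      and l: "\<And>s. (\<lambda>n. measure (N n) {x \<in> space (N n). g n x > s}) \<longlonglongrightarrow> measure N' {x \<in> space N'. g' x > s}"
    for g g' s
  proof (rule LIMSEQ_le_const2)
    have compl: "measure K {x \<in> space K. h x \<le> s} = 1 - measure K {x \<in> space K. h x > s}"
      if "prob_space K" and [measurable]: "h \<in> borel_measurable K" for K :: "'z measure" and h :: "'z \<Rightarrow> real"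
    proof -
      interpret K: prob_space K by fact
      have "{x \<in> space K. h x \<le> s} = space K - {x \<in> space K. h x > s}" by auto
      then show ?thesis by (simp add: K.prob_compl)
    qed
    show "(\<lambda>n. \<integral>x. \<bar>layer s (g n x)\<bar> \<partial>N n) \<longlonglongrightarrow> (\<integral>x. \<bar>layer s (g' x)\<bar> \<partial>N')"
      by (auto simp: prob_space.expectation_layer[OF P(1)] N'.expectation_layer compl[OF P(1)] compl[OF P(2)] that
        intro!: tendsto_diff l)
    show "\<exists>n0. \<forall>n\<ge>n0. (\<integral>x. \<bar>layer s (g n x)\<bar> \<partial>N n) \<le> C * exp (- \<delta> * \<bar>s\<bar>)" using t by blast
  qed
  note ta' = tail'[OF m(1) m'(1) tails(1) lim_a] and tb' = tail'[OF m(2) m'(2) tails(2) lim_b]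
  note n = prob_space.expectation_mult_layer[OF P(1) m C tails]
  note n' = N'.expectation_mult_layer[OF m' C ta' tb']
  note [measurable] = m m'
  show "integrable N' (\<lambda>x. a' x * b' x)" by (rule n')
  let ?w = "\<lambda>p. C * (exp (- (\<delta>/2) * \<bar>fst p\<bar>) * exp (- (\<delta>/2) * \<bar>snd p\<bar>))"
  have w: "integrable (lborel \<Otimes>\<^sub>M lborel :: (real \<times> real) measure) ?w"
    using C by (intro integrable_mult_right lborel_pair.integrable_fst_mult_snd integrable_exp_neg_abs) auto
  have "(\<lambda>n. \<integral>p. (\<integral>x. layer (fst p) (a n x) * layer (snd p) (b n x) \<partial>N n) \<partial>(lborel \<Otimes>\<^sub>M lborel))
    \<longlonglongrightarrow> (\<integral>p. (\<integral>x. layer (fst p) (a' x) * layer (snd p) (b' x) \<partial>N') \<partial>(lborel \<Otimes>\<^sub>M lborel))"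
  proof (rule integral_dominated_convergence[OF _ _ w])
    have meas: "(\<lambda>p. \<integral>x. layer (fst p) (g x) * layer (snd p) (h x) \<partial>K) \<in> borel_measurable (lborel \<Otimes>\<^sub>M lborel)"
      if "prob_space K" and [measurable]: "g \<in> borel_measurable K" "h \<in> borel_measurable K" for K :: "'z measure" and g h
    proof -
      interpret K: prob_space K by fact
      show ?thesis by measurable
    qed
    show "(\<lambda>p. \<integral>x. layer (fst p) (a' x) * layer (snd p) (b' x) \<partial>N') \<in> borel_measurable (lborel \<Otimes>\<^sub>M lborel)"
      by (rule meas[OF P(2) m'])
    show "(\<lambda>p. \<integral>x. layer (fst p) (a n x) * layer (snd p) (b n x) \<partial>N n) \<in> borel_measurable (lborel \<Otimes>\<^sub>M lborel)" for n
      by (rule meas[OF P(1) m])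
    show "AE p in lborel \<Otimes>\<^sub>M lborel. norm (\<integral>x. layer (fst p) (a n x) * layer (snd p) (b n x) \<partial>N n) \<le> ?w p" for n
      using n(3)[of n] by (intro AE_I2) simp
    show "AE p in lborel \<Otimes>\<^sub>M lborel. (\<lambda>n. \<integral>x. layer (fst p) (a n x) * layer (snd p) (b n x) \<partial>N n)
      \<longlonglongrightarrow> (\<integral>x. layer (fst p) (a' x) * layer (snd p) (b' x) \<partial>N')"
      unfolding prob_space.expectation_layer_mult[OF P(1) m] N'.expectation_layer_mult[OF m']
      by (intro AE_I2 tendsto_add tendsto_diff lim tendsto_const) (auto intro: lim_a lim_b)
  qed
  then show "(\<lambda>n. \<integral>x. a n x * b n x \<partial>N n) \<longlonglongrightarrow> (\<integral>x. a' x * b' x \<partial>N')"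
    unfolding n(2) n'(2) .
qed

section \<open>Uniform margins and the domain of attraction\<close>

text \<open>The range is required everywhere and not almost everywhere, as holds for 1 minus a
  distribution function; only the value 0, where the logarithm carries no information, is left to a
  null set.\<close>

locale unif_margins = prob_space M for M :: "'a measure" +
  fixes U :: "'d::finite \<Rightarrow> 'a \<Rightarrow> real"
  assumes U_measurable[measurable]: "\<And>l. U l \<in> borel_measurable M"
    and U_nonneg: "\<And>l \<omega>. 0 \<le> U l \<omega>" and U_le_1: "\<And>l \<omega>. U l \<omega> \<le> 1"
    and prob_U_less: "\<And>l c. 0 \<le> c \<Longrightarrow> c \<le> 1 \<Longrightarrow> prob {\<omega> \<in> space M. U l \<omega> < c} = c"
begin

lemma prob_U_le:
  assumes "0 \<le> c" "c \<le> 1"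
  shows "prob {\<omega> \<in> space M. U l \<omega> \<le> c} = c"
proof (cases "c = 1")
  case True
  then show ?thesis by (simp add: U_le_1 prob_space)
next
  case False
  show ?thesis
  proof (rule antisym)
    show "prob {\<omega> \<in> space M. U l \<omega> \<le> c} \<le> c"
    proof (rule field_le_epsilon)
      fix e :: real assume e: "e > 0"
      define c' where "c' = min 1 (c + e)"
      have "prob {\<omega> \<in> space M. U l \<omega> \<le> c} \<le> prob {\<omega> \<in> space M. U l \<omega> < c'}"
        using e assms False by (intro finite_measure_mono) (auto simp: c'_def)
      also have "\<dots> = c'" using e assms by (intro prob_U_less) (auto simp: c'_def)
      finally show "prob {\<omega> \<in> space M. U l \<omega> \<le> c} \<le> c + e" by (simp add: c'_def)
    qed
    have "c = prob {\<omega> \<in> space M. U l \<omega> < c}" using assms by (simp add: prob_U_less)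
    also have "\<dots> \<le> prob {\<omega> \<in> space M. U l \<omega> \<le> c}" by (intro finite_measure_mono) auto
    finally show "c \<le> prob {\<omega> \<in> space M. U l \<omega> \<le> c}" .
  qed
qed

lemma prob_U_less_le: "c \<ge> 0 \<Longrightarrow> prob {\<omega> \<in> space M. U l \<omega> < c} \<le> c"
  by (cases "c \<le> 1") (auto simp: prob_U_less intro: order.trans[OF prob_le_1])

lemma prob_U_le_le: "c \<ge> 0 \<Longrightarrow> prob {\<omega> \<in> space M. U l \<omega> \<le> c} \<le> c"
  by (cases "c \<le> 1") (auto simp: prob_U_le intro: order.trans[OF prob_le_1])

lemma AE_U_neq:
  assumes "0 \<le> c" "c \<le> 1"
  shows "AE \<omega> in M. U l \<omega> \<noteq> c"
proof -
  have "prob {\<omega> \<in> space M. U l \<omega> = c} = prob ({\<omega> \<in> space M. U l \<omega> \<le> c} - {\<omega> \<in> space M. U l \<omega> < c})"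
    by (intro arg_cong[where f=prob]) auto
  also have "\<dots> = 0"
    using assms by (subst finite_measure_Diff) (auto simp: prob_U_le prob_U_less)
  finally show ?thesis by (subst (asm) prob_eq_0) auto
qed

lemma AE_U_pos: "AE \<omega> in M. U l \<omega> > 0"
proof -
  have "AE \<omega> in M. U l \<omega> \<noteq> 0" by (rule AE_U_neq) auto
  then show ?thesis by eventually_elim (use U_nonneg[of l] in \<open>auto simp: less_le\<close>)
qed

end

text \<open>The probability integral transform. \<open>F\<close> may be flat and is not inverted;
  instead every level \<open>y\<close> strictly between 0 and 1 is attained by the intermediate
  value theorem, and monotonicity yields that \<open>F (Z \<omega>) < y\<close> has probability at
  most \<open>y\<close> while \<open>F (Z \<omega>) \<le> y\<close> has probability at least
  \<open>y\<close>. Approaching \<open>y\<close> by larger levels closes the gap.\<close>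

lemma (in prob_space) prob_cdf_less:
  fixes Z :: "'a \<Rightarrow> real" and F :: "real \<Rightarrow> real"
  assumes [measurable]: "Z \<in> borel_measurable M"
    and F: "\<And>x. F x = prob {\<omega> \<in> space M. Z \<omega> \<le> x}" and cont: "continuous_on UNIV F"
    and c: "0 \<le> c" "c \<le> 1"
  shows "prob {\<omega> \<in> space M. 1 - F (Z \<omega>) < c} = c"
proof -
  interpret D: real_distribution "distr M borel Z" by (rule real_distribution_distr) simp
  have F_cdf: "F = cdf (distr M borel Z)"
    by (auto simp: fun_eq_iff F cdf_def measure_distr vimage_def intro!: arg_cong[where f=prob])
  have mono: "mono F" by (auto simp: F_cdf mono_def D.cdf_nondecreasing)
  have top: "(F \<longlongrightarrow> 1) at_top" and bot: "(F \<longlongrightarrow> 0) at_bot"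
    unfolding F_cdf by (rule D.cdf_lim_at_top_prob D.cdf_lim_at_bot)+
  have [measurable]: "F \<in> borel_measurable borel" by (rule borel_measurable_mono[OF mono])
  have F01: "0 \<le> F x" "F x \<le> 1" for x by (auto simp: F)
  have ex: "\<exists>x. F x = y" if "0 < y" "y < 1" for y
  proof -
    from order_tendstoD(2)[OF bot that(1)] obtain a where a: "F a < y" by (auto simp: eventually_at_bot_linorder)
    from order_tendstoD(1)[OF top that(2)] obtain b where b: "F b > y" by (auto simp: eventually_at_top_linorder)
    have "a \<le> b" using a b mono by (meson linear monoD not_less order.trans less_imp_le)
    with a b show ?thesis using IVT'[of F a y b] continuous_on_subset[OF cont, of "{a..b}"] by fastforce
  qed
  have le: "prob {\<omega> \<in> space M. F (Z \<omega>) < y} \<le> y" if "0 < y" "y < 1" for y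
  proof -
    from ex[OF that] obtain x where x: "F x = y" by blast
    have "prob {\<omega> \<in> space M. F (Z \<omega>) < y} \<le> prob {\<omega> \<in> space M. Z \<omega> \<le> x}"
    proof (rule finite_measure_mono)
      show "{\<omega> \<in> space M. F (Z \<omega>) < y} \<subseteq> {\<omega> \<in> space M. Z \<omega> \<le> x}"
        using monoD[OF mono, of x] x by (auto simp: not_le[symmetric]) (meson not_le less_imp_le)
    qed simp
    then show ?thesis using x F[of x] by simp
  qed
  have ge: "y \<le> prob {\<omega> \<in> space M. F (Z \<omega>) \<le> y}" if "0 < y" "y < 1" for y
  proof -
    from ex[OF that] obtain x where x: "F x = y" by blast
    have "prob {\<omega> \<in> space M. Z \<omega> \<le> x} \<le> prob {\<omega> \<in> space M. F (Z \<omega>) \<le> y}"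
      using monoD[OF mono, of _ x] x by (intro finite_measure_mono) auto
    then show ?thesis using x F[of x] by simp
  qed
  have le': "prob {\<omega> \<in> space M. F (Z \<omega>) \<le> y} \<le> y" if "0 \<le> y" "y \<le> 1" for y
  proof (cases "y = 1")
    case False
    show ?thesis
    proof (rule dense_ge_bounded[of y 1])
      fix z assume z: "y < z" "z < 1"
      have "prob {\<omega> \<in> space M. F (Z \<omega>) \<le> y} \<le> prob {\<omega> \<in> space M. F (Z \<omega>) < z}"
        using z by (intro finite_measure_mono) auto
      also have "\<dots> \<le> z" using z that by (intro le) auto
      finally show "prob {\<omega> \<in> space M. F (Z \<omega>) \<le> y} \<le> z" .
    qed (use False that in simp)
  qed simp
  have ge': "y \<le> prob {\<omega> \<in> space M. F (Z \<omega>) \<le> y}" if "0 \<le> y" "y \<le> 1" for y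
  proof -
    consider "y = 0" | "y = 1" | "0 < y" "y < 1" using \<open>0 \<le> y\<close> \<open>y \<le> 1\<close> by linarith
    then show ?thesis
    proof cases
      case 2
      then show ?thesis by (simp add: F01 prob_space)
    qed (use ge in auto)
  qed
  have "prob {\<omega> \<in> space M. 1 - F (Z \<omega>) < c} = prob (space M - {\<omega> \<in> space M. F (Z \<omega>) \<le> 1 - c})"
    by (intro arg_cong[where f=prob]) auto
  also have "\<dots> = 1 - prob {\<omega> \<in> space M. F (Z \<omega>) \<le> 1 - c}" by (rule prob_compl) simp
  also have "\<dots> = c" using le'[of "1 - c"] ge'[of "1 - c"] c by simp
  finally show ?thesis .
qed

lemma unif_margins_marg_cdf:
  fixes X :: "'a \<Rightarrow> real^'d::finite"
  assumes "prob_space M" and [measurable]: "X \<in> borel_measurable M"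
    and cont: "\<And>l. continuous_on UNIV (marg_cdf M X l)"
  shows "unif_margins M (\<lambda>l \<omega>. 1 - marg_cdf M X l (X \<omega> $ l))"
proof -
  interpret prob_space M by fact
  have nth: "(\<lambda>\<omega>. X \<omega> $ l) \<in> borel_measurable M" for l
    using measurable_compose[OF assms(2) borel_measurable_nth] .
  note nth[measurable]
  have [measurable]: "marg_cdf M X l \<in> borel_measurable borel" for l
    using cont by (rule borel_measurable_continuous_onI)
  show ?thesis
  proof
    show "prob {\<omega> \<in> space M. 1 - marg_cdf M X l (X \<omega> $ l) < c} = c" if "0 \<le> c" "c \<le> 1" for l c
      by (rule prob_cdf_less[OF nth marg_cdf_def cont that])
  qed (auto simp: marg_cdf_def)
qed

text \<open>Interchange of limits: the error bound \<open>d K\<close> does not depend on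
  \<open>s\<close>, so \<open>K\<close> can be fixed before \<open>s\<close> moves.\<close>

lemma tendsto_approx:
  fixes f :: "'b \<Rightarrow> real" and g :: "nat \<Rightarrow> 'b \<Rightarrow> real"
  assumes "\<And>K. \<forall>\<^sub>F s in F. \<bar>f s - g K s\<bar> \<le> d K" and "\<And>K. (g K \<longlongrightarrow> h K) F"
    and "h \<longlonglongrightarrow> c" "d \<longlonglongrightarrow> 0"
  shows "(f \<longlongrightarrow> c) F"
proof (rule tendstoI)
  fix e :: real assume "e > 0"
  then have e: "e / 3 > 0" by simp
  have "\<forall>\<^sub>F K in sequentially. dist (h K) c < e/3 \<and> d K < e/3"
    using tendstoD[OF assms(3) e] order_tendstoD(2)[OF assms(4) e] by eventually_elim simp
  then obtain K where K: "dist (h K) c < e/3" "d K < e/3" by (auto simp: eventually_sequentially)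
  show "\<forall>\<^sub>F s in F. dist (f s) c < e"
    using assms(1)[of K] tendstoD[OF assms(2)[of K] e]
  proof eventually_elim
    case (elim s)
    then show ?case using K unfolding dist_real_def by linarith
  qed
qed

section \<open>Exceedance probabilities of the limit law\<close>

locale mda_unif = unif_margins M U for M :: "'a measure" and U :: "'d::finite \<Rightarrow> 'a \<Rightarrow> real" +
  fixes ell :: "real^'d \<Rightarrow> real" and \<mu>Y :: "(real^'d) measure"
  assumes mda: "\<And>x. (\<forall>l. 0 \<le> x $ l) \<Longrightarrow>
      ((\<lambda>s. prob {\<omega> \<in> space M. \<exists>l. U l \<omega> < s * x $ l} / s) \<longlongrightarrow> ell x) (at_right 0)"
    and Y: "is_mpareto_law ell \<mu>Y"
begin

sublocale Y: prob_space \<mu>Y using Y by (simp add: is_mpareto_law_def)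

lemma sets_Y[measurable_cong]: "sets \<mu>Y = sets borel" using Y by (simp add: is_mpareto_law_def)

lemma space_Y[simp]: "space \<mu>Y = UNIV" using sets_eq_imp_space_eq[OF sets_Y] by simp

lemma nth_measurable_Y[measurable]: "(\<lambda>y. y $ l) \<in> borel_measurable \<mu>Y"
  using borel_measurable_nth[of l] by (simp cong: measurable_cong_sets add: sets_Y)

definition "ell_one = ell (\<chi> l. 1)"

lemma small_s: "\<forall>\<^sub>F s in at_right (0::real). 0 < s \<and> s < \<epsilon>" if "\<epsilon> > 0" for \<epsilon> :: real
  using eventually_at_right_real[OF that] by simp

lemma ell_one_ge_1: "ell_one \<ge> 1"
proof -
  have "((\<lambda>s. prob {\<omega> \<in> space M. \<exists>l. U l \<omega> < s * (\<chi> l. 1) $ l} / s) \<longlongrightarrow> ell_one) (at_right 0)"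
    unfolding ell_one_def by (rule mda) simp
  moreover have "\<forall>\<^sub>F s in at_right 0. 1 \<le> prob {\<omega> \<in> space M. \<exists>l. U l \<omega> < s * (\<chi> l. 1) $ l} / s"
    using small_s[of 1, simplified]
  proof eventually_elim
    case (elim s)
    \<comment> \<open>\<open>undefined\<close> serves as an arbitrary coordinate; a single margin
      already falls below \<open>s\<close> with probability \<open>s\<close>.\<close>
    have "s = prob {\<omega> \<in> space M. U undefined \<omega> < s}" using elim by (simp add: prob_U_less)
    also have "\<dots> \<le> prob {\<omega> \<in> space M. \<exists>l. U l \<omega> < s * (\<chi> l. 1) $ l}"
      by (intro finite_measure_mono) auto
    finally show ?case using elim by simp
  qed
  ultimately show ?thesis by (rule tendsto_lowerbound) simp
qed

text \<open>\<open>P s\<close> is an event about the rescaled vector \<open>s / U\<close> and \<open>Q\<close> the same event about \<open>Y\<close>.\<close>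
definition tail_converges :: "(real \<Rightarrow> 'a \<Rightarrow> bool) \<Rightarrow> (real^'d \<Rightarrow> bool) \<Rightarrow> bool" where
  "tail_converges P Q \<longleftrightarrow> (\<forall>s. {\<omega> \<in> space M. P s \<omega>} \<in> sets M) \<and> {y. Q y} \<in> sets \<mu>Y \<and>
    ((\<lambda>s. prob {\<omega> \<in> space M. (\<exists>l. U l \<omega> < s) \<and> P s \<omega>} / s) \<longlongrightarrow> ell_one * measure \<mu>Y {y. Q y}) (at_right 0)"

text \<open>The formula defining the multivariate Pareto law, read at a finite level. The point with
  entries \<open>1 / min (x l) 1\<close> describes the event that some \<open>U l\<close> is below
  \<open>s\<close> or below \<open>s / x l\<close>, the point with entries \<open>1 / x l\<close>
  the event that some \<open>U l\<close> is below \<open>s / x l\<close>; their difference is the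
  orthant event within the exceedance region.\<close>

lemma tail_converges_orthant:
  assumes x: "\<And>l. x l > 0"
  shows "tail_converges (\<lambda>s \<omega>. \<forall>l. U l \<omega> \<ge> s / x l) (\<lambda>y. \<forall>l. y $ l \<le> x l)"
proof -
  let ?A = "\<lambda>s. {\<omega> \<in> space M. \<exists>l. U l \<omega> < s * (\<chi> l. 1 / min (x l) 1) $ l}"
  let ?B = "\<lambda>s. {\<omega> \<in> space M. \<exists>l. U l \<omega> < s * (\<chi> l. 1 / x l) $ l}"
  have lim: "((\<lambda>s. prob (?A s) / s - prob (?B s) / s) \<longlongrightarrow> ell (\<chi> l. 1 / min (x l) 1) - ell (\<chi> l. 1 / x l)) (at_right 0)"
    by (intro tendsto_diff mda) (auto intro: less_imp_le x)
  have "\<forall>\<^sub>F s in at_right 0. prob (?A s) / s - prob (?B s) / s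
    = prob {\<omega> \<in> space M. (\<exists>l. U l \<omega> < s) \<and> (\<forall>l. U l \<omega> \<ge> s / x l)} / s"
    using small_s[OF zero_less_one]
  proof eventually_elim
    case (elim s)
    have le: "s / x l \<le> s / min (x l) 1" "s \<le> s / min (x l) 1" for l
      using elim x[of l] by (auto simp: min_def divide_simps mult_left_le)
    have ex: "u < s \<or> u < s / x l" if "u < s / min (x l) 1" for u l
      using that by (auto simp: min_def split: if_splits)
    have iff: "u < s / min (x l) 1 \<longleftrightarrow> u < s \<or> u < s / x l" for u l
      using le[of l] ex[of u l] by linarith
    have A: "?A s = {\<omega> \<in> space M. (\<exists>l. U l \<omega> < s) \<or> (\<exists>l. U l \<omega> < s / x l)}"
      by (simp add: iff ex_disj_distrib)
    have "{\<omega> \<in> space M. (\<exists>l. U l \<omega> < s) \<and> (\<forall>l. U l \<omega> \<ge> s / x l)} = ?A s - ?B s"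
      unfolding A by (auto simp: not_less) (meson not_le)
    moreover have "?B s \<subseteq> ?A s" unfolding A by auto
    ultimately have "prob {\<omega> \<in> space M. (\<exists>l. U l \<omega> < s) \<and> (\<forall>l. U l \<omega> \<ge> s / x l)} = prob (?A s) - prob (?B s)"
      by (simp add: finite_measure_Diff)
    then show ?case by (simp add: diff_divide_distrib)
  qed
  note * = Lim_transform_eventually[OF lim this]
  have "measure \<mu>Y {y. \<forall>l. y $ l \<le> (\<chi> l. x l) $ l} = (ell (\<chi> l. 1 / min ((\<chi> l. x l) $ l) 1) - ell (\<chi> l. 1 / (\<chi> l. x l) $ l)) / ell_one"
    using Y[unfolded is_mpareto_law_def, THEN conjunct2, THEN conjunct2, THEN conjunct2, rule_format, of "\<chi> l. x l"] x
    unfolding ell_one_def by simp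
  then have "ell_one * measure \<mu>Y {y. \<forall>l. y $ l \<le> x l} = ell (\<chi> l. 1 / min (x l) 1) - ell (\<chi> l. 1 / x l)"
    using ell_one_ge_1 by simp
  moreover have "{y. \<forall>l. y $ l \<le> x l} \<in> sets \<mu>Y"
  proof -
    have "{y \<in> space \<mu>Y. \<forall>l. y $ l \<le> x l} \<in> sets \<mu>Y" by measurable
    then show ?thesis by simp
  qed
  ultimately show ?thesis using * unfolding tail_converges_def by simp
qed

text \<open>Coordinates outside \<open>L\<close> receive the level \<open>Suc K\<close>, which is
  sent to infinity. The interchange with the limit in \<open>s\<close> is legitimate because the
  discarded event needs some \<open>U l\<close> below \<open>s / Suc K\<close>, of probability at
  most \<open>CARD('d) * s / Suc K\<close>: after division by \<open>s\<close> the error is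
  uniform.\<close>

lemma tail_converges_sub_orthant:
  assumes x: "\<And>l. x l > 0"
  shows "tail_converges (\<lambda>s \<omega>. \<forall>l\<in>L. U l \<omega> \<ge> s / x l) (\<lambda>y. \<forall>l\<in>L. y $ l \<le> x l)"
proof -
  define z where "z K l = (if l \<in> L then x l else real (Suc K))" for K l
  have z: "z K l > 0" for K l using x by (simp add: z_def)
  let ?P = "\<lambda>s \<omega>. \<forall>l\<in>L. U l \<omega> \<ge> s / x l"
  let ?PK = "\<lambda>K s \<omega>. \<forall>l. U l \<omega> \<ge> s / z K l"
  let ?Q = "\<lambda>y. \<forall>l\<in>L. y $ l \<le> x l"
  have gK: "tail_converges (?PK K) (\<lambda>y. \<forall>l. y $ l \<le> z K l)" for K by (rule tail_converges_orthant[OF z])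
  have QS: "{y. ?Q y} \<in> sets \<mu>Y"
  proof -
    have "{y \<in> space \<mu>Y. ?Q y} \<in> sets \<mu>Y" by measurable
    then show ?thesis by simp
  qed
  have "((\<lambda>s. prob {\<omega> \<in> space M. (\<exists>l. U l \<omega> < s) \<and> ?P s \<omega>} / s) \<longlongrightarrow> ell_one * measure \<mu>Y {y. ?Q y}) (at_right 0)"
  proof (rule tendsto_approx)
    show "((\<lambda>s. prob {\<omega> \<in> space M. (\<exists>l. U l \<omega> < s) \<and> ?PK K s \<omega>} / s) \<longlongrightarrow> ell_one * measure \<mu>Y {y. \<forall>l. y $ l \<le> z K l}) (at_right 0)" for K
      using gK[of K] by (simp add: tail_converges_def)
    show "(\<lambda>K. ell_one * measure \<mu>Y {y. \<forall>l. y $ l \<le> z K l}) \<longlonglongrightarrow> ell_one * measure \<mu>Y {y. ?Q y}"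
    proof (rule tendsto_mult_left)
      have "(\<lambda>K. measure \<mu>Y {y. \<forall>l. y $ l \<le> z K l}) \<longlonglongrightarrow> measure \<mu>Y (\<Union>K. {y. \<forall>l. y $ l \<le> z K l})"
      proof (rule Y.finite_Lim_measure_incseq)
        show "range (\<lambda>K. {y. \<forall>l. y $ l \<le> z K l}) \<subseteq> sets \<mu>Y" using gK by (auto simp: tail_converges_def)
        show "incseq (\<lambda>K. {y. \<forall>l. y $ l \<le> z K l})"
        proof (rule incseq_SucI, safe)
          fix K y l assume "\<forall>l. y $ l \<le> z K l"
          then have "y $ l \<le> z K l" by blast
          also have "z K l \<le> z (Suc K) l" by (simp add: z_def)
          finally show "y $ l \<le> z (Suc K) l" .
        qed
      qed
      also have "(\<Union>K. {y. \<forall>l. y $ l \<le> z K l}) = {y. ?Q y}"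
      proof safe
        fix y K l assume "\<forall>l. y $ l \<le> z K l" "l \<in> L"
        then show "y $ l \<le> x l" by (auto simp: z_def dest!: spec[of _ l])
      next
        fix y assume y: "?Q y"
        obtain K where K: "Max (range (\<lambda>l. y $ l)) \<le> real K" using real_arch_simple by blast
        have "y $ l \<le> z K l" for l
        proof -
          have "y $ l \<le> Max (range (\<lambda>l. y $ l))" by (intro Max_ge) auto
          then have "y $ l \<le> real (Suc K)" using K by linarith
          then show ?thesis using y by (simp add: z_def)
        qed
        then show "y \<in> (\<Union>K. {y. \<forall>l. y $ l \<le> z K l})" by blast
      qed
      finally show "(\<lambda>K. measure \<mu>Y {y. \<forall>l. y $ l \<le> z K l}) \<longlonglongrightarrow> measure \<mu>Y {y. ?Q y}" .
    qed
    show "(\<lambda>K. real (CARD('d)) / real (Suc K)) \<longlonglongrightarrow> 0" by real_asymp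
    show "\<forall>\<^sub>F s in at_right 0. \<bar>prob {\<omega> \<in> space M. (\<exists>l. U l \<omega> < s) \<and> ?P s \<omega>} / s
        - prob {\<omega> \<in> space M. (\<exists>l. U l \<omega> < s) \<and> ?PK K s \<omega>} / s\<bar> \<le> real (CARD('d)) / real (Suc K)" for K
      using small_s[OF zero_less_one]
    proof eventually_elim
      case (elim s)
      let ?A = "{\<omega> \<in> space M. (\<exists>l. U l \<omega> < s) \<and> ?P s \<omega>}" and ?B = "{\<omega> \<in> space M. (\<exists>l. U l \<omega> < s) \<and> ?PK K s \<omega>}"
      let ?C = "\<lambda>l. {\<omega> \<in> space M. U l \<omega> < s / real (Suc K)}"
      have "U l \<omega> \<ge> s / x l" if "?PK K s \<omega>" "l \<in> L" for \<omega> l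
        using that by (auto simp: z_def dest: spec[of _ l])
      then have "?B \<subseteq> ?A" by blast
      then have 1: "prob ?B \<le> prob ?A" by (intro finite_measure_mono) auto
      have sub: "?A \<subseteq> ?B \<union> (\<Union>l\<in>UNIV. ?C l)"
      proof
        fix \<omega> assume \<omega>: "\<omega> \<in> ?A"
        show "\<omega> \<in> ?B \<union> (\<Union>l\<in>UNIV. ?C l)"
        proof (cases "\<exists>l. U l \<omega> < s / real (Suc K)")
          case False
          then have "?PK K s \<omega>" using \<omega> by (auto simp: z_def not_less)
          then show ?thesis using \<omega> by blast
        qed (use \<omega> in blast)
      qed
      have "prob ?A \<le> prob (?B \<union> (\<Union>l\<in>UNIV. ?C l))" by (intro finite_measure_mono sub) auto
      also have "\<dots> \<le> prob ?B + prob (\<Union>l\<in>UNIV. ?C l)" by (intro measure_Un_le) auto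
      also have "prob (\<Union>l\<in>UNIV. ?C l) \<le> (\<Sum>l\<in>UNIV. prob (?C l))" by (intro finite_measure_subadditive_finite) auto
      also have "\<dots> \<le> (\<Sum>l\<in>(UNIV::'d set). s / real (Suc K))" using elim by (intro sum_mono prob_U_less_le) auto
      finally have "prob ?A - prob ?B \<le> s * (real (CARD('d)) / real (Suc K))" by (simp add: field_simps)
      with 1 elim show ?case by (simp add: diff_divide_distrib[symmetric] abs_of_nonneg divide_le_eq mult.commute)
    qed
  qed
  then show ?thesis using QS unfolding tail_converges_def by simp
qed

text \<open>Constraints form a set of pairs so that a coordinate may occur several times: coinciding
  \<open>i\<close>, \<open>j\<close> and \<open>m\<close> then need no case distinction, and per
  coordinate the smallest level is binding. The guard \<open>s > 0\<close> is part of the event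
  because the smallest level gives the largest threshold \<open>s / a\<close> only for positive
  \<open>s\<close>, while \<open>tail_converges\<close> speaks about every \<open>s\<close>.\<close>

lemma tail_converges_slots:
  assumes T: "finite T" "\<And>l a. (l, a) \<in> T \<Longrightarrow> a > 0"
  shows "tail_converges (\<lambda>s \<omega>. s > 0 \<longrightarrow> (\<forall>(l, a)\<in>T. U l \<omega> \<ge> s / a)) (\<lambda>y. \<forall>(l, a)\<in>T. y $ l \<le> a)"
proof -
  define x where "x l = (if l \<in> fst ` T then Min {a. (l, a) \<in> T} else 1)" for l
  have fin: "finite {a. (l, a) \<in> T}" for l
    by (rule finite_subset[OF _ finite_imageI[OF T(1), of snd]]) force
  have ne: "{a. (l, a) \<in> T} \<noteq> {}" if "l \<in> fst ` T" for l using that by auto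
  have x: "x l > 0" for l using fin ne[of l] T(2) by (auto simp: x_def)
  have le_iff: "y \<le> x l \<longleftrightarrow> (\<forall>a. (l, a) \<in> T \<longrightarrow> y \<le> a)" if "l \<in> fst ` T" for l y
    using fin[of l] ne[OF that] that by (simp add: x_def)
  have Q: "(\<forall>l\<in>fst ` T. y $ l \<le> x l) \<longleftrightarrow> (\<forall>(l, a)\<in>T. y $ l \<le> a)" for y :: "real^'d"
    using le_iff by force
  have P: "(\<forall>l\<in>fst ` T. U l \<omega> \<ge> s / x l) \<longleftrightarrow> (\<forall>(l, a)\<in>T. U l \<omega> \<ge> s / a)" if s: "s > 0" for s \<omega>
  proof -
    have swap: "u \<ge> s / a \<longleftrightarrow> u > 0 \<and> s / u \<le> a" if "a > 0" for u a
    proof (cases "u > 0")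
      case True
      then show ?thesis using that by (simp add: divide_le_eq mult.commute)
    next
      case False
      moreover have "s / a > 0" using s that by simp
      ultimately show ?thesis by linarith
    qed
    have "(\<forall>l\<in>fst ` T. U l \<omega> \<ge> s / x l) \<longleftrightarrow> (\<forall>l\<in>fst ` T. U l \<omega> > 0 \<and> s / U l \<omega> \<le> x l)"
      by (intro ball_cong refl swap x)
    also have "\<dots> \<longleftrightarrow> (\<forall>(l, a)\<in>T. U l \<omega> > 0 \<and> s / U l \<omega> \<le> a)"
      using le_iff by force
    also have "\<dots> \<longleftrightarrow> (\<forall>(l, a)\<in>T. U l \<omega> \<ge> s / a)"
    proof (intro ball_cong refl)
      fix p assume "p \<in> T"
      then show "(case p of (l, a) \<Rightarrow> U l \<omega> > 0 \<and> s / U l \<omega> \<le> a) \<longleftrightarrow> (case p of (l, a) \<Rightarrow> U l \<omega> \<ge> s / a)"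
        using swap[of "snd p" "U (fst p) \<omega>"] T(2)[of "fst p" "snd p"] by (simp only: case_prod_unfold prod.collapse)
    qed
    finally show ?thesis .
  qed
  have g: "tail_converges (\<lambda>s \<omega>. \<forall>l\<in>fst ` T. U l \<omega> \<ge> s / x l) (\<lambda>y. \<forall>l\<in>fst ` T. y $ l \<le> x l)"
    by (rule tail_converges_sub_orthant[OF x])
  show ?thesis
    unfolding tail_converges_def
  proof (intro conjI allI)
    show "{y. \<forall>(l, a)\<in>T. y $ l \<le> a} \<in> sets \<mu>Y" using g unfolding tail_converges_def Q by blast
    show "{\<omega> \<in> space M. s > 0 \<longrightarrow> (\<forall>(l, a)\<in>T. U l \<omega> \<ge> s / a)} \<in> sets M" for s
    proof (cases "s > 0")
      case True
      have "{\<omega> \<in> space M. \<forall>l\<in>fst ` T. U l \<omega> \<ge> s / x l} \<in> sets M" using g unfolding tail_converges_def by blast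
      then show ?thesis unfolding P[OF True] using True by simp
    qed simp
    have "((\<lambda>s. prob {\<omega> \<in> space M. (\<exists>l. U l \<omega> < s) \<and> (\<forall>l\<in>fst ` T. U l \<omega> \<ge> s / x l)} / s) \<longlongrightarrow> ell_one * measure \<mu>Y {y. \<forall>(l, a)\<in>T. y $ l \<le> a}) (at_right 0)"
      using g unfolding tail_converges_def Q by blast
    then show "((\<lambda>s. prob {\<omega> \<in> space M. (\<exists>l. U l \<omega> < s) \<and> (s > 0 \<longrightarrow> (\<forall>(l, a)\<in>T. U l \<omega> \<ge> s / a))} / s) \<longlongrightarrow> ell_one * measure \<mu>Y {y. \<forall>(l, a)\<in>T. y $ l \<le> a}) (at_right 0)"
      by (rule Lim_transform_eventually, intro eventually_mono[OF small_s[OF zero_less_one]]) (simp only: P simp_thms)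
  qed
qed

text \<open>One inclusion-exclusion step. Lower events are closed under intersection, so repeated
  relative complements reach the upper events.\<close>

lemma tail_converges_diff:
  assumes "tail_converges P Q" "tail_converges (\<lambda>s \<omega>. P s \<omega> \<and> R s \<omega>) (\<lambda>y. Q y \<and> S y)"
  shows "tail_converges (\<lambda>s \<omega>. P s \<omega> \<and> \<not> R s \<omega>) (\<lambda>y. Q y \<and> \<not> S y)"
proof -
  have m[measurable]: "{\<omega> \<in> space M. P s \<omega>} \<in> sets M" "{\<omega> \<in> space M. P s \<omega> \<and> R s \<omega>} \<in> sets M"
    "{y. Q y} \<in> sets \<mu>Y" "{y. Q y \<and> S y} \<in> sets \<mu>Y" for s using assms by (auto simp: tail_converges_def)
  have e1: "{\<omega> \<in> space M. P s \<omega> \<and> \<not> R s \<omega>} = {\<omega> \<in> space M. P s \<omega>} - {\<omega> \<in> space M. P s \<omega> \<and> R s \<omega>}" for s by auto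
  have e2: "{y. Q y \<and> \<not> S y} = {y. Q y} - {y. Q y \<and> S y}" by auto
  have meas: "{\<omega> \<in> space M. P s \<omega> \<and> \<not> R s \<omega>} \<in> sets M" "{y. Q y \<and> \<not> S y} \<in> sets \<mu>Y" for s
    unfolding e1 e2 using m by auto
  have mE: "{\<omega> \<in> space M. (\<exists>l. U l \<omega> < s) \<and> T \<omega>} \<in> sets M" if "{\<omega> \<in> space M. T \<omega>} \<in> sets M" for s T
  proof -
    have "{\<omega> \<in> space M. (\<exists>l. U l \<omega> < s) \<and> T \<omega>} = {\<omega> \<in> space M. (\<exists>l. U l \<omega> < s)} \<inter> {\<omega> \<in> space M. T \<omega>}" by auto
    then show ?thesis using that by simp
  qed
  have "prob {\<omega> \<in> space M. (\<exists>l. U l \<omega> < s) \<and> P s \<omega> \<and> \<not> R s \<omega>} =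
     prob {\<omega> \<in> space M. (\<exists>l. U l \<omega> < s) \<and> P s \<omega>} - prob {\<omega> \<in> space M. (\<exists>l. U l \<omega> < s) \<and> P s \<omega> \<and> R s \<omega>}" for s
  proof -
    have "{\<omega> \<in> space M. (\<exists>l. U l \<omega> < s) \<and> P s \<omega> \<and> \<not> R s \<omega>} =
      {\<omega> \<in> space M. (\<exists>l. U l \<omega> < s) \<and> P s \<omega>} - {\<omega> \<in> space M. (\<exists>l. U l \<omega> < s) \<and> P s \<omega> \<and> R s \<omega>}" by auto
    then show ?thesis using m by (simp only:) (intro finite_measure_Diff mE, auto)
  qed
  moreover have "measure \<mu>Y {y. Q y \<and> \<not> S y} = measure \<mu>Y {y. Q y} - measure \<mu>Y {y. Q y \<and> S y}"
    unfolding e2 by (intro Y.finite_measure_Diff) (use m in auto)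
  ultimately show ?thesis
    using meas tendsto_diff[OF conjunct2[OF conjunct2[OF assms(1)[unfolded tail_converges_def]]] conjunct2[OF conjunct2[OF assms(2)[unfolded tail_converges_def]]]]
    unfolding tail_converges_def by (simp add: diff_divide_distrib right_diff_distrib)
qed

lemma tail_converges_cong:
  assumes "tail_converges P Q" "\<And>s \<omega>. P s \<omega> \<longleftrightarrow> P' s \<omega>" "\<And>y. Q y \<longleftrightarrow> Q' y"
  shows "tail_converges P' Q'"
  using assms by (simp add: tail_converges_def)

text \<open>Three complements turn the lower events \<open>A\<close>, \<open>B\<close>,
  \<open>C\<close> into upper ones: \<open>C\<close> is negated first, then \<open>B\<close>, then
  \<open>A\<close>, each time subtracting an intersection prepared before. Once
  \<open>U m \<omega> < s\<close> is part of the event, the condition that some margin is below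
  \<open>s\<close> holds by itself.\<close>

lemma tendsto_exceedances:
  assumes a: "a > 0" and b: "b > 0"
  shows "((\<lambda>s. prob {\<omega> \<in> space M. U i \<omega> < s / a \<and> U j \<omega> < s / b \<and> U m \<omega> < s} / s)
     \<longlongrightarrow> ell_one * measure \<mu>Y {y. y $ i > a \<and> y $ j > b \<and> y $ m > 1}) (at_right 0)"
proof -
  define A where "A s \<omega> \<longleftrightarrow> (s > 0 \<longrightarrow> U i \<omega> \<ge> s / a)" for s \<omega>
  define B where "B s \<omega> \<longleftrightarrow> (s > 0 \<longrightarrow> U j \<omega> \<ge> s / b)" for s \<omega>
  define C where "C s \<omega> \<longleftrightarrow> (s > 0 \<longrightarrow> U m \<omega> \<ge> s / 1)" for s \<omega>
  let ?A = "\<lambda>y. y $ i \<le> a" and ?B = "\<lambda>y. y $ j \<le> b" and ?C = "\<lambda>y. y $ m \<le> 1"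
  have g0: "tail_converges (\<lambda>s \<omega>. True) (\<lambda>y. True)"
    by (rule tail_converges_cong[OF tail_converges_slots[of "{}"]]) auto
  have gA: "tail_converges A ?A" by (rule tail_converges_cong[OF tail_converges_slots[of "{(i,a)}"]]) (use a in \<open>auto simp: A_def\<close>)
  have gB: "tail_converges B ?B" by (rule tail_converges_cong[OF tail_converges_slots[of "{(j,b)}"]]) (use b in \<open>auto simp: B_def\<close>)
  have gC: "tail_converges C ?C" by (rule tail_converges_cong[OF tail_converges_slots[of "{(m,1)}"]]) (auto simp: C_def)
  have gAB: "tail_converges (\<lambda>s \<omega>. A s \<omega> \<and> B s \<omega>) (\<lambda>y. ?A y \<and> ?B y)"
    by (rule tail_converges_cong[OF tail_converges_slots[of "{(i,a), (j,b)}"]]) (use a b in \<open>auto simp: A_def B_def\<close>)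
  have gAC: "tail_converges (\<lambda>s \<omega>. A s \<omega> \<and> C s \<omega>) (\<lambda>y. ?A y \<and> ?C y)"
    by (rule tail_converges_cong[OF tail_converges_slots[of "{(i,a), (m,1)}"]]) (use a b in \<open>auto simp: A_def C_def\<close>)
  have gBC: "tail_converges (\<lambda>s \<omega>. B s \<omega> \<and> C s \<omega>) (\<lambda>y. ?B y \<and> ?C y)"
    by (rule tail_converges_cong[OF tail_converges_slots[of "{(j,b), (m,1)}"]]) (use a b in \<open>auto simp: B_def C_def\<close>)
  have gABC: "tail_converges (\<lambda>s \<omega>. A s \<omega> \<and> B s \<omega> \<and> C s \<omega>) (\<lambda>y. ?A y \<and> ?B y \<and> ?C y)"
    by (rule tail_converges_cong[OF tail_converges_slots[of "{(i,a), (j,b), (m,1)}"]]) (use a b in \<open>auto simp: A_def B_def C_def\<close>)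
  have n1: "tail_converges (\<lambda>s \<omega>. \<not> C s \<omega>) (\<lambda>y. \<not> ?C y)"
    by (rule tail_converges_cong[OF tail_converges_diff[OF g0]]) (use gC in auto)
  have n2: "tail_converges (\<lambda>s \<omega>. A s \<omega> \<and> \<not> C s \<omega>) (\<lambda>y. ?A y \<and> \<not> ?C y)"
    by (rule tail_converges_diff[OF gA gAC])
  have n3: "tail_converges (\<lambda>s \<omega>. B s \<omega> \<and> \<not> C s \<omega>) (\<lambda>y. ?B y \<and> \<not> ?C y)"
    by (rule tail_converges_diff[OF gB gBC])
  have n4: "tail_converges (\<lambda>s \<omega>. (A s \<omega> \<and> B s \<omega>) \<and> \<not> C s \<omega>) (\<lambda>y. (?A y \<and> ?B y) \<and> \<not> ?C y)"
    by (rule tail_converges_diff[OF gAB]) (rule tail_converges_cong[OF gABC]; auto)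
  have n5: "tail_converges (\<lambda>s \<omega>. \<not> C s \<omega> \<and> \<not> B s \<omega>) (\<lambda>y. \<not> ?C y \<and> \<not> ?B y)"
    by (rule tail_converges_diff[OF n1]) (rule tail_converges_cong[OF n3]; auto)
  have n6: "tail_converges (\<lambda>s \<omega>. (A s \<omega> \<and> \<not> C s \<omega>) \<and> \<not> B s \<omega>) (\<lambda>y. (?A y \<and> \<not> ?C y) \<and> \<not> ?B y)"
    by (rule tail_converges_diff[OF n2]) (rule tail_converges_cong[OF n4]; auto)
  have n7: "tail_converges (\<lambda>s \<omega>. (\<not> C s \<omega> \<and> \<not> B s \<omega>) \<and> \<not> A s \<omega>) (\<lambda>y. (\<not> ?C y \<and> \<not> ?B y) \<and> \<not> ?A y)"
    by (rule tail_converges_diff[OF n5]) (rule tail_converges_cong[OF n6]; auto)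
  have lim: "((\<lambda>s. prob {\<omega> \<in> space M. (\<exists>l. U l \<omega> < s) \<and> (\<not> C s \<omega> \<and> \<not> B s \<omega>) \<and> \<not> A s \<omega>} / s)
     \<longlongrightarrow> ell_one * measure \<mu>Y {y. (\<not> ?C y \<and> \<not> ?B y) \<and> \<not> ?A y}) (at_right 0)"
    using n7 unfolding tail_converges_def by blast
  have eq: "{y. (\<not> ?C y \<and> \<not> ?B y) \<and> \<not> ?A y} = {y. y $ i > a \<and> y $ j > b \<and> y $ m > 1}" by auto
  show ?thesis
  proof (rule Lim_transform_eventually[OF lim[unfolded eq]], rule eventually_mono[OF small_s[OF zero_less_one]])
    fix s :: real assume s: "0 < s \<and> s < 1"
    then have "{\<omega> \<in> space M. (\<exists>l. U l \<omega> < s) \<and> (\<not> C s \<omega> \<and> \<not> B s \<omega>) \<and> \<not> A s \<omega>} = {\<omega> \<in> space M. U i \<omega> < s / a \<and> U j \<omega> < s / b \<and> U m \<omega> < s}"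
      by (auto simp: A_def B_def C_def)
    then show "prob {\<omega> \<in> space M. (\<exists>l. U l \<omega> < s) \<and> (\<not> C s \<omega> \<and> \<not> B s \<omega>) \<and> \<not> A s \<omega>} / s
       = prob {\<omega> \<in> space M. U i \<omega> < s / a \<and> U j \<omega> < s / b \<and> U m \<omega> < s} / s" by simp
  qed
qed

end

section \<open>Joint tails\<close>

lemma (in prob_space) cond_measure_props:
  assumes A[measurable]: "A \<in> sets M" and pos: "prob A > 0"
  shows "prob_space (cond_measure M A)"
    and "sets (cond_measure M A) = sets M" and "space (cond_measure M A) = space M"
    and "\<And>B. B \<in> sets M \<Longrightarrow> measure (cond_measure M A) B = prob (A \<inter> B) / prob A"
    and "\<And>f. f \<in> borel_measurable M \<Longrightarrow> integral\<^sup>L (cond_measure M A) f = cond_exp_ev M A f"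
    and "\<And>f::'a \<Rightarrow> real. f \<in> borel_measurable M \<Longrightarrow> integrable (cond_measure M A) f \<longleftrightarrow> integrable M (\<lambda>x. indicator A x * f x)"
proof -
  show s: "sets (cond_measure M A) = sets M" and sp: "space (cond_measure M A) = space M"
    by (simp_all add: cond_measure_def)
  have em: "emeasure (cond_measure M A) B = ennreal (prob (A \<inter> B) / prob A)" if [measurable]: "B \<in> sets M" for B
  proof -
    have "emeasure (cond_measure M A) B = (\<integral>\<^sup>+x. ennreal (indicator A x / prob A) * indicator B x \<partial>M)"
      unfolding cond_measure_def by (subst emeasure_density) auto
    also have "\<dots> = (\<integral>\<^sup>+x. ennreal (1 / prob A) * indicator (A \<inter> B) x \<partial>M)"
      by (intro nn_integral_cong) (auto simp: indicator_def)
    also have "\<dots> = ennreal (1 / prob A) * ennreal (prob (A \<inter> B))"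
      by (subst nn_integral_cmult_indicator) (auto simp: emeasure_eq_measure)
    also have "\<dots> = ennreal (prob (A \<inter> B) / prob A)"
      using pos by (subst ennreal_mult[symmetric]) auto
    finally show ?thesis .
  qed
  show "prob_space (cond_measure M A)"
  proof
    show "emeasure (cond_measure M A) (space (cond_measure M A)) = 1"
      using em[OF sets.top] pos sets.sets_into_space[OF A] by (simp add: sp Int_absorb2)
  qed
  show "measure (cond_measure M A) B = prob (A \<inter> B) / prob A" if "B \<in> sets M" for B
    using em[OF that] pos by (simp add: measure_def)
  show "integral\<^sup>L (cond_measure M A) f = cond_exp_ev M A f" if [measurable]: "f \<in> borel_measurable M" for f
    unfolding cond_measure_def cond_exp_ev_def
    using pos by (subst integral_density) (auto simp: divide_inverse mult_ac simp flip: integral_mult_right_zero)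
  show "integrable (cond_measure M A) f \<longleftrightarrow> integrable M (\<lambda>x. indicator A x * f x)" if [measurable]: "f \<in> borel_measurable M" for f :: "'a \<Rightarrow> real"
  proof -
    have "integrable (cond_measure M A) f \<longleftrightarrow> integrable M (\<lambda>x. (indicator A x / prob A) * f x)"
      unfolding cond_measure_def by (subst integrable_density) auto
    also have "(\<lambda>x. (indicator A x / prob A) * f x) = (\<lambda>x. inverse (prob A) * (indicator A x * f x))"
      by (auto simp: divide_inverse)
    also have "integrable M \<dots> \<longleftrightarrow> integrable M (\<lambda>x. indicator A x * f x)"
      using pos by simp
    finally show ?thesis .
  qed
qed

lemma prob_space_std_pareto: "prob_space std_pareto"
proof
  have "((\<lambda>x::real. - 1 / x) \<longlongrightarrow> 0) at_top" by real_asymp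
  then have "(\<integral>\<^sup>+ p. ennreal (1 / p\<^sup>2) * indicator {1..} p \<partial>lborel) = ennreal (0 - (- 1 / 1))"
    by (intro nn_integral_FTC_atLeast) (auto intro!: derivative_eq_intros simp: power2_eq_square)
  also have "(\<integral>\<^sup>+ p. ennreal (1 / p\<^sup>2) * indicator {1..} p \<partial>lborel) = (\<integral>\<^sup>+ p. ennreal (indicator {1..} p / p\<^sup>2) \<partial>lborel)"
    by (intro nn_integral_cong) (auto simp: indicator_def)
  finally show "emeasure std_pareto (space std_pareto) = 1"
    unfolding std_pareto_def by (subst emeasure_density) (auto simp: cong: nn_integral_cong)
qed

context mda_unif
begin

text \<open>For a uniform margin the normalised exceedance probability is exactly 1 at every level
  below 1, so conditioning on \<open>y $ m > 1\<close> absorbs the factor \<open>ell_one\<close> of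
  the preceding limits.\<close>

lemma prob_Y_gt_1: "ell_one * Y.prob {y. y $ m > 1} = 1"
proof -
  have "((\<lambda>s. prob {\<omega> \<in> space M. U m \<omega> < s / 1 \<and> U m \<omega> < s / 1 \<and> U m \<omega> < s} / s)
     \<longlongrightarrow> ell_one * measure \<mu>Y {y. y $ m > 1 \<and> y $ m > 1 \<and> y $ m > 1}) (at_right 0)"
    by (rule tendsto_exceedances) auto
  moreover have "((\<lambda>s. prob {\<omega> \<in> space M. U m \<omega> < s / 1 \<and> U m \<omega> < s / 1 \<and> U m \<omega> < s} / s) \<longlongrightarrow> 1) (at_right 0)"
    by (rule tendsto_eventually, rule eventually_mono[OF small_s[OF zero_less_one]]) (simp add: prob_U_less)
  ultimately show ?thesis using tendsto_unique[of "at_right (0::real)"] by force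
qed

lemma Y_gt_measurable[measurable]: "{y. y $ m > c} \<in> sets \<mu>Y" "{y. y $ m \<le> c} \<in> sets \<mu>Y"
proof -
  have "{y \<in> space \<mu>Y. y $ m > c} \<in> sets \<mu>Y" "{y \<in> space \<mu>Y. y $ m \<le> c} \<in> sets \<mu>Y" by measurable
  then show "{y. y $ m > c} \<in> sets \<mu>Y" "{y. y $ m \<le> c} \<in> sets \<mu>Y" by simp_all
qed

lemma prob_Y_gt_1': "Y.prob {y. y $ m > 1} = 1 / ell_one" "Y.prob {y. y $ m > 1} > 0"
proof -
  show *: "Y.prob {y. y $ m > 1} = 1 / ell_one" using prob_Y_gt_1[of m] ell_one_ge_1 by (simp add: field_simps)
  show "Y.prob {y. y $ m > 1} > 0" unfolding * using ell_one_ge_1 by simp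
qed

abbreviation "Ym m \<equiv> cond_measure \<mu>Y {y. y $ m > 1}"

lemmas Ym = Y.cond_measure_props[OF Y_gt_measurable(1) prob_Y_gt_1'(2)]

lemma measure_Ym: "B \<in> sets \<mu>Y \<Longrightarrow> measure (Ym m) B = ell_one * Y.prob ({y. y $ m > 1} \<inter> B)"
  using ell_one_ge_1 by (simp add: Ym(4) prob_Y_gt_1')

lemma tendsto_cond_exceedances:
  assumes "a > 0" "b > 0"
  shows "((\<lambda>s. prob {\<omega> \<in> space M. U i \<omega> < s / a \<and> U j \<omega> < s / b \<and> U m \<omega> < s} / s)
     \<longlongrightarrow> measure (Ym m) {y. y $ i > a \<and> y $ j > b}) (at_right 0)"
proof -
  have "{y. y $ i > a \<and> y $ j > b} = {y. y $ i > a} \<inter> {y. y $ j > b}" by auto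
  then have "{y. y $ i > a \<and> y $ j > b} \<in> sets \<mu>Y" by simp
  from measure_Ym[OF this, of m] have "measure (Ym m) {y. y $ i > a \<and> y $ j > b} = ell_one * Y.prob {y. y $ i > a \<and> y $ j > b \<and> y $ m > 1}"
    by (simp add: Int_def conj_ac)
  then show ?thesis using tendsto_exceedances[OF assms] by simp
qed

lemma tendsto_cond_small:
  assumes z: "z > 0"
  shows "((\<lambda>s. prob {\<omega> \<in> space M. U i \<omega> \<ge> s * z \<and> U m \<omega> < s} / s) \<longlongrightarrow> measure (Ym m) {y. y $ i \<le> 1 / z}) (at_right 0)"
proof -
  have "((\<lambda>s. 1 - prob {\<omega> \<in> space M. U i \<omega> < s / (1/z) \<and> U i \<omega> < s / (1/z) \<and> U m \<omega> < s} / s)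
     \<longlongrightarrow> 1 - measure (Ym m) {y. y $ i > 1/z \<and> y $ i > 1/z}) (at_right 0)"
    using z by (intro tendsto_diff tendsto_const tendsto_cond_exceedances) auto
  also have "1 - measure (Ym m) {y. y $ i > 1/z \<and> y $ i > 1/z} = measure (Ym m) {y. y $ i \<le> 1 / z}"
  proof -
    have "{y. y $ i \<le> 1 / z} = space (Ym m) - {y. y $ i > 1/z}" by (auto simp: Ym)
    then show ?thesis by (simp add: prob_space.prob_compl[OF Ym(1)] Ym(2))
  qed
  finally show ?thesis
  proof (rule Lim_transform_eventually, intro eventually_mono[OF small_s[OF zero_less_one]])
    fix s :: real assume s: "0 < s \<and> s < 1"
    have "prob {\<omega> \<in> space M. U i \<omega> \<ge> s * z \<and> U m \<omega> < s}
       = prob ({\<omega> \<in> space M. U m \<omega> < s} - {\<omega> \<in> space M. U i \<omega> < s * z \<and> U m \<omega> < s})"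
      by (intro arg_cong[where f=prob]) auto
    also have "\<dots> = s - prob {\<omega> \<in> space M. U i \<omega> < s * z \<and> U m \<omega> < s}"
      using s by (subst finite_measure_Diff) (auto simp: prob_U_less)
    finally show "1 - prob {\<omega> \<in> space M. U i \<omega> < s / (1/z) \<and> U i \<omega> < s / (1/z) \<and> U m \<omega> < s} / s
      = prob {\<omega> \<in> space M. U i \<omega> \<ge> s * z \<and> U m \<omega> < s} / s"
      using s by (simp add: diff_divide_distrib)
  qed
qed

text \<open>The Pareto factor is at least 1, so small values of \<open>Y\<^sub>i\<close> force small values of \<open>W\<^sub>i\<close>.\<close>
lemma Ym_lower_tail:
  assumes W: "is_W_law \<mu>Y m \<mu>W" and \<gamma>: "\<gamma> > 0"
    and fin: "(\<integral>\<^sup>+ w. (if w $ i > 0 then ennreal ((w $ i) powr (- \<gamma>)) else \<infinity>) \<partial>\<mu>W) < \<infinity>"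
  obtains C where "C \<ge> 0" "\<And>z. z > 0 \<Longrightarrow> measure (Ym m) {y. y $ i \<le> 1 / z} \<le> C * z powr (- \<gamma>)"
proof -
  let ?h = "\<lambda>w::real^'d. (if w $ i > 0 then ennreal ((w $ i) powr (- \<gamma>)) else \<infinity>)"
  have WP: "prob_space \<mu>W" and WS[measurable_cong]: "sets \<mu>W = sets borel"
    and Wd: "distr (\<mu>W \<Otimes>\<^sub>M std_pareto) borel (\<lambda>(w, p). p *\<^sub>R w) = Ym m"
    using W by (auto simp: is_W_law_def)
  interpret W: prob_space \<mu>W by fact
  interpret P: prob_space std_pareto by (rule prob_space_std_pareto)
  interpret WPP: pair_prob_space \<mu>W std_pareto ..
  have PS[measurable_cong]: "sets std_pareto = sets borel" by (simp add: std_pareto_def)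
  have spW[simp]: "space \<mu>W = UNIV" using sets_eq_imp_space_eq[OF WS] by simp
  have spP[simp]: "space std_pareto = UNIV" by (simp add: std_pareto_def)
  have [measurable]: "(\<lambda>w. w $ i) \<in> borel_measurable \<mu>W"
    using borel_measurable_nth[of i] by (simp cong: measurable_cong_sets add: WS)
  have [measurable]: "(\<lambda>y::real^'d. y $ i) \<in> borel_measurable borel" by (rule borel_measurable_nth)
  have AEp: "AE p in std_pareto. p \<ge> 1"
    unfolding std_pareto_def by (subst AE_density) (auto simp: indicator_def)
  obtain C where C: "C \<ge> 0" "(\<integral>\<^sup>+ w. ?h w \<partial>\<mu>W) = ennreal C"
    using fin by (cases "\<integral>\<^sup>+ w. ?h w \<partial>\<mu>W") auto
  have "measure (Ym m) {y. y $ i \<le> 1 / z} \<le> C * z powr (- \<gamma>)" if z: "z > 0" for z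
  proof -
    have "emeasure (Ym m) {y. y $ i \<le> 1 / z} = emeasure (distr (\<mu>W \<Otimes>\<^sub>M std_pareto) borel (\<lambda>(w, p). p *\<^sub>R w)) {y. y $ i \<le> 1 / z}"
      by (simp add: Wd)
    also have "\<dots> = emeasure (\<mu>W \<Otimes>\<^sub>M std_pareto) {x \<in> space (\<mu>W \<Otimes>\<^sub>M std_pareto). snd x * fst x $ i \<le> 1 / z}"
    proof (subst emeasure_distr)
      have "(\<lambda>x. snd x *\<^sub>R fst x :: real^'d) \<in> borel_measurable (\<mu>W \<Otimes>\<^sub>M std_pareto)"
        by (intro borel_measurable_scaleR) measurable
      then show "(\<lambda>(w, p). p *\<^sub>R w) \<in> borel_measurable (\<mu>W \<Otimes>\<^sub>M std_pareto)" by (simp add: case_prod_unfold)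
      have "{y \<in> space borel. y $ i \<le> 1 / z} \<in> sets borel" by measurable
      then show "{y. y $ i \<le> 1 / z} \<in> sets borel" by simp
    qed (auto intro!: arg_cong2[where f=emeasure] simp: case_prod_unfold)
    also have "\<dots> \<le> emeasure (\<mu>W \<Otimes>\<^sub>M std_pareto) ({w. w $ i \<le> 1 / z} \<times> UNIV)"
    proof (rule emeasure_mono_AE)
      have "AE x in \<mu>W \<Otimes>\<^sub>M std_pareto. snd x \<ge> 1"
        by (rule WPP.AE_pair_measure) (use AEp in auto)
      then show "AE x in \<mu>W \<Otimes>\<^sub>M std_pareto. x \<in> {x \<in> space (\<mu>W \<Otimes>\<^sub>M std_pareto). snd x * fst x $ i \<le> 1 / z} \<longrightarrow> x \<in> {w. w $ i \<le> 1 / z} \<times> UNIV"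
      proof eventually_elim
        case (elim x)
        have "fst x $ i \<le> 1 / z" if le: "snd x * fst x $ i \<le> 1 / z"
        proof (cases "fst x $ i \<ge> 0")
          case True
          then have "1 * fst x $ i \<le> snd x * fst x $ i" using elim by (intro mult_right_mono) auto
          then show ?thesis using le by simp
        next
          case False
          then have "fst x $ i < 0" by simp
          also have "0 < 1 / z" using z by simp
          finally show ?thesis by simp
        qed
        then show ?case by (cases x) auto
      qed
      have "{w \<in> space \<mu>W. w $ i \<le> 1 / z} \<times> space std_pareto \<in> sets (\<mu>W \<Otimes>\<^sub>M std_pareto)" by (intro pair_measureI) measurable
      then show "{w. w $ i \<le> 1 / z} \<times> UNIV \<in> sets (\<mu>W \<Otimes>\<^sub>M std_pareto)" by simp
    qed
    also have "\<dots> = emeasure \<mu>W {w \<in> space \<mu>W. w $ i \<le> 1 / z} * emeasure std_pareto (space std_pareto)"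
    proof (subst P.emeasure_pair_measure_Times[symmetric])
      show "{w \<in> space \<mu>W. w $ i \<le> 1 / z} \<in> sets \<mu>W" by measurable
    qed simp_all
    also have "\<dots> = (\<integral>\<^sup>+ w. indicator {w \<in> space \<mu>W. w $ i \<le> 1 / z} w \<partial>\<mu>W)"
      using P.emeasure_space_1 by simp
    \<comment> \<open>Markov's inequality for the negative power. The integrand is \<infinity> where
      \<open>w $ i\<close> is not positive, so its finite integral accounts for a possible atom at 0
      as well.\<close>
    also have "\<dots> \<le> (\<integral>\<^sup>+ w. ennreal (z powr (- \<gamma>)) * ?h w \<partial>\<mu>W)"
    proof (rule nn_integral_mono)
      fix w
      have "1 \<le> ennreal (z powr (- \<gamma>)) * ?h w" if "w $ i \<le> 1 / z"
      proof (cases "w $ i > 0")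
        case True
        have "1 = (z * (1 / z)) powr (- \<gamma>)" using z by simp
        also have "\<dots> \<le> (z * w $ i) powr (- \<gamma>)"
          using True z \<gamma> that by (intro powr_mono2') (auto simp: field_simps)
        also have "\<dots> = z powr (- \<gamma>) * (w $ i) powr (- \<gamma>)" using True z by (simp add: powr_mult)
        finally show ?thesis using True by (simp add: ennreal_mult[symmetric] ennreal_1[symmetric] ennreal_leI del: ennreal_1)
      next
        case False
        then show ?thesis using z by (simp add: ennreal_mult_top)
      qed
      then show "indicator {w \<in> space \<mu>W. w $ i \<le> 1 / z} w \<le> ennreal (z powr (- \<gamma>)) * ?h w" by (cases "w $ i \<le> 1 / z") (simp_all del: if_split)
    qed
    also have "\<dots> = ennreal (z powr (- \<gamma>)) * (\<integral>\<^sup>+ w. ?h w \<partial>\<mu>W)" by (rule nn_integral_cmult) measurable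
    also have "\<dots> = ennreal (C * z powr (- \<gamma>))" unfolding C(2) using C by (simp add: ennreal_mult mult.commute)
    finally show ?thesis
      using C z by (simp add: measure_def enn2real_leI)
  qed
  with C(1) show thesis by (rule that)
qed

text \<open>The event splits disjointly into \<open>U i \<omega> < s\<close> and the case
  \<open>U i \<omega> \<ge> s\<close> with \<open>U m \<omega> < s / z\<close>; the second piece
  belongs to level \<open>s / z\<close>. Since (B) is phrased with \<open>Lim\<close>, which can be
  evaluated only through a proved convergence, this is what gives access to it at the point
  \<open>(1, 1 / z)\<close>.\<close>

lemma tendsto_exc_pair:
  assumes im: "i \<noteq> m" and z: "z \<ge> 1"
  shows "((\<lambda>s. prob {\<omega> \<in> space M. \<exists>l\<in>{i, m}. U l \<omega> < s * (\<chi> l. if l = i then 1 else 1 / z) $ l} / s)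
     \<longlongrightarrow> 1 + measure (Ym m) {y. y $ i \<le> 1 / z} / z) (at_right 0)"
proof -
  have lim: "filterlim (\<lambda>s. s / z) (at_right 0) (at_right 0)"
    using z by (auto simp: filterlim_at intro!: tendsto_eq_intros eventually_mono[OF small_s[OF zero_less_one]])
  have "((\<lambda>s. 1 + prob {\<omega> \<in> space M. U i \<omega> \<ge> (s / z) * z \<and> U m \<omega> < s / z} / (s / z) / z)
     \<longlongrightarrow> 1 + measure (Ym m) {y. y $ i \<le> 1 / z} / z) (at_right 0)"
    by (intro tendsto_add tendsto_divide tendsto_const filterlim_compose[OF tendsto_cond_small lim]) (use z in auto)
  then show ?thesis
  proof (rule Lim_transform_eventually, intro eventually_mono[OF small_s[OF zero_less_one]])
    fix s :: real assume s: "0 < s \<and> s < 1"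
    have "{\<omega> \<in> space M. \<exists>l\<in>{i, m}. U l \<omega> < s * (\<chi> l. if l = i then 1 else 1 / z) $ l}
      = {\<omega> \<in> space M. U i \<omega> < s} \<union> {\<omega> \<in> space M. U i \<omega> \<ge> (s / z) * z \<and> U m \<omega> < s / z}"
      using im z by auto
    moreover have "prob \<dots> = s + prob {\<omega> \<in> space M. U i \<omega> \<ge> (s / z) * z \<and> U m \<omega> < s / z}"
      using s z by (subst finite_measure_Union) (auto simp: prob_U_less)
    ultimately show "1 + prob {\<omega> \<in> space M. U i \<omega> \<ge> (s / z) * z \<and> U m \<omega> < s / z} / (s / z) / z =
      prob {\<omega> \<in> space M. \<exists>l\<in>{i, m}. U l \<omega> < s * (\<chi> l. if l = i then 1 else 1 / z) $ l} / s"
      using s z by (simp add: field_simps)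
  qed
qed

end

section \<open>Polynomial joint tails at finite levels\<close>

locale mda_unif_rate = mda_unif M U ell \<mu>Y
  for M :: "'a measure" and U :: "'d::finite \<Rightarrow> 'a \<Rightarrow> real" and ell \<mu>Y +
  assumes B: "\<exists>\<xi>>0. \<forall>I::'d set. card I \<in> {2, 3} \<longrightarrow>
      (\<exists>C. \<forall>\<^sub>F s in at_right 0. \<forall>x::real^'d. (\<forall>l\<in>I. 0 \<le> x $ l \<and> x $ l \<le> 1) \<longrightarrow>
         \<bar>prob {\<omega> \<in> space M. \<exists>l\<in>I. U l \<omega> < s * x $ l} / s
           - Lim (at_right 0) (\<lambda>q. prob {\<omega> \<in> space M. \<exists>l\<in>I. U l \<omega> < q * x $ l} / q)\<bar> \<le> C * s powr \<xi>)"
    and T: "\<exists>\<gamma>>0. \<forall>m' i'::'d. \<exists>\<mu>W. is_W_law \<mu>Y m' \<mu>W \<and>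
      (\<integral>\<^sup>+ w. (if w $ i' > 0 then ennreal ((w $ i') powr (- \<gamma>)) else \<infinity>) \<partial>\<mu>W) < \<infinity>"
begin

text \<open>Condition (B) is applied at level \<open>q z\<close>, so that its supremum over the unit square also covers
  the far-out event \<open>{U\<^sub>i \<ge> q z, U\<^sub>m < q}\<close>; this costs the factor \<open>z powr (1 + \<xi>)\<close> in the error.\<close>
lemma joint_tail_rate:
  assumes im: "i \<noteq> m"
  obtains C \<gamma> \<xi> s0 where "C \<ge> 0" "\<gamma> > 0" "\<xi> > 0" "0 < s0" "s0 \<le> 1"
    "\<And>q z. 0 < q \<Longrightarrow> z \<ge> 1 \<Longrightarrow> q * z < s0 \<Longrightarrow>
       prob {\<omega> \<in> space M. U i \<omega> \<ge> q * z \<and> U m \<omega> < q} \<le> q * (C * z powr (-\<gamma>) + C * (q powr \<xi> * z powr (1 + \<xi>)))"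
proof -
  have card: "card {i, m} \<in> {2, 3}" using im by simp
  from B obtain \<xi> where \<xi>: "\<xi> > 0" and B1: "\<forall>I::'d set. card I \<in> {2, 3} \<longrightarrow>
      (\<exists>C. \<forall>\<^sub>F s in at_right 0. \<forall>x::real^'d. (\<forall>l\<in>I. 0 \<le> x $ l \<and> x $ l \<le> 1) \<longrightarrow>
         \<bar>prob {\<omega> \<in> space M. \<exists>l\<in>I. U l \<omega> < s * x $ l} / s
           - Lim (at_right 0) (\<lambda>q. prob {\<omega> \<in> space M. \<exists>l\<in>I. U l \<omega> < q * x $ l} / q)\<bar> \<le> C * s powr \<xi>)"
    by (elim exE conjE)
  from B1[rule_format, OF card] obtain CB where
    "\<forall>\<^sub>F s in at_right 0. \<forall>x::real^'d. (\<forall>l\<in>{i,m}. 0 \<le> x $ l \<and> x $ l \<le> 1) \<longrightarrow>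
         \<bar>prob {\<omega> \<in> space M. \<exists>l\<in>{i,m}. U l \<omega> < s * x $ l} / s
           - Lim (at_right 0) (\<lambda>q. prob {\<omega> \<in> space M. \<exists>l\<in>{i,m}. U l \<omega> < q * x $ l} / q)\<bar> \<le> CB * s powr \<xi>"
    by (elim exE)
  then obtain s1 where s1: "s1 > 0" and B': "\<And>s x. 0 < s \<Longrightarrow> s < s1 \<Longrightarrow> (\<forall>l\<in>{i,m}. 0 \<le> x $ l \<and> x $ l \<le> 1) \<Longrightarrow>
         \<bar>prob {\<omega> \<in> space M. \<exists>l\<in>{i,m}. U l \<omega> < s * x $ l} / s
           - Lim (at_right 0) (\<lambda>q. prob {\<omega> \<in> space M. \<exists>l\<in>{i,m}. U l \<omega> < q * x $ l} / q)\<bar> \<le> CB * s powr \<xi>"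
    unfolding eventually_at_right_field by (elim exE conjE) (rule that, auto)
  from T obtain \<gamma> \<mu>W where \<gamma>: "\<gamma> > 0" and W: "is_W_law \<mu>Y m \<mu>W"
    "(\<integral>\<^sup>+ w. (if w $ i > 0 then ennreal ((w $ i) powr (- \<gamma>)) else \<infinity>) \<partial>\<mu>W) < \<infinity>" by blast
  obtain CT where CT: "CT \<ge> 0" "\<And>z. z > 0 \<Longrightarrow> measure (Ym m) {y. y $ i \<le> 1 / z} \<le> CT * z powr (- \<gamma>)"
    using Ym_lower_tail[OF W(1) \<gamma> W(2)] by blast
  define C where "C = max CT \<bar>CB\<bar>"
  define s0 where "s0 = min s1 1"
  have main: "prob {\<omega> \<in> space M. U i \<omega> \<ge> q * z \<and> U m \<omega> < q} \<le> q * (C * z powr (-\<gamma>) + C * (q powr \<xi> * z powr (1 + \<xi>)))"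
    if q: "0 < q" and z: "z \<ge> 1" and qz: "q * z < s0" for q z
  proof -
    define s where "s = q * z"
    have s: "0 < s" "s < s1" "s \<le> 1" using q z qz by (auto simp: s_def s0_def)
    \<comment> \<open>At level \<open>s = q * z\<close> this point has the thresholds
      \<open>q * z\<close> for \<open>U i\<close> and \<open>q\<close> for \<open>U m\<close>. The
      union event consists of \<open>U i \<omega> < s\<close>, of mass \<open>s\<close>, and the
      wanted event, so the leading 1 of the limit cancels.\<close>
    let ?x = "(\<chi> l. if l = i then 1 else 1 / z) :: real^'d"
    have Lim: "Lim (at_right 0) (\<lambda>q. prob {\<omega> \<in> space M. \<exists>l\<in>{i,m}. U l \<omega> < q * ?x $ l} / q)
       = 1 + measure (Ym m) {y. y $ i \<le> 1 / z} / z"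
      by (rule tendsto_Lim[OF _ tendsto_exc_pair[OF im z]]) simp
    have "\<bar>prob {\<omega> \<in> space M. \<exists>l\<in>{i,m}. U l \<omega> < s * ?x $ l} / s - (1 + measure (Ym m) {y. y $ i \<le> 1 / z} / z)\<bar> \<le> CB * s powr \<xi>"
      unfolding Lim[symmetric] by (rule B') (use s z in auto)
    then have "prob {\<omega> \<in> space M. \<exists>l\<in>{i,m}. U l \<omega> < s * ?x $ l} / s \<le> 1 + measure (Ym m) {y. y $ i \<le> 1 / z} / z + CB * s powr \<xi>"
      by linarith
    also have "\<dots> \<le> 1 + (C * z powr (-\<gamma>)) / z + C * s powr \<xi>"
      using CT(2)[of z] z by (intro add_mono divide_right_mono mult_right_mono order.trans[OF CT(2)]) (auto simp: C_def)
    finally have le: "prob {\<omega> \<in> space M. \<exists>l\<in>{i,m}. U l \<omega> < s * ?x $ l} \<le> s * (1 + (C * z powr (-\<gamma>)) / z + C * s powr \<xi>)"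
      using s by (simp add: divide_le_eq mult.commute)
    have "prob {\<omega> \<in> space M. \<exists>l\<in>{i,m}. U l \<omega> < s * ?x $ l} = prob ({\<omega> \<in> space M. U i \<omega> < s} \<union> {\<omega> \<in> space M. U i \<omega> \<ge> q * z \<and> U m \<omega> < q})"
      using im z q by (intro arg_cong[where f=prob]) (auto simp: s_def)
    also have "\<dots> = s + prob {\<omega> \<in> space M. U i \<omega> \<ge> q * z \<and> U m \<omega> < q}"
      using s by (subst finite_measure_Union) (auto simp: prob_U_less s_def)
    finally have "prob {\<omega> \<in> space M. U i \<omega> \<ge> q * z \<and> U m \<omega> < q} \<le> s * ((C * z powr (-\<gamma>)) / z + C * s powr \<xi>)"
      using le by (simp add: algebra_simps)
    also have "\<dots> = q * (C * z powr (-\<gamma>) + C * (q powr \<xi> * z powr (1 + \<xi>)))"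
      using q z by (simp add: s_def powr_add powr_mult field_simps)
    finally show ?thesis .
  qed
  show thesis
    by (rule that[of C \<gamma> \<xi> s0, OF _ \<gamma> \<xi> _ _ main]) (use CT(1) s1 in \<open>auto simp: C_def s0_def\<close>)
qed

text \<open>Below \<open>z = q powr (- a)\<close> the bound of the previous lemma is a power of \<open>z\<close>; beyond, the event shrinks with
  \<open>z\<close> and is empty for \<open>q z > 1\<close>, so the value at \<open>z = q powr (- a)\<close> is already a power of \<open>z \<le> 1 / q\<close>.\<close>
lemma joint_tail:
  obtains C \<delta> where "C \<ge> 1" "\<delta> > 0"
    "\<And>q z. 0 < q \<Longrightarrow> q \<le> 1 \<Longrightarrow> z \<ge> 1 \<Longrightarrow> prob {\<omega> \<in> space M. U i \<omega> > q * z \<and> U m \<omega> < q} \<le> C * q * z powr (-\<delta>)"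
proof (cases "i = m")
  case True
  have "prob {\<omega> \<in> space M. U i \<omega> > q * z \<and> U m \<omega> < q} \<le> 1 * q * z powr (-1)" if "0 < q" "q \<le> 1" "z \<ge> 1" for q z
  proof -
    have "q * 1 \<le> q * z" using that by (intro mult_left_mono) auto
    then have "{\<omega> \<in> space M. U i \<omega> > q * z \<and> U m \<omega> < q} = {}" using True by auto
    then show ?thesis using that by (simp only: measure_empty) simp
  qed
  then show thesis by (rule that[rotated 2]) auto
next
  case False
  obtain C \<gamma> \<xi> s0 where C: "C \<ge> 0" and \<gamma>: "\<gamma> > 0" and \<xi>: "\<xi> > 0" and s0: "0 < s0" "s0 \<le> 1" and
    tail: "\<And>q z. 0 < q \<Longrightarrow> z \<ge> 1 \<Longrightarrow> q * z < s0 \<Longrightarrow>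
       prob {\<omega> \<in> space M. U i \<omega> \<ge> q * z \<and> U m \<omega> < q} \<le> q * (C * z powr (-\<gamma>) + C * (q powr \<xi> * z powr (1 + \<xi>)))"
    using joint_tail_rate[OF False] by blast
  \<comment> \<open>By choice \<open>a * (1 + \<xi>) = \<xi> / 2\<close>. For
    \<open>z \<le> q powr (- a)\<close> the error \<open>q powr \<xi> * z powr (1 + \<xi>)\<close>
    is then at most \<open>q powr (\<xi> / 2)\<close>, hence at most
    \<open>z powr (- (1 + \<xi>))\<close>, which explains \<open>\<delta>1\<close>. Since
    \<open>a < 1/2\<close>, also \<open>q * z \<le> sqrt q\<close>, and this is below
    \<open>s0\<close> as soon as \<open>q < q0\<close>. At the cutoff the bound becomes
    \<open>q powr (a * \<delta>1)\<close>, whence \<open>\<delta>\<close>.\<close>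
  define a where "a = \<xi> / (2 * (1 + \<xi>))"
  define \<delta>1 where "\<delta>1 = min \<gamma> (1 + \<xi>)"
  define \<delta> where "\<delta> = a * \<delta>1"
  define q0 where "q0 = s0\<^sup>2"
  \<comment> \<open>The second entry serves levels \<open>q \<ge> q0\<close>: there
    \<open>q * z \<le> 1\<close> forces \<open>q0 * z \<le> 1\<close>, and the trivial bound
    \<open>q\<close> suffices.\<close>
  define C' where "C' = max (2 * C) (q0 powr (-\<delta>))"
  have a: "0 < a" "a < 1/2" "a * (1 + \<xi>) = \<xi> / 2" using \<xi> by (auto simp: a_def field_simps)
  have \<delta>: "0 < \<delta>1" "0 < \<delta>" using a \<gamma> \<xi> by (auto simp: \<delta>1_def) (auto simp: \<delta>_def \<delta>1_def)
  have "\<delta> \<le> \<delta>1" using a \<delta>(1) mult_right_mono[of a 1 \<delta>1] by (simp add: \<delta>_def)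
  note \<delta> = \<delta> this
  have q0: "0 < q0" "q0 \<le> 1" using s0 by (auto simp: q0_def power_le_one)
  have "1 powr (-\<delta>) \<le> q0 powr (-\<delta>)" using q0 \<delta> by (intro powr_mono2') auto
  then have C'1: "C' \<ge> 1" by (simp add: C'_def)
  let ?p = "\<lambda>q z. prob {\<omega> \<in> space M. U i \<omega> > q * z \<and> U m \<omega> < q}"
  have small: "?p q z \<le> 2 * C * q * z powr (-\<delta>1)" if q: "0 < q" "q < q0" and z: "z \<ge> 1" "z \<le> q powr (-a)" for q z
  proof -
    have q1: "q < 1" using q q0 by simp
    have "q * z \<le> q powr 1 * q powr (-a)" using q z by simp
    also have "\<dots> = q powr (1 - a)" unfolding powr_add[symmetric] by simp
    also have "\<dots> \<le> q powr (1/2)" using q q1 a by (intro powr_mono') auto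
    also have "\<dots> = sqrt q" using q by (simp add: powr_half_sqrt)
    also have "\<dots> < s0" using q s0 by (intro real_less_lsqrt) (auto simp: q0_def)
    finally have qz: "q * z < s0" .
    have zq: "q \<le> z powr (-1/a)"
    proof -
      have "(q powr (-a)) powr (-1/a) \<le> z powr (-1/a)" using z a q by (intro powr_mono2') auto
      then show ?thesis using a q by (simp add: powr_powr)
    qed
    have "q powr \<xi> * z powr (1 + \<xi>) \<le> q powr \<xi> * (q powr (-a)) powr (1 + \<xi>)"
      using z \<xi> by (intro mult_left_mono powr_mono2) auto
    also have "\<dots> = q powr (\<xi> - a * (1 + \<xi>))" by (subst powr_powr, subst powr_add[symmetric]) simp
    also have "\<dots> = q powr (\<xi> / 2)" by (subst a(3)) simp
    also have "\<dots> \<le> (z powr (-1/a)) powr (\<xi> / 2)" using zq q \<xi> by (intro powr_mono2) auto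
    also have "\<dots> = z powr (-(1 + \<xi>))"
    proof -
      have "(-1/a) * (\<xi>/2) = -(1 + \<xi>)" unfolding a(3)[symmetric] using a(1) by simp
      then show ?thesis by (simp only: powr_powr)
    qed
    also have "\<dots> \<le> z powr (-\<delta>1)" using z by (intro powr_mono) (auto simp: \<delta>1_def)
    finally have 1: "q powr \<xi> * z powr (1 + \<xi>) \<le> z powr (-\<delta>1)" .
    have 2: "z powr (-\<gamma>) \<le> z powr (-\<delta>1)" using z by (intro powr_mono) (auto simp: \<delta>1_def)
    have "?p q z \<le> prob {\<omega> \<in> space M. U i \<omega> \<ge> q * z \<and> U m \<omega> < q}" by (intro finite_measure_mono) auto
    also have "\<dots> \<le> q * (C * z powr (-\<gamma>) + C * (q powr \<xi> * z powr (1 + \<xi>)))" by (rule tail[OF q(1) z(1) qz])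
    also have "\<dots> \<le> q * (C * z powr (-\<delta>1) + C * z powr (-\<delta>1))"
      using q C 1 2 by (intro mult_left_mono add_mono) auto
    finally show ?thesis by (simp add: algebra_simps)
  qed
  have "?p q z \<le> C' * q * z powr (-\<delta>)" if q: "0 < q" "q \<le> 1" and z: "z \<ge> 1" for q z
  proof -
    consider "q * z > 1" | "q * z \<le> 1" "q \<ge> q0" | "q < q0" "z \<le> q powr (-a)" | "q * z \<le> 1" "q < q0" "z > q powr (-a)"
      by (cases "q * z > 1"; cases "q < q0"; cases "z \<le> q powr (-a)") (simp_all only: not_less not_le)
    then show ?thesis
    proof cases
      case 1
      then have "\<not> U i \<omega> > q * z" for \<omega> using U_le_1[of i \<omega>] by linarith
      then have "{\<omega> \<in> space M. U i \<omega> > q * z \<and> U m \<omega> < q} = {}" by simp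
      then show ?thesis using C'1 q by (simp only: measure_empty) simp
    next
      case 2
      have "?p q z \<le> prob {\<omega> \<in> space M. U m \<omega> < q}" by (intro finite_measure_mono) auto
      also have "\<dots> = q" using q by (simp add: prob_U_less)
      also have "\<dots> \<le> q * (q0 powr (-\<delta>) * z powr (-\<delta>))"
      proof -
        have "q0 * z \<le> q * z" using 2 z by (intro mult_right_mono) auto
        then have "q0 * z \<le> 1" using 2 by simp
        then have "1 powr (-\<delta>) \<le> (q0 * z) powr (-\<delta>)" using q0 z \<delta> by (intro powr_mono2') auto
        then have "1 \<le> q0 powr (-\<delta>) * z powr (-\<delta>)" using q0 z by (simp add: powr_mult)
        from mult_left_mono[OF this, of q] show ?thesis using q by simp
      qed
      also have "\<dots> \<le> q * (C' * z powr (-\<delta>))"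
        using q by (intro mult_left_mono mult_right_mono) (auto simp: C'_def)
      finally show ?thesis by (simp add: mult_ac)
    next
      case 3
      have "?p q z \<le> 2 * C * q * z powr (-\<delta>1)" using small 3 q z by simp
      also have "\<dots> \<le> C' * q * z powr (-\<delta>)"
        using C q z \<delta> by (intro mult_mono powr_mono mult_nonneg_nonneg) (auto simp: C'_def)
      finally show ?thesis .
    next
      case 4
      let ?z = "q powr (-a)"
      have "1 powr (-a) \<le> ?z" using q a by (intro powr_mono2') auto
      then have z1: "?z \<ge> 1" by simp
      have "?p q z \<le> ?p q ?z"
      proof (intro finite_measure_mono)
        have "q * ?z \<le> q * z" using 4 q by (intro mult_left_mono) auto
        then show "{\<omega> \<in> space M. U i \<omega> > q * z \<and> U m \<omega> < q} \<subseteq> {\<omega> \<in> space M. U i \<omega> > q * ?z \<and> U m \<omega> < q}" by auto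
      qed auto
      also have "\<dots> \<le> 2 * C * q * ?z powr (-\<delta>1)" using small[of q ?z] 4 q z1 by simp
      also have "?z powr (-\<delta>1) = q powr \<delta>" by (simp add: powr_powr \<delta>_def)
      also have "q powr \<delta> \<le> (1 / z) powr \<delta>" using q z 4 \<delta> by (intro powr_mono2) (auto simp: field_simps)
      also have "\<dots> = z powr (-\<delta>)" using z by (simp add: powr_divide powr_minus_divide)
      finally have "?p q z \<le> 2 * C * q * z powr (-\<delta>)" using C q by (simp add: mult_left_mono)
      also have "\<dots> \<le> C' * q * z powr (-\<delta>)"
        using C q by (intro mult_right_mono) (auto simp: C'_def)
      finally show ?thesis .
    qed
  qed
  then show thesis using C'1 \<delta>(2) that by blast
qed

end

section \<open>Moments of log-ratios\<close>

lemma power2_diff_le: "(x - y)\<^sup>2 \<le> 2 * x\<^sup>2 + 2 * y\<^sup>2" for x y :: real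
  using zero_le_power2[of "x + y"] by (simp add: power2_eq_square algebra_simps)

context mda_unif_rate
begin

text \<open>There are finitely many pairs of coordinates, so the worst constant and exponent serve
  for all. The cap \<open>\<delta> \<le> 1\<close> makes the same exponent dominate the opposite
  tail, where the uniform margin gives \<open>exp (- s)\<close>.\<close>

lemma joint_tail_all:
  obtains C \<delta> where "C \<ge> 1" "\<delta> > 0" "\<delta> \<le> 1"
    "\<And>i m q s. 0 < q \<Longrightarrow> q \<le> 1 \<Longrightarrow> s \<ge> 0 \<Longrightarrow> prob {\<omega> \<in> space M. U i \<omega> \<ge> q * exp s \<and> U m \<omega> < q} \<le> C * q * exp (-\<delta> * s)"
proof -
  let ?P = "\<lambda>p C \<delta>. C \<ge> 1 \<and> \<delta> > 0 \<and> (\<forall>q z. 0 < q \<longrightarrow> q \<le> 1 \<longrightarrow> z \<ge> 1 \<longrightarrow>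
     prob {\<omega> \<in> space M. U (fst p) \<omega> > q * z \<and> U (snd p) \<omega> < q} \<le> C * q * z powr (-\<delta>))"
  have "\<exists>C \<delta>. ?P p C \<delta>" for p
    by (rule joint_tail[of "fst p" "snd p"]) blast
  then have "\<forall>p. \<exists>C \<delta>. ?P p C \<delta>" by blast
  from choice[OF this] obtain C where "\<forall>p. \<exists>\<delta>. ?P p (C p) \<delta>" by blast
  from choice[OF this] obtain \<delta> where CD: "\<forall>p. ?P p (C p) (\<delta> p)" by blast
  have C: "\<And>p. C p \<ge> 1" "\<And>p. \<delta> p > 0"
    "\<And>p q z. 0 < q \<Longrightarrow> q \<le> 1 \<Longrightarrow> z \<ge> 1 \<Longrightarrow>
     prob {\<omega> \<in> space M. U (fst p) \<omega> > q * z \<and> U (snd p) \<omega> < q} \<le> C p * q * z powr (-\<delta> p)"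
    using CD by blast+
  define C' where "C' = Max (range C)"
  define \<delta>' where "\<delta>' = min 1 (Min (range \<delta>))"
  have C'C: "C p \<le> C'" for p unfolding C'_def by (intro Max_ge) auto
  have C'1: "C' \<ge> 1" using C(1) C'C order.trans by blast
  have \<delta>'\<delta>: "\<delta>' \<le> \<delta> p" for p unfolding \<delta>'_def by (intro min.coboundedI2 Min_le) auto
  have \<delta>': "\<delta>' > 0" "\<delta>' \<le> 1" using C(2) by (auto simp: \<delta>'_def)
  have "prob {\<omega> \<in> space M. U i \<omega> \<ge> q * exp s \<and> U m \<omega> < q} \<le> C' * q * exp (-\<delta>' * s)"
    if q: "0 < q" "q \<le> 1" and s: "s \<ge> 0" for i m q s
  proof -
    have "prob {\<omega> \<in> space M. U i \<omega> \<ge> q * exp s \<and> U m \<omega> < q} \<le> prob {\<omega> \<in> space M. U i \<omega> > q * exp s \<and> U m \<omega> < q}"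
    proof (rule finite_measure_mono_AE)
      have "AE \<omega> in M. U i \<omega> \<noteq> q * exp s"
      proof (cases "q * exp s \<le> 1")
        case True
        then show ?thesis using q by (intro AE_U_neq) auto
      next
        case False
        have "U i \<omega> \<noteq> q * exp s" for \<omega> using False U_le_1[of i \<omega>] by linarith
        then show ?thesis by simp
      qed
      then show "AE \<omega> in M. \<omega> \<in> {\<omega> \<in> space M. U i \<omega> \<ge> q * exp s \<and> U m \<omega> < q} \<longrightarrow>
          \<omega> \<in> {\<omega> \<in> space M. U i \<omega> > q * exp s \<and> U m \<omega> < q}"
        by eventually_elim auto
    qed simp
    also have "\<dots> \<le> C (i, m) * q * exp s powr (-\<delta> (i, m))" using C(3)[of q "exp s" "(i, m)"] q s by simp
    also have "\<dots> \<le> C' * q * exp s powr (-\<delta>')"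
      using q s C'C[of "(i,m)"] \<delta>'\<delta>[of "(i,m)"] C'1 by (intro mult_mono powr_mono) auto
    also have "exp s powr (-\<delta>') = exp (-\<delta>' * s)" by (simp add: powr_def)
    finally show ?thesis .
  qed
  with C'1 \<delta>' show thesis by (rule that)
qed

section \<open>Conditional moments of logarithmic margins\<close>

definition exc :: "'d \<Rightarrow> real \<Rightarrow> 'a set" where "exc m q = {\<omega> \<in> space M. U m \<omega> < q}"

lemma exc_measurable[measurable]: "exc m q \<in> sets M" unfolding exc_def by measurable

lemma prob_exc: "0 \<le> q \<Longrightarrow> q \<le> 1 \<Longrightarrow> prob (exc m q) = q" unfolding exc_def by (rule prob_U_less)

text \<open>Logarithms of the rescaled margins and of \<open>Y\<close>; the index \<open>None\<close> stands for the constant 1, so that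
  first moments are covered by products of two such variables.\<close>
fun lv :: "'d option \<Rightarrow> real \<Rightarrow> 'a \<Rightarrow> real" where
  "lv None q \<omega> = 1"
| "lv (Some l) q \<omega> = ln q - ln (U l \<omega>)"

fun lY :: "'d option \<Rightarrow> real^'d \<Rightarrow> real" where
  "lY None y = 1"
| "lY (Some l) y = ln (y $ l)"

lemma lv_measurable[measurable]: "lv o1 q \<in> borel_measurable M"
proof (cases o1)
  case None
  then have "lv o1 q = (\<lambda>_. 1)" by auto
  then show ?thesis by simp
next
  case (Some l)
  then have "lv o1 q = (\<lambda>\<omega>. ln q - ln (U l \<omega>))" by auto
  then show ?thesis by simp
qed

lemma lY_measurable[measurable]: "lY o1 \<in> borel_measurable \<mu>Y"
proof (cases o1)
  case None
  then have "lY o1 = (\<lambda>_. 1)" by auto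
  then show ?thesis by simp
next
  case (Some l)
  then have "lY o1 = (\<lambda>y. ln (y $ l))" by auto
  then show ?thesis by simp
qed

lemma lv_gt_iff: "U l \<omega> > 0 \<Longrightarrow> q > 0 \<Longrightarrow> lv (Some l) q \<omega> > s \<longleftrightarrow> U l \<omega> < q / exp s"
proof -
  assume a: "U l \<omega> > 0" "q > 0"
  have "lv (Some l) q \<omega> > s \<longleftrightarrow> ln (U l \<omega>) < ln (q / exp s)" using a by (simp add: ln_div) linarith
  also have "\<dots> \<longleftrightarrow> U l \<omega> < q / exp s" using a by (intro ln_less_cancel_iff) auto
  finally show ?thesis .
qed

lemma lv_gt_AE:
  assumes "q > 0"
  shows "AE \<omega> in M. lv (Some l) q \<omega> > s \<longleftrightarrow> U l \<omega> < q / exp s"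
  using AE_U_pos[of l] by eventually_elim (simp only: lv_gt_iff assms)

lemma cond_exc:
  assumes "0 < q" "q \<le> 1"
  shows "prob_space (cond_measure M (exc m q))"
    "sets (cond_measure M (exc m q)) = sets M" "space (cond_measure M (exc m q)) = space M"
    "\<And>B. B \<in> sets M \<Longrightarrow> measure (cond_measure M (exc m q)) B = prob (exc m q \<inter> B) / q"
    "\<And>f. f \<in> borel_measurable M \<Longrightarrow> integral\<^sup>L (cond_measure M (exc m q)) f = cond_exp_ev M (exc m q) f"
    "\<And>f::'a\<Rightarrow>real. f \<in> borel_measurable M \<Longrightarrow> integrable (cond_measure M (exc m q)) f \<longleftrightarrow> integrable M (\<lambda>x. indicator (exc m q) x * f x)"
  using cond_measure_props[OF exc_measurable, of m q] assms by (simp_all add: prob_exc)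

text \<open>Very negative values of \<open>lv (Some l)\<close> mean large \<open>U l\<close> and are
  controlled by the joint tail. Large positive values mean small \<open>U l\<close>; there the
  condition on \<open>U m\<close> is dropped and the uniform margin alone suffices.\<close>

lemma lv_tails:
  obtains C \<delta> where "C \<ge> 0" "\<delta> > 0"
    "\<And>o1 m q s. 0 < q \<Longrightarrow> q \<le> 1 \<Longrightarrow> (\<integral>x. \<bar>layer s (lv o1 q x)\<bar> \<partial>cond_measure M (exc m q)) \<le> C * exp (- \<delta> * \<bar>s\<bar>)"
proof -
  from joint_tail_all obtain C \<delta> where C: "C \<ge> 1" "\<delta> > 0" "\<delta> \<le> 1"
    "\<And>i m q s. 0 < q \<Longrightarrow> q \<le> 1 \<Longrightarrow> s \<ge> 0 \<Longrightarrow> prob {\<omega> \<in> space M. U i \<omega> \<ge> q * exp s \<and> U m \<omega> < q} \<le> C * q * exp (-\<delta> * s)"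
    by blast
  \<comment> \<open>For the constant variable the kernel is nonzero exactly when
    \<open>0 \<le> s < 1\<close>, and there
    \<open>exp 1 * exp (- \<delta> * s) \<ge> 1\<close>.\<close>
  define C' where "C' = max C (exp 1)"
  have C': "C' \<ge> 1" "C' \<ge> C" "C' \<ge> exp 1" using C by (auto simp: C'_def)
  have "(\<integral>x. \<bar>layer s (lv o1 q x)\<bar> \<partial>cond_measure M (exc m q)) \<le> C' * exp (- \<delta> * \<bar>s\<bar>)"
    if q: "0 < q" "q \<le> 1" for o1 m q s
  proof (cases o1)
    case None
    interpret N: prob_space "cond_measure M (exc m q)" by (rule cond_exc[OF q])
    have "(\<integral>x. \<bar>layer s (lv o1 q x)\<bar> \<partial>cond_measure M (exc m q)) = \<bar>layer s 1\<bar>"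
      using None N.prob_space by simp
    also have "\<dots> \<le> C' * exp (- \<delta> * \<bar>s\<bar>)"
    proof (cases "0 \<le> s \<and> s < 1")
      case True
      have "\<delta> * s \<le> 1" using True C by (intro mult_le_one) auto
      then have "1 \<le> exp 1 * exp (- \<delta> * s)" unfolding exp_add[symmetric] by simp
      also have "\<dots> \<le> C' * exp (- \<delta> * s)" using C' by (intro mult_right_mono) auto
      finally show ?thesis using True by (simp add: layer_def)
    next
      case False
      then have "layer s 1 = 0" by (auto simp: layer_def)
      then show ?thesis using C' by simp
    qed
    finally show ?thesis .
  next
    case (Some l)
    have [measurable]: "lv o1 q \<in> borel_measurable (cond_measure M (exc m q))"
      by (subst measurable_cong_sets[OF cond_exc(2)[OF q] refl]) (rule lv_measurable)
    have neg: "prob (exc m q \<inter> {x \<in> space M. lv o1 q x \<le> s}) / q \<le> C' * exp (- \<delta> * \<bar>s\<bar>)" if s: "s < 0"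
    proof -
      have "prob (exc m q \<inter> {x \<in> space M. lv o1 q x \<le> s}) \<le> prob {\<omega> \<in> space M. U l \<omega> \<ge> q * exp (-s) \<and> U m \<omega> < q}"
      proof (rule finite_measure_mono_AE)
        show "AE x in M. x \<in> exc m q \<inter> {x \<in> space M. lv o1 q x \<le> s} \<longrightarrow> x \<in> {\<omega> \<in> space M. U l \<omega> \<ge> q * exp (-s) \<and> U m \<omega> < q}"
          using lv_gt_AE[OF q(1), of s l] by eventually_elim (auto simp: Some exc_def exp_minus divide_inverse)
      qed simp
      also have "\<dots> \<le> C * q * exp (-\<delta> * (-s))" by (rule C(4)) (use q s in auto)
      also have "\<dots> \<le> C' * q * exp (-\<delta> * (-s))" using q C' by (intro mult_right_mono) auto
      finally show ?thesis using q s by (simp add: divide_le_eq mult_ac)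
    qed
    have pos: "prob (exc m q \<inter> {x \<in> space M. lv o1 q x > s}) / q \<le> C' * exp (- \<delta> * \<bar>s\<bar>)" if s: "s \<ge> 0"
    proof -
      have "prob (exc m q \<inter> {x \<in> space M. lv o1 q x > s}) \<le> prob {\<omega> \<in> space M. U l \<omega> < q / exp s}"
      proof (rule finite_measure_mono_AE)
        show "AE x in M. x \<in> exc m q \<inter> {x \<in> space M. lv o1 q x > s} \<longrightarrow> x \<in> {\<omega> \<in> space M. U l \<omega> < q / exp s}"
          using lv_gt_AE[OF q(1), of s l] by eventually_elim (auto simp: Some exc_def)
      qed simp
      also have "\<dots> \<le> q / exp s" using q by (intro prob_U_less_le) auto
      also have "\<dots> = q * exp (- s)" by (simp add: exp_minus divide_inverse)
      also have "\<dots> \<le> q * exp (-\<delta> * s)" using C s q mult_right_mono[of \<delta> 1 s] by (intro mult_left_mono) auto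
      also have "\<dots> \<le> (C' * q) * exp (-\<delta> * s)" using q C' by (intro mult_right_mono) auto
      finally show ?thesis using q s by (simp add: divide_le_eq mult_ac)
    qed
    show ?thesis
      using neg pos
      by (subst prob_space.expectation_layer[OF cond_exc(1)[OF q]]) (simp_all add: cond_exc[OF q])
  qed
  with C C' that[of C' \<delta>] show thesis by auto
qed

text \<open>The lower tail bound at \<open>1 / z\<close> tends to 0 as \<open>z\<close> grows, so
  the conditional law has no mass at \<open>y $ i = 0\<close>. Comparisons of logarithms can
  therefore be read as comparisons of coordinates.\<close>

lemma Ym_pos: "AE y in Ym m. y $ i > 0"
proof -
  from T obtain \<gamma> \<mu>W where \<gamma>: "\<gamma> > 0" and W: "is_W_law \<mu>Y m \<mu>W"
    "(\<integral>\<^sup>+ w. (if w $ i > 0 then ennreal ((w $ i) powr (- \<gamma>)) else \<infinity>) \<partial>\<mu>W) < \<infinity>" by blast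
  obtain C where C: "C \<ge> 0" "\<And>z. z > 0 \<Longrightarrow> measure (Ym m) {y. y $ i \<le> 1 / z} \<le> C * z powr (- \<gamma>)"
    using Ym_lower_tail[OF W(1) \<gamma> W(2)] by blast
  interpret N: prob_space "Ym m" by (rule Ym)
  have "measure (Ym m) {y. y $ i \<le> 0} \<le> 0"
  proof (rule tendsto_lowerbound)
    show "((\<lambda>z. C * z powr (- \<gamma>)) \<longlongrightarrow> 0) at_top"
      using \<gamma> by (intro tendsto_mult_right_zero tendsto_neg_powr filterlim_ident) auto
    show "\<forall>\<^sub>F z in at_top. measure (Ym m) {y. y $ i \<le> 0} \<le> C * z powr (- \<gamma>)"
      using eventually_gt_at_top[of 0]
    proof eventually_elim
      case (elim z)
      have "0 < 1 / z" using elim by simp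
      then have "{y. y $ i \<le> 0} \<subseteq> {y. y $ i \<le> 1 / z}" by (auto simp del: zero_less_divide_1_iff)
      then have "measure (Ym m) {y. y $ i \<le> 0} \<le> measure (Ym m) {y. y $ i \<le> 1 / z}"
        by (intro N.finite_measure_mono) (auto simp: Ym)
      then show ?case using C(2)[OF elim] by simp
    qed
  qed simp
  then have "N.prob {y. y $ i \<le> 0} = 0" using measure_nonneg by (simp add: order.antisym)
  then have "AE y in Ym m. y \<notin> {y. y $ i \<le> 0}"
    by (subst (asm) N.prob_eq_0) (auto simp: Ym)
  then show ?thesis by eventually_elim auto
qed

lemma tendsto_lv_joint:
  assumes q: "\<And>n. 0 < q n" "\<And>n. q n \<le> 1" "q \<longlonglongrightarrow> 0"
  shows "(\<lambda>n. measure (cond_measure M (exc m (q n))) {x \<in> space (cond_measure M (exc m (q n))). lv o1 (q n) x > s \<and> lv o2 (q n) x > t})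
    \<longlonglongrightarrow> measure (Ym m) {y \<in> space (Ym m). lY o1 y > s \<and> lY o2 y > t}"
proof -
  interpret Y': prob_space "Ym m" by (rule Ym)
  have [measurable]: "lY o1 \<in> borel_measurable (Ym m)" for o1
    by (subst measurable_cong_sets[OF Ym(2) refl]) (rule lY_measurable)
  have [measurable]: "(\<lambda>y. y $ i) \<in> borel_measurable (Ym m)" for i
    by (subst measurable_cong_sets[OF Ym(2) refl]) (rule nth_measurable_Y)
  let ?N = "\<lambda>n. cond_measure M (exc m (q n))"
  have qlim: "filterlim q (at_right 0) sequentially"
    using q less_imp_neq[OF q(1)] by (auto simp: filterlim_at intro!: always_eventually)
  have base: "(\<lambda>n. measure (?N n) {x \<in> space (?N n). lv (Some i) (q n) x > s \<and> lv (Some j) (q n) x > t})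
    \<longlonglongrightarrow> measure (Ym m) {y \<in> space (Ym m). lY (Some i) y > s \<and> lY (Some j) y > t}" for i j s t
  proof -
    have "(\<lambda>n. prob {\<omega> \<in> space M. U i \<omega> < q n / exp s \<and> U j \<omega> < q n / exp t \<and> U m \<omega> < q n} / q n)
       \<longlonglongrightarrow> measure (Ym m) {y. y $ i > exp s \<and> y $ j > exp t}"
      by (rule filterlim_compose[OF tendsto_cond_exceedances qlim]) auto
    also have "measure (Ym m) {y. y $ i > exp s \<and> y $ j > exp t} = measure (Ym m) {y \<in> space (Ym m). lY (Some i) y > s \<and> lY (Some j) y > t}"
    proof (rule measure_eq_AE)
      have "{y \<in> space (Ym m). y $ i > exp s \<and> y $ j > exp t} \<in> sets (Ym m)" by measurable
      then show "{y. y $ i > exp s \<and> y $ j > exp t} \<in> sets (Ym m)" by (simp add: Ym)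
      show "AE y in Ym m. y \<in> {y. y $ i > exp s \<and> y $ j > exp t} \<longleftrightarrow> y \<in> {y \<in> space (Ym m). lY (Some i) y > s \<and> lY (Some j) y > t}"
        using Ym_pos[where i=i and m=m] Ym_pos[where i=j and m=m]
      proof eventually_elim
        case (elim y)
        then have "u > exp v \<longleftrightarrow> ln u > v" if "u > 0" for u v :: real using that by (metis exp_less_cancel_iff exp_ln)
        with elim show ?case by (simp add: Ym)
      qed
    qed measurable
    finally show ?thesis
    proof (rule Lim_transform_eventually, intro always_eventually allI)
      fix n
      have "prob {\<omega> \<in> space M. U i \<omega> < q n / exp s \<and> U j \<omega> < q n / exp t \<and> U m \<omega> < q n}
         = prob (exc m (q n) \<inter> {x \<in> space M. lv (Some i) (q n) x > s \<and> lv (Some j) (q n) x > t})"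
      proof (rule measure_eq_AE)
        show "AE x in M. x \<in> {\<omega> \<in> space M. U i \<omega> < q n / exp s \<and> U j \<omega> < q n / exp t \<and> U m \<omega> < q n} \<longleftrightarrow>
           x \<in> exc m (q n) \<inter> {x \<in> space M. lv (Some i) (q n) x > s \<and> lv (Some j) (q n) x > t}"
          using lv_gt_AE[OF q(1)[of n], of s i] lv_gt_AE[OF q(1)[of n], of t j]
          by eventually_elim (auto simp: exc_def simp del: lv.simps)
      qed measurable
      then show "prob {\<omega> \<in> space M. U i \<omega> < q n / exp s \<and> U j \<omega> < q n / exp t \<and> U m \<omega> < q n} / q n =
         measure (?N n) {x \<in> space (?N n). lv (Some i) (q n) x > s \<and> lv (Some j) (q n) x > t}"
        by (simp add: cond_exc[OF q(1,2)] del: lv.simps)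
    qed
  qed
  have single: "(\<lambda>n. measure (?N n) {x \<in> space (?N n). lv (Some i) (q n) x > s})
    \<longlonglongrightarrow> measure (Ym m) {y \<in> space (Ym m). lY (Some i) y > s}" for i s
    using base[of s i s i] by simp
  have one: "measure (?N n) (space (?N n)) = 1" for n
    using prob_space.prob_space[OF cond_exc(1)[OF q(1,2)]] .
  show ?thesis
  \<comment> \<open>The constant variable exceeds \<open>s\<close> iff \<open>s < 1\<close>;
    depending on the level the event reduces to the other variable or is empty.\<close>
  proof (cases o1; cases o2)
    fix i j assume "o1 = Some i" "o2 = Some j"
    then show ?thesis using base by blast
  next
    fix i assume "o1 = Some i" "o2 = None"
    then show ?thesis using single by (cases "t < 1") (auto simp del: lv.simps(2) lY.simps(2))
  next
    fix i assume "o1 = None" "o2 = Some i"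
    then show ?thesis using single by (cases "s < 1") (auto simp del: lv.simps(2) lY.simps(2))
  next
    assume "o1 = None" "o2 = None"
    then show ?thesis using one Y'.prob_space by (cases "s < 1"; cases "t < 1") auto
  qed
qed

lemma tendsto_lv_mult:
  assumes q: "\<And>n. 0 < q n" "\<And>n. q n \<le> 1" "q \<longlonglongrightarrow> 0"
  shows "\<And>n. integrable (cond_measure M (exc m (q n))) (\<lambda>x. lv o1 (q n) x * lv o2 (q n) x)"
    and "integrable (Ym m) (\<lambda>y. lY o1 y * lY o2 y)"
    and "(\<lambda>n. \<integral>x. lv o1 (q n) x * lv o2 (q n) x \<partial>cond_measure M (exc m (q n))) \<longlonglongrightarrow> (\<integral>y. lY o1 y * lY o2 y \<partial>Ym m)"
proof -
  interpret Y': prob_space "Ym m" by (rule Ym)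
  obtain C \<delta> where C: "C \<ge> 0" "\<delta> > 0"
    "\<And>o1 m q s. 0 < q \<Longrightarrow> q \<le> 1 \<Longrightarrow> (\<integral>x. \<bar>layer s (lv o1 q x)\<bar> \<partial>cond_measure M (exc m q)) \<le> C * exp (- \<delta> * \<bar>s\<bar>)"
    using lv_tails by blast
  have m': "lY o1 \<in> borel_measurable (Ym m)" for o1
    by (subst measurable_cong_sets[OF Ym(2) refl]) (rule lY_measurable)
  have m: "lv o1 (q n) \<in> borel_measurable (cond_measure M (exc m (q n)))" for o1 n
    by (subst measurable_cong_sets[OF cond_exc(2)[OF q(1,2)] refl]) (rule lv_measurable)
  have lim1: "(\<lambda>n. measure (cond_measure M (exc m (q n))) {x \<in> space (cond_measure M (exc m (q n))). lv o1 (q n) x > s})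
    \<longlonglongrightarrow> measure (Ym m) {y \<in> space (Ym m). lY o1 y > s}" for o1 s
    using tendsto_lv_joint[OF q, where ?o1.0=o1 and ?o2.0=o1 and s=s and t=s] by simp
  show "\<And>n. integrable (cond_measure M (exc m (q n))) (\<lambda>x. lv o1 (q n) x * lv o2 (q n) x)"
    by (rule prob_space.expectation_mult_layer(1)[OF cond_exc(1)[OF q(1,2)] m m C(1,2) C(3)[OF q(1,2)] C(3)[OF q(1,2)]])
  note * = tendsto_expectation_mult[OF cond_exc(1)[OF q(1,2)] Ym(1) m m m' m' C(1,2) C(3)[OF q(1,2)] C(3)[OF q(1,2)] lim1 lim1 tendsto_lv_joint[OF q]]
  show "integrable (Ym m) (\<lambda>y. lY o1 y * lY o2 y)" by (rule *)
  show "(\<lambda>n. \<integral>x. lv o1 (q n) x * lv o2 (q n) x \<partial>cond_measure M (exc m (q n))) \<longlonglongrightarrow> (\<integral>y. lY o1 y * lY o2 y \<partial>Ym m)"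
    by (rule *)
qed

text \<open>\<open>lv (Some l) q\<close> is the logarithm of \<open>q / U l\<close>, the counterpart
  of \<open>ln (y $ l)\<close>. The common \<open>ln q\<close> cancels in differences, and
  \<open>ln (U i \<omega>) - ln (U j \<omega>)\<close> corresponds to
  \<open>ln (y $ j) - ln (y $ i)\<close>: hence the sign in the first limit, which the square
  removes.\<close>

lemma tendsto_cond_moments:
  assumes q: "\<And>n. 0 < q n" "\<And>n. q n \<le> 1" "q \<longlonglongrightarrow> 0"
  shows "(\<lambda>n. cond_exp_ev M (exc m (q n)) (\<lambda>\<omega>. ln (U i \<omega>) - ln (U j \<omega>)))
      \<longlonglongrightarrow> - cond_exp_ev \<mu>Y {y. y $ m > 1} (\<lambda>y. ln (y $ i) - ln (y $ j))" (is ?first)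
    and "(\<lambda>n. cond_exp_ev M (exc m (q n)) (\<lambda>\<omega>. (ln (U i \<omega>) - ln (U j \<omega>))\<^sup>2))
      \<longlonglongrightarrow> cond_exp_ev \<mu>Y {y. y $ m > 1} (\<lambda>y. (ln (y $ i) - ln (y $ j))\<^sup>2)" (is ?second)
    and "ext_variogram \<mu>Y m i j = cond_exp_ev \<mu>Y {y. y $ m > 1} (\<lambda>y. (ln (y $ i) - ln (y $ j))\<^sup>2) - (cond_exp_ev \<mu>Y {y. y $ m > 1} (\<lambda>y. ln (y $ i) - ln (y $ j)))\<^sup>2"
proof -
  interpret Y': prob_space "Ym m" by (rule Ym)
  let ?N = "\<lambda>n. cond_measure M (exc m (q n))"
  let ?I = "Some i" and ?J = "Some j"
  note L = tendsto_lv_mult[OF q, of m]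
  have e1: "cond_exp_ev M (exc m (q n)) (\<lambda>\<omega>. ln (U i \<omega>) - ln (U j \<omega>)) =
      (\<integral>x. lv None (q n) x * lv ?J (q n) x \<partial>?N n) - (\<integral>x. lv None (q n) x * lv ?I (q n) x \<partial>?N n)" for n
    unfolding cond_exc(5)[OF q(1,2), symmetric] Bochner_Integration.integral_diff[OF L(1) L(1), symmetric]
    by (subst cond_exc(5)[OF q(1,2), symmetric]) auto
  have e2: "cond_exp_ev M (exc m (q n)) (\<lambda>\<omega>. (ln (U i \<omega>) - ln (U j \<omega>))\<^sup>2) =
      (\<integral>x. lv ?I (q n) x * lv ?I (q n) x \<partial>?N n) + (\<integral>x. lv ?J (q n) x * lv ?J (q n) x \<partial>?N n)
       - 2 * (\<integral>x. lv ?I (q n) x * lv ?J (q n) x \<partial>?N n)" for n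
    unfolding Bochner_Integration.integral_add[OF L(1) L(1), symmetric] integral_mult_right_zero[symmetric]
      Bochner_Integration.integral_diff[OF Bochner_Integration.integrable_add[OF L(1) L(1)] integrable_mult_right[OF L(1)], symmetric]
    by (subst cond_exc(5)[OF q(1,2), symmetric]) (auto simp: power2_eq_square algebra_simps intro!: Bochner_Integration.integral_cong)
  have y1: "cond_exp_ev \<mu>Y {y. y $ m > 1} (\<lambda>y. ln (y $ i) - ln (y $ j)) =
      (\<integral>y. lY None y * lY ?I y \<partial>Ym m) - (\<integral>y. lY None y * lY ?J y \<partial>Ym m)"
    unfolding Bochner_Integration.integral_diff[OF L(2) L(2), symmetric]
    by (subst Ym(5)[symmetric]) auto
  have y2: "cond_exp_ev \<mu>Y {y. y $ m > 1} (\<lambda>y. (ln (y $ i) - ln (y $ j))\<^sup>2) =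
      (\<integral>y. lY ?I y * lY ?I y \<partial>Ym m) + (\<integral>y. lY ?J y * lY ?J y \<partial>Ym m) - 2 * (\<integral>y. lY ?I y * lY ?J y \<partial>Ym m)"
    unfolding Bochner_Integration.integral_add[OF L(2) L(2), symmetric] integral_mult_right_zero[symmetric]
      Bochner_Integration.integral_diff[OF Bochner_Integration.integrable_add[OF L(2) L(2)] integrable_mult_right[OF L(2)], symmetric]
    by (subst Ym(5)[symmetric]) (auto simp: power2_eq_square algebra_simps intro!: Bochner_Integration.integral_cong)
  show ?first unfolding e1 y1 minus_diff_eq by (intro tendsto_diff L(3))
  show ?second unfolding e2 y2 by (intro tendsto_diff tendsto_add tendsto_mult tendsto_const L(3))
  have i1: "integrable (Ym m) (\<lambda>y. ln (y $ i) - ln (y $ j))"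
    using Bochner_Integration.integrable_diff[OF L(2)[of None ?I] L(2)[of None ?J]] by simp
  have i2: "integrable (Ym m) (\<lambda>y. (ln (y $ i) - ln (y $ j))\<^sup>2)"
    using Bochner_Integration.integrable_diff[OF Bochner_Integration.integrable_add[OF L(2)[of ?I ?I] L(2)[of ?J ?J]] integrable_mult_right[OF L(2)[of ?I ?J], of 2]]
    by (simp add: power2_eq_square algebra_simps)
  have "ext_variogram \<mu>Y m i j = Y'.variance (\<lambda>y. ln (y $ i) - ln (y $ j))"
    unfolding ext_variogram_def cond_var_ev_def by (simp add: Ym(5))
  also have "\<dots> = Y'.expectation (\<lambda>y. (ln (y $ i) - ln (y $ j))\<^sup>2) - (Y'.expectation (\<lambda>y. ln (y $ i) - ln (y $ j)))\<^sup>2"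
    by (rule Y'.variance_eq[OF i1 i2])
  finally show "ext_variogram \<mu>Y m i j = cond_exp_ev \<mu>Y {y. y $ m > 1} (\<lambda>y. (ln (y $ i) - ln (y $ j))\<^sup>2) - (cond_exp_ev \<mu>Y {y. y $ m > 1} (\<lambda>y. ln (y $ i) - ln (y $ j)))\<^sup>2"
    by (simp add: Ym(5))
qed

text \<open>The bound is proportional to \<open>q\<close>, the mass of the conditioning event. It is
  needed for variances of squared log-ratios, for the Cauchy-Schwarz step that compares nested
  samples, and for margins below \<open>1 / n\<close>, which ranks cannot follow.\<close>

lemma fourth_moment_lv:
  obtains K where "K \<ge> 0"
    "\<And>l m q. 0 < q \<Longrightarrow> q \<le> 1 \<Longrightarrow> integrable M (\<lambda>\<omega>. indicator (exc m q) \<omega> * (ln q - ln (U l \<omega>)) ^ 4)"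
    "\<And>l m q. 0 < q \<Longrightarrow> q \<le> 1 \<Longrightarrow> expectation (\<lambda>\<omega>. indicator (exc m q) \<omega> * (ln q - ln (U l \<omega>)) ^ 4) \<le> K * q"
proof -
  from joint_tail_all obtain C \<delta> where C: "C \<ge> 1" "\<delta> > 0" "\<delta> \<le> 1"
    "\<And>i m q s. 0 < q \<Longrightarrow> q \<le> 1 \<Longrightarrow> s \<ge> 0 \<Longrightarrow> prob {\<omega> \<in> space M. U i \<omega> \<ge> q * exp s \<and> U m \<omega> < q} \<le> C * q * exp (-\<delta> * s)"
    by blast
  define K where "K = (1 + C) * (\<Sum>n. (real n + 1) ^ 4 * exp (- \<delta> * real n))"
  have K0: "K \<ge> 0" unfolding K_def using C by (intro mult_nonneg_nonneg suminf_nonneg summable_power4_exp) auto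
  have p4: "\<bar>x\<bar> ^ 4 = x ^ 4" for x :: real by (simp add: power_even_abs)
  have *: "integrable M (\<lambda>\<omega>. indicator (exc m q) \<omega> * (ln q - ln (U l \<omega>)) ^ 4) \<and>
      expectation (\<lambda>\<omega>. indicator (exc m q) \<omega> * (ln q - ln (U l \<omega>)) ^ 4) \<le> K * q"
    if q: "0 < q" "q \<le> 1" for l m q
  proof -
    have tail: "prob {x \<in> exc m q. \<bar>ln q - ln (U l x)\<bar> \<ge> real n} \<le> ((1 + C) * q) * exp (- \<delta> * real n)" for n
    proof -
      have "prob {x \<in> exc m q. \<bar>ln q - ln (U l x)\<bar> \<ge> real n} \<le>
         prob ({\<omega> \<in> space M. U l \<omega> \<le> q * exp (- real n)} \<union> {\<omega> \<in> space M. U l \<omega> \<ge> q * exp (real n) \<and> U m \<omega> < q})"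
      proof (rule finite_measure_mono_AE)
        show "AE x in M. x \<in> {x \<in> exc m q. \<bar>ln q - ln (U l x)\<bar> \<ge> real n} \<longrightarrow>
          x \<in> {\<omega> \<in> space M. U l \<omega> \<le> q * exp (- real n)} \<union> {\<omega> \<in> space M. U l \<omega> \<ge> q * exp (real n) \<and> U m \<omega> < q}"
          using AE_U_pos[of l]
        proof eventually_elim
          case (elim x)
          have 1: "U l x \<le> q * exp (- real n)" if "ln q - ln (U l x) \<ge> real n"
          proof -
            have "exp (ln (U l x)) \<le> exp (ln q - real n)" using that by (subst exp_le_cancel_iff) simp
            then show ?thesis using elim q by (simp add: exp_diff exp_minus divide_inverse)
          qed
          have 2: "U l x \<ge> q * exp (real n)" if "- (ln q - ln (U l x)) \<ge> real n"
          proof -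
            have "exp (ln q + real n) \<le> exp (ln (U l x))" using that by (subst exp_le_cancel_iff) simp
            then show ?thesis using elim q by (simp add: exp_add)
          qed
          show ?case using 1 2 by (auto simp: exc_def abs_if split: if_splits)
        qed
      qed simp
      also have "\<dots> \<le> prob {\<omega> \<in> space M. U l \<omega> \<le> q * exp (- real n)} + prob {\<omega> \<in> space M. U l \<omega> \<ge> q * exp (real n) \<and> U m \<omega> < q}"
        by (intro measure_Un_le) auto
      also have "\<dots> \<le> q * exp (- real n) + C * q * exp (-\<delta> * real n)"
        using q by (intro add_mono prob_U_le_le C(4)) auto
      also have "\<dots> \<le> q * exp (- \<delta> * real n) + C * q * exp (-\<delta> * real n)"
        using q C mult_right_mono[of \<delta> 1 "real n"] by (intro add_mono mult_left_mono) auto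
      finally show ?thesis by (simp add: algebra_simps)
    qed
    show ?thesis
      using fourth_moment_le[of "\<lambda>x. \<bar>ln q - ln (U l x)\<bar>" "exc m q" \<delta>, OF _ _ _ C(2) tail]
      by (simp add: p4 K_def mult_ac)
  qed
  show thesis using that[OF K0] * by blast
qed

lemma fourth_moment_log_ratio:
  obtains K where "K \<ge> 0"
    "\<And>i j m q. 0 < q \<Longrightarrow> integrable M (\<lambda>\<omega>. indicator {\<omega> \<in> space M. U m \<omega> \<le> q} \<omega> * (ln (U i \<omega>) - ln (U j \<omega>)) ^ 4)"
    "\<And>i j m q. 0 < q \<Longrightarrow> expectation (\<lambda>\<omega>. indicator {\<omega> \<in> space M. U m \<omega> \<le> q} \<omega> * (ln (U i \<omega>) - ln (U j \<omega>)) ^ 4) \<le> K * q"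
proof -
  obtain K where K: "K \<ge> 0"
    "\<And>l m q. 0 < q \<Longrightarrow> q \<le> 1 \<Longrightarrow> integrable M (\<lambda>\<omega>. indicator (exc m q) \<omega> * (ln q - ln (U l \<omega>)) ^ 4)"
    "\<And>l m q. 0 < q \<Longrightarrow> q \<le> 1 \<Longrightarrow> expectation (\<lambda>\<omega>. indicator (exc m q) \<omega> * (ln q - ln (U l \<omega>)) ^ 4) \<le> K * q"
    using fourth_moment_lv by blast
  have ineq: "(a - b) ^ 4 \<le> 8 * (c - a) ^ 4 + 8 * (c - b) ^ 4" for a b c :: real
  proof -
    have sq': "(x + y)\<^sup>2 \<le> 2 * x\<^sup>2 + 2 * y\<^sup>2" for x y :: real
      using zero_le_power2[of "x - y"] by (simp add: power2_eq_square algebra_simps)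
    have "((a - b)\<^sup>2)\<^sup>2 \<le> (2 * (c - b)\<^sup>2 + 2 * (c - a)\<^sup>2)\<^sup>2"
      using power2_diff_le[of "c - b" "c - a"] by (intro power_mono) auto
    also have "\<dots> \<le> 2 * (2 * (c - b)\<^sup>2)\<^sup>2 + 2 * (2 * (c - a)\<^sup>2)\<^sup>2" by (rule sq')
    finally show ?thesis by (simp add: power_mult_distrib flip: power_mult)
  qed
  have *: "integrable M (\<lambda>\<omega>. indicator {\<omega> \<in> space M. U m \<omega> \<le> q} \<omega> * (ln (U i \<omega>) - ln (U j \<omega>)) ^ 4) \<and>
      expectation (\<lambda>\<omega>. indicator {\<omega> \<in> space M. U m \<omega> \<le> q} \<omega> * (ln (U i \<omega>) - ln (U j \<omega>)) ^ 4) \<le> 16 * K * q"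
    if q: "0 < q" for i j m q
  proof -
    define p where "p = min q 1"
    have p: "0 < p" "p \<le> 1" "p \<le> q" using q by (auto simp: p_def)
    let ?f = "\<lambda>\<omega>. 8 * (indicator (exc m p) \<omega> * (ln p - ln (U i \<omega>)) ^ 4) + 8 * (indicator (exc m p) \<omega> * (ln p - ln (U j \<omega>)) ^ 4)"
    have int: "integrable M ?f" using K(2)[OF p(1,2)] by (intro Bochner_Integration.integrable_add integrable_mult_right)
    have AE: "AE \<omega> in M. indicator {\<omega> \<in> space M. U m \<omega> \<le> q} \<omega> * (ln (U i \<omega>) - ln (U j \<omega>)) ^ 4 \<le> ?f \<omega>"
    proof -
      have "AE \<omega> in M. U m \<omega> \<noteq> p" using p by (intro AE_U_neq) auto
      with AE_space show ?thesis
      proof eventually_elim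
        case (elim \<omega>)
        have nn: "0 \<le> ?f \<omega>" by (intro add_nonneg_nonneg mult_nonneg_nonneg) auto
        show ?case
        proof (cases "U m \<omega> \<le> q")
          case True
          then have "U m \<omega> < p" using elim U_le_1[of m \<omega>] by (auto simp: p_def min_def split: if_splits)
          then have "\<omega> \<in> exc m p" using elim by (simp add: exc_def)
          then show ?thesis using ineq[of "ln (U i \<omega>)" "ln (U j \<omega>)" "ln p"] True elim by simp
        next
          case False
          then show ?thesis using nn by simp
        qed
      qed
    qed
    have int': "integrable M (\<lambda>\<omega>. indicator {\<omega> \<in> space M. U m \<omega> \<le> q} \<omega> * (ln (U i \<omega>) - ln (U j \<omega>)) ^ 4)"
    proof (rule Bochner_Integration.integrable_bound[OF int])
      show "AE \<omega> in M. norm (indicator {\<omega> \<in> space M. U m \<omega> \<le> q} \<omega> * (ln (U i \<omega>) - ln (U j \<omega>)) ^ 4) \<le> norm (?f \<omega>)"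
        using AE
      proof eventually_elim
        case (elim \<omega>)
        have "norm (indicator {\<omega> \<in> space M. U m \<omega> \<le> q} \<omega> * (ln (U i \<omega>) - ln (U j \<omega>)) ^ 4) = indicator {\<omega> \<in> space M. U m \<omega> \<le> q} \<omega> * (ln (U i \<omega>) - ln (U j \<omega>)) ^ 4"
          by (simp add: abs_mult)
        with elim show ?case by simp
      qed
    qed measurable
    have "expectation (\<lambda>\<omega>. indicator {\<omega> \<in> space M. U m \<omega> \<le> q} \<omega> * (ln (U i \<omega>) - ln (U j \<omega>)) ^ 4) \<le> expectation ?f"
      by (rule integral_mono_AE[OF int' int AE])
    also have "\<dots> = 8 * expectation (\<lambda>\<omega>. indicator (exc m p) \<omega> * (ln p - ln (U i \<omega>)) ^ 4) + 8 * expectation (\<lambda>\<omega>. indicator (exc m p) \<omega> * (ln p - ln (U j \<omega>)) ^ 4)"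
      using K(2)[OF p(1,2)] by (subst Bochner_Integration.integral_add) (simp_all only: integrable_mult_right integral_mult_right_zero)
    also have "\<dots> \<le> 8 * (K * p) + 8 * (K * p)" by (intro add_mono mult_left_mono K(3) p) auto
    also have "\<dots> = 16 * K * p" by simp
    also have "\<dots> \<le> 16 * K * q" using K(1) p by (intro mult_left_mono) auto
    finally show ?thesis using int' by blast
  qed
  show thesis using that[of "16 * K"] * K(1) by simp
qed

end

section \<open>Independent samples and ranks\<close>

lemma (in prob_space) expectation_indep_pair:
  fixes h :: "'b \<times> 'b \<Rightarrow> real"
  assumes ind: "indep_var N A N' B" and [measurable]: "h \<in> borel_measurable (N \<Otimes>\<^sub>M N')"
    and int: "integrable M (\<lambda>\<omega>. h (A \<omega>, B \<omega>))"
  shows "expectation (\<lambda>\<omega>. h (A \<omega>, B \<omega>)) = (\<integral>y. (\<integral>x. h (x, y) \<partial>distr M N A) \<partial>distr M N' B)"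
proof -
  have A[measurable]: "A \<in> measurable M N" and B[measurable]: "B \<in> measurable M N'"
    and eq: "distr M N A \<Otimes>\<^sub>M distr M N' B = distr M (N \<Otimes>\<^sub>M N') (\<lambda>x. (A x, B x))"
    using ind by (auto simp: indep_var_distribution_eq)
  interpret PA: prob_space "distr M N A" by (rule prob_space_distr) simp
  interpret PB: prob_space "distr M N' B" by (rule prob_space_distr) simp
  interpret P: pair_prob_space "distr M N A" "distr M N' B" ..
  have "integrable (distr M (N \<Otimes>\<^sub>M N') (\<lambda>x. (A x, B x))) h"
    using int by (subst integrable_distr_eq) auto
  then have i: "integrable (distr M N A \<Otimes>\<^sub>M distr M N' B) (case_prod (\<lambda>x y. h (x, y)))" by (simp add: eq)
  have "expectation (\<lambda>\<omega>. h (A \<omega>, B \<omega>)) = integral\<^sup>L (distr M (N \<Otimes>\<^sub>M N') (\<lambda>x. (A x, B x))) h"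
    by (subst integral_distr) auto
  also have "\<dots> = integral\<^sup>L (distr M N A \<Otimes>\<^sub>M distr M N' B) (case_prod (\<lambda>x y. h (x, y)))" by (simp add: eq)
  also have "\<dots> = (\<integral>y. (\<integral>x. h (x, y) \<partial>distr M N A) \<partial>distr M N' B)"
    by (rule P.integral_snd[OF i, symmetric])
  finally show ?thesis .
qed

lemma (in prob_space) expectation_square_sum_orthogonal:
  fixes Z :: "'i \<Rightarrow> 'a \<Rightarrow> real"
  assumes fin: "finite I" and int: "\<And>s t. s \<in> I \<Longrightarrow> t \<in> I \<Longrightarrow> integrable M (\<lambda>\<omega>. Z s \<omega> * Z t \<omega>)"
    and orth: "\<And>s t. s \<in> I \<Longrightarrow> t \<in> I \<Longrightarrow> s \<noteq> t \<Longrightarrow> expectation (\<lambda>\<omega>. Z s \<omega> * Z t \<omega>) = 0"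
  shows "integrable M (\<lambda>\<omega>. (\<Sum>t\<in>I. Z t \<omega>)\<^sup>2)"
    "expectation (\<lambda>\<omega>. (\<Sum>t\<in>I. Z t \<omega>)\<^sup>2) = (\<Sum>t\<in>I. expectation (\<lambda>\<omega>. (Z t \<omega>)\<^sup>2))"
proof -
  have eq: "(\<lambda>\<omega>. (\<Sum>t\<in>I. Z t \<omega>)\<^sup>2) = (\<lambda>\<omega>. \<Sum>s\<in>I. \<Sum>t\<in>I. Z s \<omega> * Z t \<omega>)"
    by (simp add: power2_eq_square sum_product)
  show "integrable M (\<lambda>\<omega>. (\<Sum>t\<in>I. Z t \<omega>)\<^sup>2)" unfolding eq
    by (intro Bochner_Integration.integrable_sum int)
  have "expectation (\<lambda>\<omega>. (\<Sum>t\<in>I. Z t \<omega>)\<^sup>2) = (\<Sum>s\<in>I. \<Sum>t\<in>I. expectation (\<lambda>\<omega>. Z s \<omega> * Z t \<omega>))"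
    unfolding eq using int by (simp add: Bochner_Integration.integral_sum Bochner_Integration.integrable_sum)
  also have "\<dots> = (\<Sum>s\<in>I. \<Sum>t\<in>I. if t = s then expectation (\<lambda>\<omega>. (Z s \<omega>)\<^sup>2) else 0)"
    by (intro sum.cong refl) (auto simp: orth power2_eq_square)
  also have "\<dots> = (\<Sum>t\<in>I. expectation (\<lambda>\<omega>. (Z t \<omega>)\<^sup>2))" using fin by (simp add: sum.delta')
  finally show "expectation (\<lambda>\<omega>. (\<Sum>t\<in>I. Z t \<omega>)\<^sup>2) = (\<Sum>t\<in>I. expectation (\<lambda>\<omega>. (Z t \<omega>)\<^sup>2))" .
qed

lemma integrable_mult_squares:
  fixes f g :: "'a \<Rightarrow> real"
  assumes "integrable M (\<lambda>x. (f x)\<^sup>2)" "integrable M (\<lambda>x. (g x)\<^sup>2)"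
    and [measurable]: "f \<in> borel_measurable M" "g \<in> borel_measurable M"
  shows "integrable M (\<lambda>x. f x * g x)"
proof (rule Bochner_Integration.integrable_bound)
  show "integrable M (\<lambda>x. (f x)\<^sup>2 + (g x)\<^sup>2)" using assms by simp
  show "AE x in M. norm (f x * g x) \<le> norm ((f x)\<^sup>2 + (g x)\<^sup>2)"
  proof (intro AE_I2)
    fix x
    have "2 * (\<bar>f x\<bar> * \<bar>g x\<bar>) \<le> (f x)\<^sup>2 + (g x)\<^sup>2"
      using zero_le_power2[of "\<bar>f x\<bar> - \<bar>g x\<bar>"] by (simp add: power2_eq_square algebra_simps)
    moreover have "0 \<le> \<bar>f x\<bar> * \<bar>g x\<bar>" by simp
    ultimately have "\<bar>f x\<bar> * \<bar>g x\<bar> \<le> (f x)\<^sup>2 + (g x)\<^sup>2" by linarith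
    then show "norm (f x * g x) \<le> norm ((f x)\<^sup>2 + (g x)\<^sup>2)" by (simp add: abs_mult)
  qed
qed measurable

section \<open>Integrating out one observation\<close>

locale iid_sample = prob_space M for M :: "'a measure" +
  fixes N :: "'b measure" and X :: "nat \<Rightarrow> 'a \<Rightarrow> 'b"
  assumes X_measurable: "\<And>t. t \<ge> 1 \<Longrightarrow> X t \<in> measurable M N"
    and indep: "indep_vars (\<lambda>_. N) X {1..}"
    and ident: "\<And>t. t \<ge> 1 \<Longrightarrow> distr M N (X t) = distr M N (X 1)"
begin

lemma X1_measurable[measurable]: "X (Suc 0) \<in> measurable M N" using X_measurable[of 1] by simp

lemma expectation_X:
  fixes f :: "'b \<Rightarrow> real"
  assumes "t \<ge> 1" "f \<in> borel_measurable N"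
  shows "expectation (\<lambda>\<omega>. f (X t \<omega>)) = expectation (\<lambda>\<omega>. f (X 1 \<omega>))"
    and "integrable M (\<lambda>\<omega>. f (X t \<omega>)) \<longleftrightarrow> integrable M (\<lambda>\<omega>. f (X 1 \<omega>))"
proof -
  have "expectation (\<lambda>\<omega>. f (X t \<omega>)) = integral\<^sup>L (distr M N (X t)) f"
    using assms by (subst integral_distr[OF X_measurable]) auto
  also have "\<dots> = expectation (\<lambda>\<omega>. f (X 1 \<omega>))"
    using assms by (subst ident, simp, subst integral_distr[OF X_measurable]) auto
  finally show "expectation (\<lambda>\<omega>. f (X t \<omega>)) = expectation (\<lambda>\<omega>. f (X 1 \<omega>))" .
  have "integrable M (\<lambda>\<omega>. f (X t \<omega>)) \<longleftrightarrow> integrable (distr M N (X t)) f"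
    using assms by (subst integrable_distr_eq[OF X_measurable]) auto
  also have "\<dots> \<longleftrightarrow> integrable M (\<lambda>\<omega>. f (X 1 \<omega>))"
    using assms by (subst ident, simp, subst integrable_distr_eq[OF X_measurable]) auto
  finally show "integrable M (\<lambda>\<omega>. f (X t \<omega>)) \<longleftrightarrow> integrable M (\<lambda>\<omega>. f (X 1 \<omega>))" .
qed

text \<open>Stands in for conditioning on the observations with index in \<open>J\<close>: by
  independence one further observation can be averaged with these held fixed. The singleton family
  \<open>{s}\<close> in the proof puts that observation into the shape in which independence of
  disjoint blocks is stated.\<close>

lemma expectation_integrate_out:
  fixes h :: "'b \<times> (nat \<Rightarrow> 'b) \<Rightarrow> real"
  assumes s: "s \<ge> 1" "J \<subseteq> {1..}" "s \<notin> J"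
    and h[measurable]: "h \<in> borel_measurable (N \<Otimes>\<^sub>M PiM J (\<lambda>_. N))"
    and int: "integrable M (\<lambda>\<omega>. h (X s \<omega>, \<lambda>t\<in>J. X t \<omega>))"
  shows "expectation (\<lambda>\<omega>. h (X s \<omega>, \<lambda>t\<in>J. X t \<omega>)) =
    (\<integral>y. (\<integral>x. h (x, y) \<partial>distr M N (X 1)) \<partial>distr M (PiM J (\<lambda>_. N)) (\<lambda>\<omega>. \<lambda>t\<in>J. X t \<omega>))"
proof -
  have ind: "indep_var (PiM {s} (\<lambda>_. N)) (\<lambda>\<omega>. \<lambda>t\<in>{s}. X t \<omega>) (PiM J (\<lambda>_. N)) (\<lambda>\<omega>. \<lambda>t\<in>J. X t \<omega>)"
    by (rule indep_var_restrict[OF indep]) (use s in auto)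
  let ?h = "\<lambda>(f, y). h (f s, y)"
  have [measurable]: "X s \<in> measurable M N" by (rule X_measurable[OF s(1)])
  have [measurable]: "(\<lambda>p. fst p s) \<in> measurable (PiM {s} (\<lambda>_. N) \<Otimes>\<^sub>M PiM J (\<lambda>_. N)) N"
    by (rule measurable_compose[OF measurable_fst measurable_component_singleton]) simp
  have "expectation (\<lambda>\<omega>. h (X s \<omega>, \<lambda>t\<in>J. X t \<omega>)) = expectation (\<lambda>\<omega>. ?h (\<lambda>t\<in>{s}. X t \<omega>, \<lambda>t\<in>J. X t \<omega>))"
    by simp
  also have "\<dots> = (\<integral>y. (\<integral>f. ?h (f, y) \<partial>distr M (PiM {s} (\<lambda>_. N)) (\<lambda>\<omega>. \<lambda>t\<in>{s}. X t \<omega>)) \<partial>distr M (PiM J (\<lambda>_. N)) (\<lambda>\<omega>. \<lambda>t\<in>J. X t \<omega>))"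
    by (rule expectation_indep_pair[OF ind]) (simp_all add: case_prod_unfold int)
  also have "\<dots> = (\<integral>y. (\<integral>x. h (x, y) \<partial>distr M N (X 1)) \<partial>distr M (PiM J (\<lambda>_. N)) (\<lambda>\<omega>. \<lambda>t\<in>J. X t \<omega>))"
  proof (rule Bochner_Integration.integral_cong[OF refl])
    fix y assume "y \<in> space (distr M (PiM J (\<lambda>_. N)) (\<lambda>\<omega>. \<lambda>t\<in>J. X t \<omega>))"
    then have [measurable]: "y \<in> space (PiM J (\<lambda>_. N))" by simp
    have "(\<integral>f. ?h (f, y) \<partial>distr M (PiM {s} (\<lambda>_. N)) (\<lambda>\<omega>. \<lambda>t\<in>{s}. X t \<omega>)) = expectation (\<lambda>\<omega>. h (X s \<omega>, y))"
      by (subst integral_distr) (auto intro!: measurable_restrict)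
    also have "\<dots> = (\<integral>x. h (x, y) \<partial>distr M N (X s))" by (subst integral_distr) auto
    finally show "(\<integral>f. ?h (f, y) \<partial>distr M (PiM {s} (\<lambda>_. N)) (\<lambda>\<omega>. \<lambda>t\<in>{s}. X t \<omega>)) = (\<integral>x. h (x, y) \<partial>distr M N (X 1))"
      unfolding ident[OF s(1)] .
  qed
  finally show ?thesis .
qed

lemma expectation_integrate_out_0:
  fixes h :: "'b \<times> (nat \<Rightarrow> 'b) \<Rightarrow> real"
  assumes s: "s \<ge> 1" "J \<subseteq> {1..}" "s \<notin> J"
    and h[measurable]: "h \<in> borel_measurable (N \<Otimes>\<^sub>M PiM J (\<lambda>_. N))"
    and int: "integrable M (\<lambda>\<omega>. h (X s \<omega>, \<lambda>t\<in>J. X t \<omega>))"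
    and 0: "\<And>y. y \<in> space (PiM J (\<lambda>_. N)) \<Longrightarrow> (\<integral>x. h (x, y) \<partial>distr M N (X 1)) = 0"
  shows "expectation (\<lambda>\<omega>. h (X s \<omega>, \<lambda>t\<in>J. X t \<omega>)) = 0"
proof -
  have "(\<integral>y. (\<integral>x. h (x, y) \<partial>distr M N (X 1)) \<partial>distr M (PiM J (\<lambda>_. N)) (\<lambda>\<omega>. \<lambda>t\<in>J. X t \<omega>))
     = (\<integral>y. 0 \<partial>distr M (PiM J (\<lambda>_. N)) (\<lambda>\<omega>. \<lambda>t\<in>J. X t \<omega>))"
    by (intro Bochner_Integration.integral_cong refl 0) simp
  then show ?thesis by (simp add: expectation_integrate_out[OF s h int])
qed

text \<open>The variance is bounded by the raw second moment because this is the quantity that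
  truncation makes small, of the order of the truncation probability.\<close>

lemma expectation_centered_sum:
  fixes \<phi> :: "'b \<Rightarrow> real"
  assumes [measurable]: "\<phi> \<in> borel_measurable N" and int2: "integrable M (\<lambda>\<omega>. (\<phi> (X 1 \<omega>))\<^sup>2)"
  shows "integrable M (\<lambda>\<omega>. ((\<Sum>t=1..n. \<phi> (X t \<omega>)) - real n * expectation (\<lambda>\<omega>. \<phi> (X 1 \<omega>)))\<^sup>2)"
    "expectation (\<lambda>\<omega>. ((\<Sum>t=1..n. \<phi> (X t \<omega>)) - real n * expectation (\<lambda>\<omega>. \<phi> (X 1 \<omega>)))\<^sup>2) \<le> real n * expectation (\<lambda>\<omega>. (\<phi> (X 1 \<omega>))\<^sup>2)"
proof -
  define \<mu> where "\<mu> = expectation (\<lambda>\<omega>. \<phi> (X 1 \<omega>))"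
  let ?Z = "\<lambda>t \<omega>. \<phi> (X t \<omega>) - \<mu>"
  have m1: "(\<lambda>\<omega>. \<phi> (X t \<omega>)) \<in> borel_measurable M" if "t \<ge> 1" for t
    using measurable_compose[OF X_measurable[OF that] assms(1)] .
  have int1: "integrable M (\<lambda>\<omega>. \<phi> (X 1 \<omega>))"
    using square_integrable_imp_integrable[OF _ int2] m1 by simp
  have Z2: "integrable M (\<lambda>\<omega>. (?Z t \<omega>)\<^sup>2)" if "t \<ge> 1" for t
  proof -
    have "integrable M (\<lambda>\<omega>. (?Z 1 \<omega>)\<^sup>2)" using int1 int2 by (simp add: power2_diff)
    then show ?thesis using expectation_X(2)[OF that, of "\<lambda>x. (\<phi> x - \<mu>)\<^sup>2"] by simp
  qed
  have ZZ: "integrable M (\<lambda>\<omega>. ?Z s \<omega> * ?Z t \<omega>)" if "s \<in> {1..n}" "t \<in> {1..n}" for s t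
    using that by (intro integrable_mult_squares Z2 borel_measurable_diff m1) auto
  have orth: "expectation (\<lambda>\<omega>. ?Z s \<omega> * ?Z t \<omega>) = 0" if st: "s \<in> {1..n}" "t \<in> {1..n}" "s \<noteq> t" for s t
  proof -
    let ?h = "\<lambda>(x, y). (\<phi> x - \<mu>) * (\<phi> (y t) - \<mu>)"
    have "expectation (\<lambda>\<omega>. ?h (X s \<omega>, \<lambda>t\<in>{t}. X t \<omega>)) = 0"
    proof (rule expectation_integrate_out_0)
      show "integrable M (\<lambda>\<omega>. ?h (X s \<omega>, \<lambda>t\<in>{t}. X t \<omega>))" using ZZ[OF st(1,2)] by simp
      fix y
      have i: "integrable (distr M N (X 1)) (\<lambda>x. \<phi> x - \<mu>)" using int1 by (simp add: integrable_distr_eq)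
      have "(\<integral>x. \<phi> x - \<mu> \<partial>distr M N (X 1)) = 0"
        using int1 by (simp add: integral_distr \<mu>_def prob_space)
      then show "(\<integral>x. ?h (x, y) \<partial>distr M N (X 1)) = 0" using i by simp
    qed (use st in auto)
    then show ?thesis by simp
  qed
  have eq: "(\<Sum>t=1..n. \<phi> (X t \<omega>)) - real n * \<mu> = (\<Sum>t=1..n. ?Z t \<omega>)" for \<omega>
    by (simp add: sum_subtractf)
  note S = expectation_square_sum_orthogonal[of "{1..n}" ?Z, OF _ ZZ orth]
  show "integrable M (\<lambda>\<omega>. ((\<Sum>t=1..n. \<phi> (X t \<omega>)) - real n * expectation (\<lambda>\<omega>. \<phi> (X 1 \<omega>)))\<^sup>2)"
    unfolding \<mu>_def[symmetric] eq by (rule S) auto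
  have "expectation (\<lambda>\<omega>. (\<Sum>t=1..n. ?Z t \<omega>)\<^sup>2) = (\<Sum>t=1..n. expectation (\<lambda>\<omega>. (?Z t \<omega>)\<^sup>2))" by (rule S) auto
  also have "\<dots> = (\<Sum>t=1..n. expectation (\<lambda>\<omega>. (?Z 1 \<omega>)\<^sup>2))"
    by (intro sum.cong refl expectation_X(1)[of _ "\<lambda>x. (\<phi> x - \<mu>)\<^sup>2"]) auto
  also have "\<dots> = real n * variance (\<lambda>\<omega>. \<phi> (X 1 \<omega>))" by (simp add: \<mu>_def)
  also have "\<dots> \<le> real n * expectation (\<lambda>\<omega>. (\<phi> (X 1 \<omega>))\<^sup>2)"
  proof (rule mult_left_mono)
    show "variance (\<lambda>\<omega>. \<phi> (X 1 \<omega>)) \<le> expectation (\<lambda>\<omega>. (\<phi> (X 1 \<omega>))\<^sup>2)"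
      unfolding variance_eq[OF int1 int2] by simp
  qed simp
  finally show "expectation (\<lambda>\<omega>. ((\<Sum>t=1..n. \<phi> (X t \<omega>)) - real n * expectation (\<lambda>\<omega>. \<phi> (X 1 \<omega>)))\<^sup>2) \<le> real n * expectation (\<lambda>\<omega>. (\<phi> (X 1 \<omega>))\<^sup>2)"
    unfolding \<mu>_def[symmetric] eq .
qed

section \<open>Ranks as empirical survival functions\<close>

definition surv :: "('b \<Rightarrow> real) \<Rightarrow> real \<Rightarrow> real" where
  "surv key c = prob {\<omega> \<in> space M. key (X 1 \<omega>) \<ge> c}"

text \<open>The comparison is \<ge> as in \<open>surv\<close>, so that the rank divided by
  \<open>n\<close> estimates \<open>surv\<close> at the observation. Each observation counts itself,
  which keeps the logarithm of a rank non-negative.\<close>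

definition rank :: "('b \<Rightarrow> real) \<Rightarrow> nat \<Rightarrow> nat \<Rightarrow> 'a \<Rightarrow> nat" where
  "rank key n t \<omega> = card {s \<in> {1..n}. key (X s \<omega>) \<ge> key (X t \<omega>)}"

lemma rank_eq_sum: "real (rank key n t \<omega>) = (\<Sum>s=1..n. if key (X s \<omega>) \<ge> key (X t \<omega>) then 1 else 0)"
proof -
  have "(\<Sum>s=1..n. if key (X s \<omega>) \<ge> key (X t \<omega>) then 1 else 0) = (\<Sum>s\<in>{s \<in> {1..n}. key (X s \<omega>) \<ge> key (X t \<omega>)}. 1::real)"
    by (rule sum.mono_neutral_cong_right) auto
  then show ?thesis by (simp add: rank_def)
qed

lemma surv_antimono: "c \<le> c' \<Longrightarrow> key \<in> borel_measurable N \<Longrightarrow> surv key c' \<le> surv key c"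
proof -
  assume "c \<le> c'" and [measurable]: "key \<in> borel_measurable N"
  then show ?thesis unfolding surv_def One_nat_def by (intro finite_measure_mono) auto
qed

lemma surv_measurable[measurable]: "key \<in> borel_measurable N \<Longrightarrow> surv key \<in> borel_measurable borel"
proof -
  assume k: "key \<in> borel_measurable N"
  have "(\<lambda>x. - surv key x) \<in> borel_measurable borel"
    by (rule borel_measurable_mono) (auto simp: mono_def intro: surv_antimono k)
  from borel_measurable_uminus[OF this] show ?thesis by simp
qed

lemma surv_range: "0 \<le> surv key c" "surv key c \<le> 1" by (auto simp: surv_def)

lemma integral_surv:
  assumes [measurable]: "key \<in> borel_measurable N"
  shows "(\<integral>x. a * (if key x \<ge> c then 1 else 0) + b \<partial>distr M N (X 1)) = a * surv key c + b"
proof -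
  have "(\<integral>x. a * (if key x \<ge> c then 1 else 0) + b \<partial>distr M N (X 1)) = expectation (\<lambda>\<omega>. a * (if key (X 1 \<omega>) \<ge> c then 1 else 0) + b)"
    by (subst integral_distr) auto
  also have "\<dots> = expectation (\<lambda>\<omega>. a * indicator {\<omega> \<in> space M. key (X 1 \<omega>) \<ge> c} \<omega> + b)"
    by (intro Bochner_Integration.integral_cong) auto
  also have "\<dots> = a * surv key c + b"
    by (subst Bochner_Integration.integral_add) (auto simp: surv_def prob_space less_top[symmetric])
  finally show ?thesis .
qed

text \<open>Given \<open>X t\<close>, the rank is 1 plus a binomial count; only its second moment is used, so orthogonality of the
  centred indicators is enough.\<close>
lemma rank_second_moment:
  fixes g :: "'b \<Rightarrow> real"
  assumes key[measurable]: "key \<in> borel_measurable N" and g[measurable]: "g \<in> borel_measurable N"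
    and g0: "\<And>x. 0 \<le> g x" and gB: "\<And>x. g x \<le> Bd" and t: "t \<in> {1..n}"
  defines "u \<equiv> \<lambda>x. surv key (key x)"
  shows "expectation (\<lambda>\<omega>. g (X t \<omega>) * (real (rank key n t \<omega>) - real n * u (X t \<omega>))\<^sup>2)
      \<le> expectation (\<lambda>\<omega>. g (X t \<omega>) * (1 + real n * u (X t \<omega>)))"
    and "integrable M (\<lambda>\<omega>. g (X t \<omega>) * (real (rank key n t \<omega>) - real n * u (X t \<omega>))\<^sup>2)"
proof -
  let ?d = "\<lambda>x y. (if key x \<ge> key y then 1 else 0) - u y"
  \<comment> \<open>The weight enters as a square root so that the squared sum of \<open>?Z\<close>
    is the weighted squared rank error; \<open>?d\<close> has mean zero in its first
    argument.\<close>
  let ?Z = "\<lambda>s \<omega>. sqrt (g (X t \<omega>)) * ?d (X s \<omega>) (X t \<omega>)"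
  have u01: "0 \<le> u x" "u x \<le> 1" for x by (auto simp: u_def surv_range)
  have [measurable]: "u \<in> borel_measurable N" unfolding u_def by measurable
  have d1: "\<bar>?d x y\<bar> \<le> 1" for x y using u01[of y] by auto
  have B0: "0 \<le> Bd" using g0 gB order.trans by blast
  have Xm[measurable]: "X s \<in> measurable M N" if "s \<in> {1..n}" for s using X_measurable that by auto
  have bnd: "integrable M (\<lambda>\<omega>. g (X t \<omega>) * (?d (X s \<omega>) (X t \<omega>) * ?d (X s' \<omega>) (X t \<omega>)))"
    if s: "s \<in> {1..n}" "s' \<in> {1..n}" for s s'
  proof (rule integrable_const_bound[where B=Bd])
    show "AE \<omega> in M. norm (g (X t \<omega>) * (?d (X s \<omega>) (X t \<omega>) * ?d (X s' \<omega>) (X t \<omega>))) \<le> Bd"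
    proof (intro AE_I2)
      fix \<omega>
      have "\<bar>?d (X s \<omega>) (X t \<omega>)\<bar> * \<bar>?d (X s' \<omega>) (X t \<omega>)\<bar> \<le> 1" using d1 by (intro mult_le_one) auto
      then have "\<bar>g (X t \<omega>)\<bar> * (\<bar>?d (X s \<omega>) (X t \<omega>)\<bar> * \<bar>?d (X s' \<omega>) (X t \<omega>)\<bar>) \<le> Bd * 1"
        using g0 gB B0 by (intro mult_mono) auto
      then show "norm (g (X t \<omega>) * (?d (X s \<omega>) (X t \<omega>) * ?d (X s' \<omega>) (X t \<omega>))) \<le> Bd" by (simp only: real_norm_def abs_mult mult_1_right)
    qed
    note [measurable] = Xm[OF t] Xm[OF s(1)] Xm[OF s(2)]
    show "(\<lambda>\<omega>. g (X t \<omega>) * (?d (X s \<omega>) (X t \<omega>) * ?d (X s' \<omega>) (X t \<omega>))) \<in> borel_measurable M" by measurable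
  qed
  have ZZeq: "?Z s \<omega> * ?Z s' \<omega> = g (X t \<omega>) * (?d (X s \<omega>) (X t \<omega>) * ?d (X s' \<omega>) (X t \<omega>))" for s s' \<omega>
  proof -
    have "sqrt (g (X t \<omega>)) * sqrt (g (X t \<omega>)) = g (X t \<omega>)" using g0 by simp
    moreover have "?Z s \<omega> * ?Z s' \<omega> = (sqrt (g (X t \<omega>)) * sqrt (g (X t \<omega>))) * (?d (X s \<omega>) (X t \<omega>) * ?d (X s' \<omega>) (X t \<omega>))"
      by (simp only: mult_ac)
    ultimately show ?thesis by (simp only:)
  qed
  have ZZ: "integrable M (\<lambda>\<omega>. ?Z s \<omega> * ?Z s' \<omega>)" if "s \<in> {1..n}" "s' \<in> {1..n}" for s s'
    unfolding ZZeq by (rule bnd[OF that])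
  have orth0: "expectation (\<lambda>\<omega>. g (X t \<omega>) * (?d (X s \<omega>) (X t \<omega>) * ?d (X s' \<omega>) (X t \<omega>))) = 0"
    if s: "s \<in> {1..n}" "s' \<in> {1..n}" "s \<noteq> s'" "s \<noteq> t" for s s'
  proof -
    let ?J = "{t, s'}"
    let ?h = "\<lambda>(x, y). g (y t) * (?d x (y t) * ?d (y s') (y t))"
    have "expectation (\<lambda>\<omega>. ?h (X s \<omega>, \<lambda>t\<in>?J. X t \<omega>)) = 0"
    proof (rule expectation_integrate_out_0)
      have [measurable]: "(\<lambda>p. snd p t) \<in> measurable (N \<Otimes>\<^sub>M PiM ?J (\<lambda>_. N)) N" "(\<lambda>p. snd p s') \<in> measurable (N \<Otimes>\<^sub>M PiM ?J (\<lambda>_. N)) N"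
        by (rule measurable_compose[OF measurable_snd measurable_component_singleton], simp)+
      show "?h \<in> borel_measurable (N \<Otimes>\<^sub>M PiM ?J (\<lambda>_. N))"
        unfolding case_prod_unfold by measurable
      show "integrable M (\<lambda>\<omega>. ?h (X s \<omega>, \<lambda>t\<in>?J. X t \<omega>))" using bnd[OF s(1,2)] by simp
      fix y
      have z: "(\<integral>x. ?d x (y t) \<partial>distr M N (X 1)) = 0"
        using integral_surv[OF key, of 1 "key (y t)" "- u (y t)"] by (simp add: u_def)
      have "(\<integral>x. ?h (x, y) \<partial>distr M N (X 1)) = (\<integral>x. (g (y t) * ?d (y s') (y t)) * ?d x (y t) \<partial>distr M N (X 1))"
        by (intro Bochner_Integration.integral_cong) (simp_all add: mult_ac)
      also have "\<dots> = (g (y t) * ?d (y s') (y t)) * (\<integral>x. ?d x (y t) \<partial>distr M N (X 1))" by (rule integral_mult_right_zero)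
      also have "\<dots> = 0" unfolding z by simp
      finally show "(\<integral>x. ?h (x, y) \<partial>distr M N (X 1)) = 0" .
    qed (use s t in auto)
    then show ?thesis by simp
  qed
  have orth: "expectation (\<lambda>\<omega>. ?Z s \<omega> * ?Z s' \<omega>) = 0" if s: "s \<in> {1..n}" "s' \<in> {1..n}" "s \<noteq> s'" for s s'
  proof (cases "s = t")
    case False
    then show ?thesis unfolding ZZeq using orth0[OF s] by blast
  next
    \<comment> \<open>Here \<open>X s\<close> is the reference observation and cannot be integrated
      out, but then \<open>s'\<close> differs from \<open>t\<close> and the roles are
      exchanged.\<close>
    case True
    then have "s' \<noteq> t" using s by auto
    have "(\<lambda>\<omega>. ?Z s \<omega> * ?Z s' \<omega>) = (\<lambda>\<omega>. g (X t \<omega>) * (?d (X s' \<omega>) (X t \<omega>) * ?d (X s \<omega>) (X t \<omega>)))"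
      unfolding ZZeq by (intro ext arg_cong2[where f="(*)"] refl mult.commute)
    with orth0[OF s(2,1) s(3)[symmetric] \<open>s' \<noteq> t\<close>] show ?thesis by (simp only:)
  qed
  note S = expectation_square_sum_orthogonal[of "{1..n}" ?Z, OF _ ZZ orth]
  have sumZ: "(\<Sum>s=1..n. ?Z s \<omega>)\<^sup>2 = g (X t \<omega>) * (real (rank key n t \<omega>) - real n * u (X t \<omega>))\<^sup>2" for \<omega>
  proof -
    have "(\<Sum>s=1..n. ?Z s \<omega>) = sqrt (g (X t \<omega>)) * (real (rank key n t \<omega>) - real n * u (X t \<omega>))"
      unfolding rank_eq_sum sum_distrib_left[symmetric] by (simp add: sum_subtractf)
    then show ?thesis using g0 by (simp add: power_mult_distrib)
  qed
  show "integrable M (\<lambda>\<omega>. g (X t \<omega>) * (real (rank key n t \<omega>) - real n * u (X t \<omega>))\<^sup>2)"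
    using S(1) unfolding sumZ by simp
  note [measurable] = Xm[OF t]
  have ig: "integrable M (\<lambda>\<omega>. g (X t \<omega>))"
    by (rule integrable_const_bound[where B=Bd]) (use g0 gB in auto)
  have igu: "integrable M (\<lambda>\<omega>. g (X t \<omega>) * u (X t \<omega>))"
  proof (rule integrable_const_bound[where B=Bd])
    show "AE \<omega> in M. norm (g (X t \<omega>) * u (X t \<omega>)) \<le> Bd"
      using g0 gB u01 B0 mult_mono[of "g x" Bd "u x" 1 for x] by (intro AE_I2) (simp add: abs_mult)
  qed measurable
  have one: "expectation (\<lambda>\<omega>. (?Z s \<omega>)\<^sup>2) \<le> expectation (\<lambda>\<omega>. g (X t \<omega>) * u (X t \<omega>))" if s: "s \<in> {1..n}" "s \<noteq> t" for s
  proof -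
    note [measurable] = Xm[OF s(1)]
    \<comment> \<open>Subtracting the Bernoulli variance \<open>u * (1 - u)\<close> makes the
      integral over the first argument vanish, so \<open>expectation_integrate_out_0\<close> yields
      the second moment too.\<close>
    let ?h = "\<lambda>(x, y). g (y t) * ((?d x (y t))\<^sup>2 - u (y t) * (1 - u (y t)))"
    let ?J = "{t}"
    have Zeq: "(?Z s \<omega>)\<^sup>2 = g (X t \<omega>) * (?d (X s \<omega>) (X t \<omega>))\<^sup>2" for \<omega>
      unfolding power2_eq_square by (rule ZZeq)
    have ib: "integrable M (\<lambda>\<omega>. g (X t \<omega>) * (u (X t \<omega>) * (1 - u (X t \<omega>))))"
    proof (rule integrable_const_bound[where B=Bd])
      show "AE \<omega> in M. norm (g (X t \<omega>) * (u (X t \<omega>) * (1 - u (X t \<omega>)))) \<le> Bd"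
      proof (intro AE_I2)
        fix \<omega>
        have "u (X t \<omega>) * (1 - u (X t \<omega>)) \<le> 1" "0 \<le> u (X t \<omega>) * (1 - u (X t \<omega>))" using u01[of "X t \<omega>"] by (auto intro: mult_le_one)
        then have "g (X t \<omega>) * (u (X t \<omega>) * (1 - u (X t \<omega>))) \<le> Bd * 1" "0 \<le> g (X t \<omega>) * (u (X t \<omega>) * (1 - u (X t \<omega>)))"
          using g0[of "X t \<omega>"] gB[of "X t \<omega>"] B0 by (auto intro!: mult_mono simp del: mult_1_right)
        then show "norm (g (X t \<omega>) * (u (X t \<omega>) * (1 - u (X t \<omega>)))) \<le> Bd" by simp
      qed
    qed measurable
    have ia: "integrable M (\<lambda>\<omega>. g (X t \<omega>) * (?d (X s \<omega>) (X t \<omega>))\<^sup>2)"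
      using bnd[OF s(1) s(1)] by (simp only: power2_eq_square)
    have "expectation (\<lambda>\<omega>. ?h (X s \<omega>, \<lambda>t\<in>?J. X t \<omega>)) = 0"
    proof (rule expectation_integrate_out_0)
      have [measurable]: "(\<lambda>p. snd p t) \<in> measurable (N \<Otimes>\<^sub>M PiM ?J (\<lambda>_. N)) N"
        by (rule measurable_compose[OF measurable_snd measurable_component_singleton], simp)
      show "?h \<in> borel_measurable (N \<Otimes>\<^sub>M PiM ?J (\<lambda>_. N))"
        unfolding case_prod_unfold by measurable
      show "integrable M (\<lambda>\<omega>. ?h (X s \<omega>, \<lambda>t\<in>?J. X t \<omega>))"
        using Bochner_Integration.integrable_diff[OF ia ib] by (simp add: right_diff_distrib)
      fix y
      have "(\<integral>x. (?d x (y t))\<^sup>2 - u (y t) * (1 - u (y t)) \<partial>distr M N (X 1))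
         = (\<integral>x. (1 - 2 * u (y t)) * (if key x \<ge> key (y t) then 1 else 0) + - (u (y t) * (1 - 2 * u (y t))) \<partial>distr M N (X 1))"
        by (intro Bochner_Integration.integral_cong) (auto simp: power2_eq_square algebra_simps)
      also have "\<dots> = 0" unfolding integral_surv[OF key] by (simp add: u_def)
      finally have z: "(\<integral>x. (?d x (y t))\<^sup>2 - u (y t) * (1 - u (y t)) \<partial>distr M N (X 1)) = 0" .
      have "(\<integral>x. ?h (x, y) \<partial>distr M N (X 1)) = g (y t) * (\<integral>x. (?d x (y t))\<^sup>2 - u (y t) * (1 - u (y t)) \<partial>distr M N (X 1))"
        unfolding prod.case by (rule integral_mult_right_zero)
      then show "(\<integral>x. ?h (x, y) \<partial>distr M N (X 1)) = 0" unfolding z by simp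
    qed (use s t in auto)
    also have "(\<lambda>\<omega>. ?h (X s \<omega>, \<lambda>t\<in>?J. X t \<omega>)) = (\<lambda>\<omega>. g (X t \<omega>) * (?d (X s \<omega>) (X t \<omega>))\<^sup>2 - g (X t \<omega>) * (u (X t \<omega>) * (1 - u (X t \<omega>))))"
      by (simp add: right_diff_distrib)
    finally have "expectation (\<lambda>\<omega>. (?Z s \<omega>)\<^sup>2) = expectation (\<lambda>\<omega>. g (X t \<omega>) * (u (X t \<omega>) * (1 - u (X t \<omega>))))"
      unfolding Zeq Bochner_Integration.integral_diff[OF ia ib] by (simp only: right_minus_eq)
    also have "\<dots> \<le> expectation (\<lambda>\<omega>. g (X t \<omega>) * u (X t \<omega>))"
      by (rule integral_mono[OF ib igu]) (use g0 u01 in \<open>auto intro!: mult_left_mono mult_left_le\<close>)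
    finally show ?thesis .
  qed
  \<comment> \<open>Compared with itself the observation always scores 1, so its term is
    \<open>1 - u\<close> and not a centred Bernoulli variable; it accounts for the summand 1 in the
    bound.\<close>
  have self: "expectation (\<lambda>\<omega>. (?Z t \<omega>)\<^sup>2) \<le> expectation (\<lambda>\<omega>. g (X t \<omega>))"
  proof (rule integral_mono)
    show "integrable M (\<lambda>\<omega>. (?Z t \<omega>)\<^sup>2)" using ZZ[OF t t] by (simp only: power2_eq_square)
    fix \<omega>
    have "(?d (X t \<omega>) (X t \<omega>))\<^sup>2 \<le> 1" using u01[of "X t \<omega>"] by (simp add: power_le_one)
    then show "(?Z t \<omega>)\<^sup>2 \<le> g (X t \<omega>)" using g0[of "X t \<omega>"] by (simp add: power_mult_distrib mult_left_le)
  qed (rule ig)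
  have "expectation (\<lambda>\<omega>. g (X t \<omega>) * (real (rank key n t \<omega>) - real n * u (X t \<omega>))\<^sup>2) = (\<Sum>s=1..n. expectation (\<lambda>\<omega>. (?Z s \<omega>)\<^sup>2))"
    using S(2) unfolding sumZ by simp
  also have "\<dots> = expectation (\<lambda>\<omega>. (?Z t \<omega>)\<^sup>2) + (\<Sum>s\<in>{1..n}-{t}. expectation (\<lambda>\<omega>. (?Z s \<omega>)\<^sup>2))"
    using t by (subst sum.remove[of _ t]) auto
  also have "\<dots> \<le> expectation (\<lambda>\<omega>. g (X t \<omega>)) + (\<Sum>s\<in>{1..n}-{t}. expectation (\<lambda>\<omega>. g (X t \<omega>) * u (X t \<omega>)))"
    by (intro add_mono self sum_mono one) auto
  also have "\<dots> \<le> expectation (\<lambda>\<omega>. g (X t \<omega>)) + real n * expectation (\<lambda>\<omega>. g (X t \<omega>) * u (X t \<omega>))"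
  proof -
    have "0 \<le> expectation (\<lambda>\<omega>. g (X t \<omega>) * u (X t \<omega>))" by (intro Bochner_Integration.integral_nonneg) (use g0 u01 in auto)
    then show ?thesis using t by (simp add: mult_right_mono)
  qed
  also have "\<dots> = expectation (\<lambda>\<omega>. g (X t \<omega>) * (1 + real n * u (X t \<omega>)))"
    using ig igu by (simp add: distrib_left mult.left_commute[of _ "real n"])
  finally show "expectation (\<lambda>\<omega>. g (X t \<omega>) * (real (rank key n t \<omega>) - real n * u (X t \<omega>))\<^sup>2)
      \<le> expectation (\<lambda>\<omega>. g (X t \<omega>) * (1 + real n * u (X t \<omega>)))" .
qed

text \<open>With \<open>X t\<close> held fixed, the key of \<open>X s\<close> would have to hit a
  single point, which has probability zero; integrating over \<open>X t\<close> preserves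
  this.\<close>

lemma AE_no_ties:
  fixes key :: "'b \<Rightarrow> real"
  assumes key[measurable]: "key \<in> borel_measurable N" and st: "s \<ge> 1" "t \<ge> 1" "s \<noteq> t"
    and atomless: "\<And>c. prob {\<omega> \<in> space M. key (X 1 \<omega>) = c} = 0"
  shows "AE \<omega> in M. key (X s \<omega>) \<noteq> key (X t \<omega>)"
proof -
  have [measurable]: "X s \<in> measurable M N" "X t \<in> measurable M N" using X_measurable st by auto
  let ?h = "\<lambda>(x, y). if key x = key (y t) then 1 else 0 :: real"
  have "expectation (\<lambda>\<omega>. ?h (X s \<omega>, \<lambda>t\<in>{t}. X t \<omega>)) = 0"
  proof (rule expectation_integrate_out_0)
    have [measurable]: "(\<lambda>p. snd p t) \<in> measurable (N \<Otimes>\<^sub>M PiM {t} (\<lambda>_. N)) N"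
      by (rule measurable_compose[OF measurable_snd measurable_component_singleton], simp)
    have "(\<lambda>p. key (fst p)) \<in> borel_measurable (N \<Otimes>\<^sub>M PiM {t} (\<lambda>_. N))"
      "(\<lambda>p. key (snd p t)) \<in> borel_measurable (N \<Otimes>\<^sub>M PiM {t} (\<lambda>_. N))" by measurable
    from borel_measurable_eq[OF this] show "?h \<in> borel_measurable (N \<Otimes>\<^sub>M PiM {t} (\<lambda>_. N))"
      unfolding case_prod_unfold by (intro measurable_If) auto
    show "integrable M (\<lambda>\<omega>. ?h (X s \<omega>, \<lambda>t\<in>{t}. X t \<omega>))"
      by (rule integrable_const_bound[where B=1]) auto
    fix y
    have "(\<integral>x. ?h (x, y) \<partial>distr M N (X 1)) = expectation (\<lambda>\<omega>. if key (X 1 \<omega>) = key (y t) then 1 else 0)"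
      by (subst integral_distr) auto
    also have "\<dots> = expectation (indicator {\<omega> \<in> space M. key (X 1 \<omega>) = key (y t)})"
      by (intro Bochner_Integration.integral_cong) auto
    also have "\<dots> = 0" using atomless by simp
    finally show "(\<integral>x. ?h (x, y) \<partial>distr M N (X 1)) = 0" .
  qed (use st in auto)
  also have "expectation (\<lambda>\<omega>. ?h (X s \<omega>, \<lambda>t\<in>{t}. X t \<omega>)) = expectation (indicator {\<omega> \<in> space M. key (X s \<omega>) = key (X t \<omega>)})"
    by (intro Bochner_Integration.integral_cong) auto
  finally have "prob {\<omega> \<in> space M. key (X s \<omega>) = key (X t \<omega>)} = 0" by simp
  then show ?thesis by (subst (asm) prob_eq_0) auto
qed

end

text \<open>Without ties the rank is an injective self-map of \<open>{1..n}\<close>, hence a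
  permutation, and \<open>min k n\<close> of its values are at most \<open>k\<close>.\<close>

lemma card_rank_le:
  fixes key :: "nat \<Rightarrow> real"
  assumes inj: "inj_on key {1..n}"
  shows "card {t \<in> {1..n}. card {s \<in> {1..n}. key s \<ge> key t} \<le> k} = min k n"
proof -
  define r where "r t = card {s \<in> {1..n}. key s \<ge> key t}" for t
  have mono: "r t < r t'" if "t \<in> {1..n}" "t' \<in> {1..n}" "key t > key t'" for t t'
  proof -
    have "t' \<in> {s \<in> {1..n}. key s \<ge> key t'} - {s \<in> {1..n}. key s \<ge> key t}" using that by auto
    moreover have "{s \<in> {1..n}. key s \<ge> key t} \<subseteq> {s \<in> {1..n}. key s \<ge> key t'}" using that by auto
    ultimately have "{s \<in> {1..n}. key s \<ge> key t} \<subset> {s \<in> {1..n}. key s \<ge> key t'}" by blast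
    then show ?thesis unfolding r_def by (intro psubset_card_mono) auto
  qed
  have rinj: "inj_on r {1..n}"
  proof (rule inj_onI)
    fix s t assume st: "s \<in> {1..n}" "t \<in> {1..n}" "r s = r t"
    then have "\<not> key s > key t" "\<not> key t > key s" using mono[of s t] mono[of t s] by auto
    then show "s = t" using inj st by (auto dest: inj_onD)
  qed
  have sub: "r ` {1..n} \<subseteq> {1..n}"
  proof safe
    fix t assume t: "t \<in> {1..n}"
    have "r t \<le> card {1..n}" unfolding r_def by (rule card_mono) auto
    moreover have "r t > 0" unfolding r_def using t by (subst card_gt_0_iff) auto
    ultimately show "r t \<in> {1..n}" by simp
  qed
  have img: "r ` {1..n} = {1..n}"
    by (rule card_subset_eq[OF _ sub]) (use card_image[OF rinj] in auto)
  have "r ` {t \<in> {1..n}. r t \<le> k} = r ` {1..n} \<inter> {..k}" by auto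
  then have "r ` {t \<in> {1..n}. r t \<le> k} = {1..n} \<inter> {..k}" unfolding img .
  moreover have "card (r ` {t \<in> {1..n}. r t \<le> k}) = card {t \<in> {1..n}. r t \<le> k}"
    by (rule card_image) (rule inj_on_subset[OF rinj], auto)
  moreover have "{1..n} \<inter> {..k} = {1..min k n}" by auto
  ultimately show ?thesis by (simp add: r_def)
qed

section \<open>Replacing ranks by uniform margins\<close>

text \<open>A deterministic bound with three regimes. For \<open>u < 1 / n\<close> no rank can match
  \<open>u\<close>, and the two logarithms are bounded separately. For
  \<open>R \<ge> n * u / 2\<close> the logarithm is Lipschitz with constant
  \<open>2 / (n * u)\<close>. For smaller \<open>R\<close> the difference of logarithms is at most
  \<open>ln n\<close>, while \<open>(R - n * u)\<^sup>2\<close> is at least a quarter of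
  \<open>(n * u)\<^sup>2\<close>; both of the last regimes thus produce the factor 4.\<close>

lemma ln_rank_diff_le:
  fixes R u :: real and n :: nat
  assumes n: "n \<ge> 1" and R: "1 \<le> R" "R \<le> real n" and u: "0 < u" "u \<le> 1"
  shows "(ln (R / real n) - ln u)\<^sup>2 \<le>
     (if u < 1 / real n then 2 * (ln (real n))\<^sup>2 + 2 + 2 * (ln (1 / real n) - ln u) ^ 4 else 0)
      + 4 * (1 + (ln (real n))\<^sup>2) * ((if u \<ge> 1 / real n then 1 / (real n * u)\<^sup>2 else 0) * (R - real n * u)\<^sup>2)"
proof -
  have n0: "real n > 0" using n by simp
  define a where "a = real n * u"
  have a: "0 < a" "a \<le> real n" using n0 u by (auto simp: a_def mult_left_le)
  have eq: "ln (R / real n) - ln u = ln R - ln a" using n0 u R by (simp add: a_def ln_div ln_mult)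
  have lnR: "0 \<le> ln R" "ln R \<le> ln (real n)" using R by auto
  show ?thesis
  proof (cases "u < 1 / real n")
    case True
    have "(ln R - ln a)\<^sup>2 \<le> 2 * (ln R)\<^sup>2 + 2 * (ln a)\<^sup>2" by (rule power2_diff_le)
    also have "(ln R)\<^sup>2 \<le> (ln (real n))\<^sup>2" using lnR by (intro power_mono) auto
    also have "(ln a)\<^sup>2 \<le> 1 + (ln a) ^ 4"
    proof -
      have "x \<le> 1 + x\<^sup>2" for x :: real using zero_le_power2[of "x - 1/2"] by (simp add: power2_eq_square algebra_simps)
      from this[of "(ln a)\<^sup>2"] show ?thesis by (simp flip: power_mult)
    qed
    also have "(ln a) ^ 4 = (ln (1 / real n) - ln u) ^ 4"
    proof -
      have "ln (1 / real n) - ln u = - ln a" using n0 u by (simp add: a_def ln_div ln_mult)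
      then show ?thesis by simp
    qed
    finally show ?thesis unfolding eq using True by simp
  next
    case False
    then have a1: "a \<ge> 1" using n0 by (simp add: a_def field_simps)
    have lna: "0 \<le> ln a" "ln a \<le> ln (real n)" using a1 a by auto
    have "(ln R - ln a)\<^sup>2 \<le> 4 * (1 + (ln (real n))\<^sup>2) * ((R - a)\<^sup>2 / a\<^sup>2)"
    proof (cases "R \<ge> a / 2")
      case True
      have le: "\<bar>ln R - ln a\<bar> \<le> 2 * \<bar>R - a\<bar> / a"
      proof (cases "R \<ge> a")
        case True
        have "ln R - ln a = ln (R / a)" using a R by (simp add: ln_div)
        also have "\<dots> \<le> R / a - 1" using a R by (intro ln_le_minus_one) auto
        also have "\<dots> = (R - a) / a" using a by (simp add: field_simps)
        also have "\<dots> \<le> 2 * (R - a) / a" using True a by (intro divide_right_mono) auto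
        finally show ?thesis using True a R by simp
      next
        case False
        have "ln a - ln R = ln (a / R)" using a R by (simp add: ln_div)
        also have "\<dots> \<le> a / R - 1" using a R by (intro ln_le_minus_one) auto
        also have "\<dots> = (a - R) / R" using R by (simp add: field_simps)
        also have "\<dots> \<le> (a - R) / (a / 2)" using False True a by (intro divide_left_mono) auto
        also have "\<dots> = 2 * \<bar>R - a\<bar> / a" using False by simp
        finally have "ln a - ln R \<le> 2 * \<bar>R - a\<bar> / a" .
        moreover have "\<bar>ln R - ln a\<bar> = ln a - ln R" using False a R by simp
        ultimately show ?thesis by simp
      qed
      have "(ln R - ln a)\<^sup>2 = \<bar>ln R - ln a\<bar>\<^sup>2" by simp
      also have "\<dots> \<le> (2 * \<bar>R - a\<bar> / a)\<^sup>2" by (intro power_mono le) auto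
      also have "\<dots> = 4 * 1 * ((R - a)\<^sup>2 / a\<^sup>2)" by (simp add: power_mult_distrib power_divide)
      also have "\<dots> \<le> 4 * (1 + (ln (real n))\<^sup>2) * ((R - a)\<^sup>2 / a\<^sup>2)" by (intro mult_right_mono mult_left_mono) auto
      finally show ?thesis .
    next
      case False
      have "\<bar>ln R - ln a\<bar> \<le> ln (real n)" using lnR lna by linarith
      then have "\<bar>ln R - ln a\<bar>\<^sup>2 \<le> (ln (real n))\<^sup>2" by (intro power_mono) auto
      then have 1: "(ln R - ln a)\<^sup>2 \<le> 1 + (ln (real n))\<^sup>2" by simp
      have "a / 2 \<le> a - R" using False by simp
      then have "(a / 2)\<^sup>2 \<le> (a - R)\<^sup>2" using a by (intro power_mono) auto
      then have "1 \<le> 4 * ((R - a)\<^sup>2 / a\<^sup>2)" using a by (simp add: power_divide field_simps power2_commute)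
      then have "(1 + (ln (real n))\<^sup>2) * 1 \<le> (1 + (ln (real n))\<^sup>2) * (4 * ((R - a)\<^sup>2 / a\<^sup>2))" by (intro mult_left_mono) auto
      also have "\<dots> = 4 * (1 + (ln (real n))\<^sup>2) * ((R - a)\<^sup>2 / a\<^sup>2)" by (simp only: mult_ac)
      finally show ?thesis using 1 unfolding mult_1_right by (rule order.trans[rotated])
    qed
    then show ?thesis unfolding eq using False by (simp add: a_def)
  qed
qed

lemma harm_le_1_plus_ln:
  assumes "n \<ge> 1"
  shows "(harm n :: real) \<le> 1 + ln (real n)"
proof -
  obtain k where k: "n = Suc k" using assms by (cases n) auto
  have "(harm (Suc k) - ln (real (Suc k)) :: real) \<le> harm (Suc 0) - ln (real (Suc 0))"
    using decseqD[OF decseq_harm_diff_ln, of 0 k] by simp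
  then show ?thesis by (simp add: k harm_expand)
qed

text \<open>A discretised integral of \<open>1 / (n * u)\<close> from \<open>1 / n\<close> to 1: on
  the slice between \<open>j / n\<close> and \<open>(j + 1) / n\<close> the integrand is at most
  \<open>1 / j\<close>, each slice has mass at most \<open>1 / n\<close>, and the harmonic sum
  yields the logarithm.\<close>

lemma (in unif_margins) expectation_inverse_trunc:
  assumes n: "n \<ge> 1"
  shows "integrable M (\<lambda>\<omega>. if U l \<omega> \<ge> 1 / real n then 1 / (real n * U l \<omega>) else 0)"
    and "expectation (\<lambda>\<omega>. if U l \<omega> \<ge> 1 / real n then 1 / (real n * U l \<omega>) else 0) \<le> (1 + ln (real n)) / real n"
proof -
  let ?f = "\<lambda>\<omega>. if U l \<omega> \<ge> 1 / real n then 1 / (real n * U l \<omega>) else 0"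
  let ?A = "\<lambda>j. {\<omega> \<in> space M. U l \<omega> < (real j + 1) / real n} - {\<omega> \<in> space M. U l \<omega> < real j / real n}"
  have n0: "real n > 0" using n by simp
  have f1: "\<bar>?f \<omega>\<bar> \<le> 1" for \<omega>
    using n0 by (auto simp: field_simps abs_if)
  show int: "integrable M ?f"
    by (rule integrable_const_bound[where B=1]) (use f1 in auto)
  have le: "?f \<omega> \<le> (\<Sum>j=1..n. 1 / real j * indicator (?A j) \<omega>)" if \<omega>: "\<omega> \<in> space M" for \<omega>
  proof (cases "U l \<omega> \<ge> 1 / real n")
    case False
    then show ?thesis by (auto intro!: sum_nonneg)
  next
    case True
    define j where "j = nat \<lfloor>real n * U l \<omega>\<rfloor>"
    have a: "1 \<le> real n * U l \<omega>" "real n * U l \<omega> \<le> real n" using True n0 U_le_1[of l \<omega>] by (auto simp: field_simps)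
    have j: "1 \<le> j" "j \<le> n" "real j \<le> real n * U l \<omega>" "real n * U l \<omega> < real j + 1"
    proof -
      have fl: "1 \<le> \<lfloor>real n * U l \<omega>\<rfloor>" using a by linarith
      then show "real j \<le> real n * U l \<omega>" "real n * U l \<omega> < real j + 1" by (simp_all add: j_def)
      show "1 \<le> j" using nat_mono[OF fl] by (simp add: j_def)
      have "real j \<le> real n" using \<open>real j \<le> real n * U l \<omega>\<close> a by linarith
      then show "j \<le> n" by simp
    qed
    have "?f \<omega> \<le> 1 / real j * indicator (?A j) \<omega>"
      using True j \<omega> n0 by (auto simp: field_simps indicator_def)
    also have "\<dots> \<le> (\<Sum>j=1..n. 1 / real j * indicator (?A j) \<omega>)"
      by (rule member_le_sum) (use j in auto)
    finally show ?thesis .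
  qed
  have pA: "prob (?A j) \<le> 1 / real n" if "j \<in> {1..n}" for j
  proof -
    have "prob (?A j) = prob {\<omega> \<in> space M. U l \<omega> < (real j + 1) / real n} - prob {\<omega> \<in> space M. U l \<omega> < real j / real n}"
      using n0 by (intro finite_measure_Diff) (auto elim!: less_le_trans simp: divide_right_mono)
    \<comment> \<open>For \<open>j = n\<close> the upper end exceeds 1, hence the inequality
      \<open>prob_U_less_le\<close> in place of the exact uniform probability.\<close>
    also have "\<dots> \<le> (real j + 1) / real n - real j / real n"
      using that n0 by (intro diff_mono prob_U_less_le) (auto simp: prob_U_less)
    also have "\<dots> = 1 / real n" by (simp add: diff_divide_distrib[symmetric])
    finally show ?thesis .
  qed
  have "expectation ?f \<le> expectation (\<lambda>\<omega>. \<Sum>j=1..n. 1 / real j * indicator (?A j) \<omega>)"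
    by (intro integral_mono int le Bochner_Integration.integrable_sum) (auto simp: less_top[symmetric])
  also have "\<dots> = (\<Sum>j=1..n. 1 / real j * prob (?A j))"
    by (subst Bochner_Integration.integral_sum) (auto simp: less_top[symmetric] intro!: sum.cong)
  also have "\<dots> \<le> (\<Sum>j=1..n. 1 / real j * (1 / real n))"
    by (intro sum_mono mult_left_mono pA) auto
  also have "\<dots> = harm n / real n" by (simp add: harm_def sum_divide_distrib inverse_eq_divide divide_divide_eq_left mult.commute)
  also have "\<dots> \<le> (1 + ln (real n)) / real n" using n by (intro divide_right_mono harm_le_1_plus_ln) auto
  finally show "expectation ?f \<le> (1 + ln (real n)) / real n" .
qed

text \<open>Ranks are formed from \<open>key\<close>, margins from \<open>u\<close>. The two are
  kept apart because \<open>u\<close> is only weakly decreasing in \<open>key\<close>: flat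
  stretches of a distribution function may identify observations that \<open>key\<close>
  separates.\<close>

locale extremal_sample = iid_sample M N X + mda_unif_rate M "\<lambda>l \<omega>. u l (X 1 \<omega>)" ell \<mu>Y
  for M :: "'a measure" and N :: "'b measure" and X :: "nat \<Rightarrow> 'a \<Rightarrow> 'b" and u :: "'d::finite \<Rightarrow> 'b \<Rightarrow> real"
    and ell :: "real^'d \<Rightarrow> real" and \<mu>Y :: "(real^'d) measure" +
  fixes key :: "'d \<Rightarrow> 'b \<Rightarrow> real"
  assumes key_measurable[measurable]: "\<And>l. key l \<in> borel_measurable N"
    and u_eq_surv: "\<And>l x. u l x = surv (key l) (key l x)"
    and atomless: "\<And>l c. prob {\<omega> \<in> space M. key l (X 1 \<omega>) = c} = 0"
begin

text \<open>The locale parameter mentions \<open>X 1\<close>, which must not be rewritten to \<open>X (Suc 0)\<close>.\<close>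
declare One_nat_def[simp del]

lemma u_measurable[measurable]: "u l \<in> borel_measurable N"
  unfolding u_eq_surv[abs_def] by measurable

lemma u_range: "0 \<le> u l x" "u l x \<le> 1" by (simp_all add: u_eq_surv surv_range)

lemma X_1_measurable[measurable]: "X 1 \<in> measurable M N" by (rule X_measurable) simp

lemma AE_u_pos: "t \<ge> 1 \<Longrightarrow> AE \<omega> in M. u l (X t \<omega>) > 0"
proof -
  assume t: "t \<ge> 1"
  have m: "{x \<in> space N. u l x > 0} \<in> sets N" by measurable
  show "AE \<omega> in M. u l (X t \<omega>) > 0"
    using AE_distr_iff[OF X_measurable[OF t] m] AE_distr_iff[OF X_1_measurable m] AE_U_pos[of l]
    unfolding ident[OF t] by simp
qed

definition emp :: "'d \<Rightarrow> nat \<Rightarrow> nat \<Rightarrow> 'a \<Rightarrow> real" where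
  "emp l n t \<omega> = real (rank (key l) n t \<omega>) / real n"

lemma rank_measurable[measurable]:
  assumes "t \<in> {1..n}"
  shows "(\<lambda>\<omega>. real (rank (key l) n t \<omega>)) \<in> borel_measurable M"
proof -
  have [measurable]: "X s \<in> measurable M N" if "s \<in> {1..n}" for s using that by (intro X_measurable) auto
  note [measurable] = this[OF assms]
  show ?thesis unfolding rank_eq_sum by measurable
qed

lemma rank_range: "t \<in> {1..n} \<Longrightarrow> 1 \<le> rank (key l) n t \<omega>" "rank (key l) n t \<omega> \<le> n"
proof -
  have "rank (key l) n t \<omega> \<le> card {1..n}" unfolding rank_def by (rule card_mono) auto
  then show "rank (key l) n t \<omega> \<le> n" by simp
  assume "t \<in> {1..n}"
  then have "0 < rank (key l) n t \<omega>" unfolding rank_def by (subst card_gt_0_iff) auto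
  then show "1 \<le> rank (key l) n t \<omega>" by simp
qed

text \<open>The rank error has second moment of order \<open>1 + n * u\<close>; weighted by
  \<open>1 / (n * u)\<^sup>2\<close> this is at most \<open>2 / (n * u)\<close> on
  \<open>u \<ge> 1 / n\<close>, with mean of order \<open>(1 + ln n) / n\<close>. The factor
  \<open>1 + (ln n)\<^sup>2\<close> of the deterministic bound raises the logarithm to a cube.
  Margins below \<open>1 / n\<close> have probability \<open>1 / n\<close> and are covered by the
  fourth moment.\<close>

lemma emp_log_error:
  obtains C where "C \<ge> 0"
    "\<And>l n t. t \<in> {1..n} \<Longrightarrow> integrable M (\<lambda>\<omega>. (ln (emp l n t \<omega>) - ln (u l (X t \<omega>)))\<^sup>2)"
    "\<And>l n t. t \<in> {1..n} \<Longrightarrow> expectation (\<lambda>\<omega>. (ln (emp l n t \<omega>) - ln (u l (X t \<omega>)))\<^sup>2) \<le> C * (1 + ln (real n)) ^ 3 / real n"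
proof -
  obtain K where K: "K \<ge> 0"
    "\<And>l m q. 0 < q \<Longrightarrow> q \<le> 1 \<Longrightarrow> integrable M (\<lambda>\<omega>. indicator (exc m q) \<omega> * (ln q - ln (u l (X 1 \<omega>))) ^ 4)"
    "\<And>l m q. 0 < q \<Longrightarrow> q \<le> 1 \<Longrightarrow> expectation (\<lambda>\<omega>. indicator (exc m q) \<omega> * (ln q - ln (u l (X 1 \<omega>))) ^ 4) \<le> K * q"
    using fourth_moment_lv by blast
  \<comment> \<open>The part \<open>4 + 2 * K\<close> comes from margins below \<open>1 / n\<close>,
    the remaining 8 from the rank error.\<close>
  define C where "C = 12 + 2 * K"
  have "integrable M (\<lambda>\<omega>. (ln (emp l n t \<omega>) - ln (u l (X t \<omega>)))\<^sup>2) \<and>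
     expectation (\<lambda>\<omega>. (ln (emp l n t \<omega>) - ln (u l (X t \<omega>)))\<^sup>2) \<le> C * (1 + ln (real n)) ^ 3 / real n"
    if t: "t \<in> {1..n}" for l n t
  proof -
    have n: "n \<ge> 1" and t1: "t \<ge> 1" using t by auto
    have n0: "real n > 0" using n by simp
    have [measurable]: "X t \<in> measurable M N" by (rule X_measurable[OF t1])
    define L where "L = 1 + ln (real n)"
    have L: "1 \<le> L" using n by (simp add: L_def)
    let ?p = "1 / real n"
    have p: "0 < ?p" "?p \<le> 1" using n by auto
    define h where "h x = (if u l x < ?p then 2 * (ln (real n))\<^sup>2 + 2 + 2 * (ln ?p - ln (u l x)) ^ 4 else 0)" for x
    define g where "g x = (if u l x \<ge> ?p then 1 / (real n * u l x)\<^sup>2 else 0)" for x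
    have [measurable]: "h \<in> borel_measurable N" "g \<in> borel_measurable N" unfolding h_def g_def by measurable
    have h_eq: "h (X 1 \<omega>) = (2 * (ln (real n))\<^sup>2 + 2) * indicator (exc l ?p) \<omega> + 2 * (indicator (exc l ?p) \<omega> * (ln ?p - ln (u l (X 1 \<omega>))) ^ 4)"
      if "\<omega> \<in> space M" for \<omega>
      using that by (auto simp: h_def exc_def)
    have ih: "integrable M (\<lambda>\<omega>. h (X 1 \<omega>))"
      by (subst Bochner_Integration.integrable_cong[OF refl h_eq]) (use K(2)[OF p] in \<open>auto simp: less_top[symmetric]\<close>)
    have ih': "integrable M (\<lambda>\<omega>. h (X t \<omega>))" using ih expectation_X(2)[OF t1, of h] by simp
    have Eh: "expectation (\<lambda>\<omega>. h (X t \<omega>)) \<le> (4 + 2 * K) * L\<^sup>2 / real n"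
    proof -
      have "expectation (\<lambda>\<omega>. h (X t \<omega>)) = expectation (\<lambda>\<omega>. h (X 1 \<omega>))" by (rule expectation_X(1)[OF t1]) simp
      also have "\<dots> = expectation (\<lambda>\<omega>. (2 * (ln (real n))\<^sup>2 + 2) * indicator (exc l ?p) \<omega> + 2 * (indicator (exc l ?p) \<omega> * (ln ?p - ln (u l (X 1 \<omega>))) ^ 4))"
        by (rule Bochner_Integration.integral_cong[OF refl h_eq])
      also have "\<dots> = (2 * (ln (real n))\<^sup>2 + 2) * prob (exc l ?p) + 2 * expectation (\<lambda>\<omega>. indicator (exc l ?p) \<omega> * (ln ?p - ln (u l (X 1 \<omega>))) ^ 4)"
        using K(2)[OF p] by (subst Bochner_Integration.integral_add) (auto simp: less_top[symmetric])
      also have "\<dots> \<le> (2 * (ln (real n))\<^sup>2 + 2) * ?p + 2 * (K * ?p)"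
        using p K(3)[OF p] by (intro add_mono mult_left_mono) (auto simp: prob_exc)
      also have "\<dots> = (2 * (ln (real n))\<^sup>2 + 2 + 2 * K) / real n" by (simp add: add_divide_distrib)
      also have "\<dots> \<le> (2 * L\<^sup>2 + 2 * L\<^sup>2 + 2 * K * L\<^sup>2) / real n"
      proof (intro divide_right_mono add_mono)
        have "(ln (real n))\<^sup>2 \<le> L\<^sup>2" using n by (intro power_mono) (auto simp: L_def)
        then show "2 * (ln (real n))\<^sup>2 \<le> 2 * L\<^sup>2" by simp
        have L2: "1 \<le> L\<^sup>2" using L by (simp add: one_le_power)
        then show "2 \<le> 2 * L\<^sup>2" by simp
        show "2 * K \<le> 2 * K * L\<^sup>2" using K(1) L2 by (simp add: mult_left_le_one_le mult_le_cancel_left1)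
      qed simp
      finally show ?thesis by (simp add: algebra_simps)
    qed
    have g0: "0 \<le> g x" for x by (simp add: g_def)
    have g1: "g x \<le> 1" for x
    proof (cases "u l x \<ge> ?p")
      case True
      then have "1 \<le> real n * u l x" using n0 by (simp add: field_simps)
      then have "1 \<le> (real n * u l x)\<^sup>2" by (simp add: one_le_power)
      then have "1 / (real n * u l x)\<^sup>2 \<le> 1" by (subst divide_le_eq_1) linarith
      then show ?thesis by (simp only: g_def if_True True)
    qed (simp add: g_def)
    let ?r = "\<lambda>\<omega>. g (X t \<omega>) * (real (rank (key l) n t \<omega>) - real n * u l (X t \<omega>))\<^sup>2"
    note rsm = rank_second_moment[OF key_measurable, of g 1 t n l, folded u_eq_surv, OF _ g0 g1 t]
    have ir: "integrable M ?r" using rsm(2) by simp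
    have Er: "expectation ?r \<le> 2 * L / real n"
    proof -
      have "expectation ?r \<le> expectation (\<lambda>\<omega>. g (X t \<omega>) * (1 + real n * u l (X t \<omega>)))" using rsm(1) by simp
      also have "\<dots> = expectation (\<lambda>\<omega>. g (X 1 \<omega>) * (1 + real n * u l (X 1 \<omega>)))"
        by (rule expectation_X(1)[OF t1]) simp
      also have "\<dots> \<le> expectation (\<lambda>\<omega>. 2 * (if u l (X 1 \<omega>) \<ge> ?p then 1 / (real n * u l (X 1 \<omega>)) else 0))"
      proof (rule integral_mono)
        have pt: "g x * (1 + real n * u l x) \<le> 2 * (if u l x \<ge> ?p then 1 / (real n * u l x) else 0)" for x
        proof (cases "u l x \<ge> ?p")
          case True
          define a where "a = real n * u l x"
          have a: "1 \<le> a" using True n0 by (simp add: a_def field_simps)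
          have "(1 + a) / a\<^sup>2 \<le> (2 * a) / a\<^sup>2" using a by (intro divide_right_mono) auto
          also have "\<dots> = 2 * (1 / a)" using a by (simp add: power2_eq_square)
          finally show ?thesis using True by (simp add: g_def a_def)
        qed (simp add: g_def)
        have pt0: "0 \<le> g x * (1 + real n * u l x)" for x using g0 u_range[of l x] by (intro mult_nonneg_nonneg) auto
        show i2: "integrable M (\<lambda>\<omega>. 2 * (if u l (X 1 \<omega>) \<ge> ?p then 1 / (real n * u l (X 1 \<omega>)) else 0))"
          by (intro integrable_mult_right expectation_inverse_trunc(1) n)
        show "integrable M (\<lambda>\<omega>. g (X 1 \<omega>) * (1 + real n * u l (X 1 \<omega>)))"
        proof (rule Bochner_Integration.integrable_bound[OF i2])
          show "AE \<omega> in M. norm (g (X 1 \<omega>) * (1 + real n * u l (X 1 \<omega>))) \<le> norm (2 * (if u l (X 1 \<omega>) \<ge> ?p then 1 / (real n * u l (X 1 \<omega>)) else 0))"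
          proof (intro AE_I2)
            fix \<omega> show "norm (g (X 1 \<omega>) * (1 + real n * u l (X 1 \<omega>))) \<le> norm (2 * (if u l (X 1 \<omega>) \<ge> ?p then 1 / (real n * u l (X 1 \<omega>)) else 0))"
              unfolding real_norm_def abs_of_nonneg[OF pt0] by (rule order.trans[OF pt abs_ge_self])
          qed
        qed measurable
        show "g (X 1 \<omega>) * (1 + real n * u l (X 1 \<omega>)) \<le> 2 * (if u l (X 1 \<omega>) \<ge> ?p then 1 / (real n * u l (X 1 \<omega>)) else 0)" for \<omega>
          by (rule pt)
      qed
      also have "\<dots> = 2 * expectation (\<lambda>\<omega>. (if u l (X 1 \<omega>) \<ge> ?p then 1 / (real n * u l (X 1 \<omega>)) else 0))" by (rule integral_mult_right_zero)
      also have "\<dots> \<le> 2 * (L / real n)" unfolding L_def by (intro mult_left_mono expectation_inverse_trunc(2) n) simp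
      finally show ?thesis by simp
    qed
    let ?f = "\<lambda>\<omega>. (ln (emp l n t \<omega>) - ln (u l (X t \<omega>)))\<^sup>2"
    let ?G = "\<lambda>\<omega>. h (X t \<omega>) + 4 * (1 + (ln (real n))\<^sup>2) * ?r \<omega>"
    have iG: "integrable M ?G" using ih' ir by (intro Bochner_Integration.integrable_add integrable_mult_right)
    have AE: "AE \<omega> in M. ?f \<omega> \<le> ?G \<omega>"
      using AE_u_pos[OF t1, of l]
    proof eventually_elim
      case (elim \<omega>)
      have "real (rank (key l) n t \<omega>) \<ge> 1" "real (rank (key l) n t \<omega>) \<le> real n" using rank_range(1)[OF t, of l \<omega>] rank_range(2)[of l n t \<omega>] by auto
      from ln_rank_diff_le[OF n this elim u_range(2)] show ?case
        unfolding emp_def h_def g_def .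
    qed
    have [measurable]: "(\<lambda>\<omega>. real (rank (key l) n t \<omega>)) \<in> borel_measurable M" by (rule rank_measurable[OF t])
    have fm: "?f \<in> borel_measurable M" unfolding emp_def by measurable
    have i: "integrable M ?f"
    proof (rule Bochner_Integration.integrable_bound[OF iG fm])
      show "AE \<omega> in M. norm (?f \<omega>) \<le> norm (?G \<omega>)" using AE by eventually_elim auto
    qed
    have "expectation ?f \<le> expectation ?G" by (rule integral_mono_AE[OF i iG AE])
    also have "\<dots> = expectation (\<lambda>\<omega>. h (X t \<omega>)) + 4 * (1 + (ln (real n))\<^sup>2) * expectation ?r"
      using ih' ir by simp
    also have "\<dots> \<le> (4 + 2 * K) * L\<^sup>2 / real n + 4 * L\<^sup>2 * (2 * L / real n)"
    proof (rule add_mono[OF Eh mult_mono[OF _ Er]])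
      have "1 + (ln (real n))\<^sup>2 \<le> L\<^sup>2" using n by (simp add: L_def power2_sum)
      then show "4 * (1 + (ln (real n))\<^sup>2) \<le> 4 * L\<^sup>2" by simp
      show "0 \<le> expectation ?r" by (intro Bochner_Integration.integral_nonneg) (use g0 in auto)
    qed simp
    also have "\<dots> \<le> (4 + 2 * K) * L ^ 3 / real n + 8 * L ^ 3 / real n"
      using K(1) L by (intro add_mono divide_right_mono mult_left_mono power_increasing) (auto simp: power2_eq_square power3_eq_cube)
    also have "\<dots> = C * L ^ 3 / real n" by (simp add: C_def algebra_simps add_divide_distrib)
    finally show ?thesis using i by (simp add: L_def)
  qed
  moreover have "C \<ge> 0" using K(1) by (simp add: C_def)
  ultimately show thesis using that by blast
qed

end

section \<open>The empirical variogram\<close>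

lemma abs_power_le_1_plus_fourth:
  fixes x :: real
  assumes "p \<le> 2"
  shows "\<bar>x ^ p\<bar> \<le> 1 + x ^ 4"
proof -
  have sq: "2 * \<bar>y\<bar> \<le> 1 + y\<^sup>2" for y :: real
    using zero_le_power2[of "\<bar>y\<bar> - 1"] by (simp add: power2_eq_square algebra_simps)
  have 4: "(x\<^sup>2)\<^sup>2 = x ^ 4" by (simp flip: power_mult)
  consider "p = 0" | "p = 1" | "p = 2" using assms by linarith
  then show ?thesis
  proof cases
    case 1
    then show ?thesis by simp
  next
    case 2
    have "2 * \<bar>x\<bar> \<le> 1 + x\<^sup>2" "2 * x\<^sup>2 \<le> 1 + x ^ 4" using sq[of x] sq[of "x\<^sup>2"] 4 by auto
    moreover have "0 \<le> x ^ 4" by simp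
    ultimately have "\<bar>x\<bar> \<le> 1 + x ^ 4" by linarith
    then show ?thesis using 2 by simp
  next
    case 3
    have "2 * x\<^sup>2 \<le> 1 + x ^ 4" using sq[of "x\<^sup>2"] 4 by auto
    moreover have "0 \<le> x ^ 4" by simp
    ultimately have "x\<^sup>2 \<le> 1 + x ^ 4" by linarith
    then show ?thesis using 3 by simp
  qed
qed

text \<open>By nestedness the difference of the sums is a sum over \<open>d\<close> indices. As
  \<open>\<bar>D t ^ p\<bar> \<le> 1 + (D t)\<^sup>2\<close>, Cauchy-Schwarz extracts
  \<open>sqrt d\<close> and leaves fourth powers. These are summed over the enclosing set
  \<open>T2\<close>, a threshold sample in the application, whose mean is computable although
  \<open>S\<close> is selected by ranks.\<close>

lemma sum_compare_nested:
  fixes D :: "'i \<Rightarrow> real"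
  assumes fin: "finite T2" and S: "S \<subseteq> T2" "T \<subseteq> T2" and nest: "S \<subseteq> T \<or> T \<subseteq> S" and p: "p \<le> 2"
  defines "d \<equiv> \<bar>real (card S) - real (card T)\<bar>"
  shows "\<bar>(\<Sum>t\<in>S. D t ^ p) - (\<Sum>t\<in>T. D t ^ p)\<bar> \<le> d + sqrt d * sqrt (\<Sum>t\<in>T2. D t ^ 4)"
proof -
  have main: "\<bar>(\<Sum>t\<in>B. D t ^ p) - (\<Sum>t\<in>A. D t ^ p)\<bar> \<le> \<bar>real (card B) - real (card A)\<bar> + sqrt \<bar>real (card B) - real (card A)\<bar> * sqrt (\<Sum>t\<in>T2. D t ^ 4)"
    if AB: "A \<subseteq> B" "B \<subseteq> T2" for A B
  proof -
    have fB: "finite B" using AB fin finite_subset by blast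
    have fA: "finite A" using AB fB finite_subset by blast
    have c: "\<bar>real (card B) - real (card A)\<bar> = real (card (B - A))"
      using AB fB fA card_mono[OF fB AB(1)] by (simp add: card_Diff_subset of_nat_diff)
    have pt: "\<bar>D t ^ p\<bar> \<le> 1 + (D t)\<^sup>2" for t
    proof -
      consider "p = 0" | "p = 1" | "p = 2" using p by linarith
      then show ?thesis
      proof cases
        case 2
        have "2 * \<bar>D t\<bar> \<le> 1 + (D t)\<^sup>2" using zero_le_power2[of "\<bar>D t\<bar> - 1"] by (simp add: power2_eq_square algebra_simps)
        then show ?thesis using 2 by simp
      qed auto
    qed
    have "(\<Sum>t\<in>B. D t ^ p) - (\<Sum>t\<in>A. D t ^ p) = (\<Sum>t\<in>B - A. D t ^ p)"
      using AB fB by (simp add: sum_diff)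
    then have "\<bar>(\<Sum>t\<in>B. D t ^ p) - (\<Sum>t\<in>A. D t ^ p)\<bar> \<le> (\<Sum>t\<in>B - A. \<bar>D t ^ p\<bar>)" by simp
    also have "\<dots> \<le> (\<Sum>t\<in>B - A. 1 + (D t)\<^sup>2)" by (intro sum_mono pt)
    also have "\<dots> = real (card (B - A)) + (\<Sum>t\<in>B - A. 1 * (D t)\<^sup>2)" by (simp add: sum.distrib)
    also have "(\<Sum>t\<in>B - A. 1 * (D t)\<^sup>2) \<le> sqrt (real (card (B - A))) * sqrt (\<Sum>t\<in>T2. D t ^ 4)"
    proof (rule power2_le_imp_le)
      have "(\<Sum>t\<in>B - A. 1 * (D t)\<^sup>2)\<^sup>2 \<le> (\<Sum>t\<in>B - A. 1\<^sup>2) * (\<Sum>t\<in>B - A. ((D t)\<^sup>2)\<^sup>2)" by (rule Cauchy_Schwarz_ineq_sum)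
      also have "\<dots> = real (card (B - A)) * (\<Sum>t\<in>B - A. D t ^ 4)" by (simp flip: power_mult)
      also have "\<dots> \<le> real (card (B - A)) * (\<Sum>t\<in>T2. D t ^ 4)"
        by (intro mult_left_mono sum_mono2) (use AB fin in auto)
      also have "\<dots> = (sqrt (real (card (B - A))) * sqrt (\<Sum>t\<in>T2. D t ^ 4))\<^sup>2"
        by (simp add: power_mult_distrib sum_nonneg)
      finally show "(\<Sum>t\<in>B - A. 1 * (D t)\<^sup>2)\<^sup>2 \<le> (sqrt (real (card (B - A))) * sqrt (\<Sum>t\<in>T2. D t ^ 4))\<^sup>2" .
    qed (auto intro!: mult_nonneg_nonneg sum_nonneg)
    finally show ?thesis unfolding c by simp
  qed
  from nest show ?thesis
  proof
    assume "S \<subseteq> T"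
    from main[OF this S(2)] show ?thesis by (simp add: d_def abs_minus_commute)
  next
    assume "T \<subseteq> S"
    from main[OF this S(1)] show ?thesis by (simp add: d_def)
  qed
qed

text \<open>Cauchy-Schwarz with the error summed over all of \<open>I\<close>, so the estimate holds
  for every subset \<open>S\<close> of size at most \<open>k\<close>, however it was selected. For
  squares the cross term is bounded through the average of \<open>(D t)\<^sup>2\<close>, whose limit
  is already known when this is applied.\<close>

lemma sum_perturbation:
  fixes D D' :: "'i \<Rightarrow> real" and k :: real
  assumes fin: "finite I" and S: "S \<subseteq> I" and k: "k > 0" "real (card S) \<le> k"
  defines "e \<equiv> (\<Sum>t\<in>I. (D' t - D t)\<^sup>2) / k"
  shows "\<bar>(\<Sum>t\<in>S. D' t) / k - (\<Sum>t\<in>S. D t) / k\<bar> \<le> sqrt e"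
    and "\<bar>(\<Sum>t\<in>S. (D' t)\<^sup>2) / k - (\<Sum>t\<in>S. (D t)\<^sup>2) / k\<bar> \<le> 2 * (sqrt ((\<Sum>t\<in>S. (D t)\<^sup>2) / k) * sqrt e) + e"
proof -
  define E where "E t = D' t - D t" for t
  have fS: "finite S" using S fin finite_subset by blast
  have SI: "(\<Sum>t\<in>S. (E t)\<^sup>2) \<le> k * e"
  proof -
    have "(\<Sum>t\<in>S. (E t)\<^sup>2) \<le> (\<Sum>t\<in>I. (E t)\<^sup>2)" by (intro sum_mono2) (use S fin in auto)
    then show ?thesis using k by (simp add: e_def E_def)
  qed
  have e0: "e \<ge> 0" unfolding e_def using k by (intro divide_nonneg_pos sum_nonneg) auto
  have CS: "\<bar>\<Sum>t\<in>S. F t * E t\<bar> / k \<le> sqrt ((\<Sum>t\<in>S. (F t)\<^sup>2) / k) * sqrt e" for F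
  proof (rule power2_le_imp_le)
    have "(\<bar>\<Sum>t\<in>S. F t * E t\<bar> / k)\<^sup>2 = (\<Sum>t\<in>S. F t * E t)\<^sup>2 / k\<^sup>2" by (simp add: power_divide)
    also have "\<dots> \<le> ((\<Sum>t\<in>S. (F t)\<^sup>2) * (\<Sum>t\<in>S. (E t)\<^sup>2)) / k\<^sup>2"
      by (intro divide_right_mono Cauchy_Schwarz_ineq_sum) auto
    also have "\<dots> \<le> ((\<Sum>t\<in>S. (F t)\<^sup>2) * (k * e)) / k\<^sup>2"
      by (intro divide_right_mono mult_left_mono SI sum_nonneg) auto
    also have "\<dots> = (sqrt ((\<Sum>t\<in>S. (F t)\<^sup>2) / k) * sqrt e)\<^sup>2"
    proof -
      have "0 \<le> (\<Sum>t\<in>S. (F t)\<^sup>2) / k" using k by (intro divide_nonneg_pos sum_nonneg) auto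
      then have "(sqrt ((\<Sum>t\<in>S. (F t)\<^sup>2) / k) * sqrt e)\<^sup>2 = (\<Sum>t\<in>S. (F t)\<^sup>2) / k * e"
        using e0 by (simp add: power_mult_distrib)
      then show ?thesis using k by (simp add: power2_eq_square[of k])
    qed
    finally show "(\<bar>\<Sum>t\<in>S. F t * E t\<bar> / k)\<^sup>2 \<le> (sqrt ((\<Sum>t\<in>S. (F t)\<^sup>2) / k) * sqrt e)\<^sup>2" .
    show "0 \<le> sqrt ((\<Sum>t\<in>S. (F t)\<^sup>2) / k) * sqrt e" using e0 k by (intro mult_nonneg_nonneg) (auto intro!: divide_nonneg_pos sum_nonneg)
  qed
  have "\<bar>(\<Sum>t\<in>S. D' t) / k - (\<Sum>t\<in>S. D t) / k\<bar> = \<bar>\<Sum>t\<in>S. 1 * E t\<bar> / k"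
    using k by (simp add: E_def sum_subtractf diff_divide_distrib[symmetric])
  also have "\<dots> \<le> sqrt ((\<Sum>t\<in>S. 1\<^sup>2) / k) * sqrt e" by (rule CS)
  also have "\<dots> \<le> 1 * sqrt e" using k e0 by (intro mult_right_mono) auto
  finally show "\<bar>(\<Sum>t\<in>S. D' t) / k - (\<Sum>t\<in>S. D t) / k\<bar> \<le> sqrt e" by simp
  have eq: "(D' t)\<^sup>2 - (D t)\<^sup>2 = 2 * (D t * E t) + (E t)\<^sup>2" for t
    by (simp add: E_def power2_eq_square algebra_simps)
  have "(\<Sum>t\<in>S. (D' t)\<^sup>2) / k - (\<Sum>t\<in>S. (D t)\<^sup>2) / k = 2 * ((\<Sum>t\<in>S. D t * E t) / k) + (\<Sum>t\<in>S. (E t)\<^sup>2) / k"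
    unfolding diff_divide_distrib[symmetric] sum_subtractf[symmetric] eq
    by (simp add: sum.distrib sum_distrib_left add_divide_distrib)
  then have "\<bar>(\<Sum>t\<in>S. (D' t)\<^sup>2) / k - (\<Sum>t\<in>S. (D t)\<^sup>2) / k\<bar> \<le> 2 * (\<bar>\<Sum>t\<in>S. D t * E t\<bar> / k) + \<bar>(\<Sum>t\<in>S. (E t)\<^sup>2) / k\<bar>"
    using k by (simp add: order.trans[OF abs_triangle_ineq] abs_mult)
  also have "\<bar>(\<Sum>t\<in>S. (E t)\<^sup>2) / k\<bar> \<le> e" using SI k by (simp add: divide_le_eq sum_nonneg mult.commute)
  also have "2 * (\<bar>\<Sum>t\<in>S. D t * E t\<bar> / k) \<le> 2 * (sqrt ((\<Sum>t\<in>S. (D t)\<^sup>2) / k) * sqrt e)"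
    by (intro mult_left_mono CS) auto
  finally show "\<bar>(\<Sum>t\<in>S. (D' t)\<^sup>2) / k - (\<Sum>t\<in>S. (D t)\<^sup>2) / k\<bar> \<le> 2 * (sqrt ((\<Sum>t\<in>S. (D t)\<^sup>2) / k) * sqrt e) + e" by simp
qed

section \<open>Laws of large numbers at the scale k\<close>

locale extremal_sample_k = extremal_sample M N X u ell \<mu>Y key
  for M :: "'a measure" and N :: "'b measure" and X and u :: "'d::finite \<Rightarrow> 'b \<Rightarrow> real" and ell \<mu>Y key +
  fixes k :: "nat \<Rightarrow> nat" and \<theta> q :: real
  assumes \<theta>: "\<theta> > 0" and k_lower: "\<And>n. real (k n) \<ge> real n powr \<theta>"
    and k_lim: "(\<lambda>n. real (k n) / real n) \<longlonglongrightarrow> q" and q01: "0 \<le> q" "q \<le> 1"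
begin

lemma k_pos: "n \<ge> 1 \<Longrightarrow> k n \<ge> 1"
proof -
  assume n: "n \<ge> 1"
  have "1 \<le> real n powr \<theta>" using n \<theta> by (intro ge_one_powr_ge_zero) auto
  then have "1 \<le> real (k n)" using k_lower[of n] by linarith
  then show ?thesis by simp
qed

lemma k_tendsto_infinity: "filterlim (\<lambda>n. real (k n)) at_top sequentially"
proof (rule filterlim_at_top_mono[OF _ always_eventually])
  show "filterlim (\<lambda>n. real n powr \<theta>) at_top sequentially" using \<theta> by real_asymp
qed (use k_lower in blast)

text \<open>Chebyshev's inequality for a triangular array: the variance of the sum is at most
  \<open>n * (B * (k / n)) = B * k\<close>, so division by \<open>k\<close> leaves
  \<open>B / k\<close>, which vanishes as \<open>k\<close> grows.\<close>

lemma conv_prob_lln: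
  fixes \<phi> :: "nat \<Rightarrow> 'b \<Rightarrow> real"
  assumes [measurable]: "\<And>n. \<phi> n \<in> borel_measurable N"
    and int: "\<And>n. integrable M (\<lambda>\<omega>. (\<phi> n (X 1 \<omega>))\<^sup>2)"
    and bnd: "\<And>n. n \<ge> 1 \<Longrightarrow> expectation (\<lambda>\<omega>. (\<phi> n (X 1 \<omega>))\<^sup>2) \<le> B * (real (k n) / real n)"
  shows "conv_prob M (\<lambda>n \<omega>. (\<Sum>t=1..n. \<phi> n (X t \<omega>)) / real (k n) - real n * expectation (\<lambda>\<omega>. \<phi> n (X 1 \<omega>)) / real (k n)) 0"
proof -
  define Y where "Y n \<omega> = (\<Sum>t=1..n. \<phi> n (X t \<omega>)) - real n * expectation (\<lambda>\<omega>. \<phi> n (X 1 \<omega>))" for n \<omega>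
  have S: "integrable M (\<lambda>\<omega>. (Y n \<omega>)\<^sup>2)"
    "expectation (\<lambda>\<omega>. (Y n \<omega>)\<^sup>2) \<le> real n * expectation (\<lambda>\<omega>. (\<phi> n (X 1 \<omega>))\<^sup>2)" for n
    unfolding Y_def by (rule expectation_centered_sum[OF assms(1) int])+
  let ?Z = "\<lambda>n \<omega>. (Y n \<omega>)\<^sup>2 / (real (k n))\<^sup>2"
  have Z: "conv_prob M ?Z 0"
  proof (rule conv_prob_L1)
    show "integrable M (?Z n)" for n using S(1) by (intro integrable_divide_zero) simp
    have lim: "(\<lambda>n. B / real (k n)) \<longlonglongrightarrow> 0"
      by (rule real_tendsto_divide_at_top[OF tendsto_const k_tendsto_infinity])
    show "(\<lambda>n. expectation (?Z n)) \<longlonglongrightarrow> 0"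
    proof (rule tendsto_sandwich[OF _ _ tendsto_const lim])
      show "\<forall>\<^sub>F n in sequentially. 0 \<le> expectation (?Z n)" by (intro always_eventually allI Bochner_Integration.integral_nonneg) simp
      show "\<forall>\<^sub>F n in sequentially. expectation (?Z n) \<le> B / real (k n)"
        using eventually_ge_at_top[of 1]
      proof eventually_elim
        case (elim n)
        have kn: "real (k n) > 0" using k_pos[OF elim] by simp
        have "expectation (?Z n) = expectation (\<lambda>\<omega>. (Y n \<omega>)\<^sup>2) / (real (k n))\<^sup>2" by simp
        also have "\<dots> \<le> (real n * expectation (\<lambda>\<omega>. (\<phi> n (X 1 \<omega>))\<^sup>2)) / (real (k n))\<^sup>2" by (intro divide_right_mono S(2)) simp
        also have "\<dots> \<le> (real n * (B * (real (k n) / real n))) / (real (k n))\<^sup>2" by (intro divide_right_mono mult_left_mono bnd elim) auto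
        also have "\<dots> = B / real (k n)" using kn elim by (simp add: power2_eq_square field_simps)
        finally show ?case .
      qed
    qed
  qed simp
  have "conv_prob M (\<lambda>n \<omega>. sqrt (?Z n \<omega>)) (sqrt 0)" by (rule conv_prob_compose[OF Z]) (rule isCont_real_sqrt)
  then have "conv_prob M (\<lambda>n \<omega>. sqrt (?Z n \<omega>)) 0" by simp
  then have "conv_prob M (\<lambda>n \<omega>. Y n \<omega> / real (k n)) 0"
    by (rule conv_prob_squeeze') (simp add: real_sqrt_divide)
  then show ?thesis by (simp add: Y_def diff_divide_distrib)
qed

text \<open>For \<open>p \<le> 2\<close> the squared summand is at most 1 plus the fourth power, and
  both have a truncated mean proportional to the level. The factor \<open>a\<close> will be 1 for
  the threshold sample compared with the selection and 2 for the sample enclosing both.\<close>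

lemma conv_prob_exceedance_sum:
  assumes a: "0 < a" and p: "p \<le> 2"
  shows "conv_prob M (\<lambda>n \<omega>. (\<Sum>t=1..n. (if u m (X t \<omega>) \<le> a * (real (k n) / real n) then (ln (u i (X t \<omega>)) - ln (u j (X t \<omega>))) ^ p else 0)) / real (k n)
      - real n * expectation (\<lambda>\<omega>. if u m (X 1 \<omega>) \<le> a * (real (k n) / real n) then (ln (u i (X 1 \<omega>)) - ln (u j (X 1 \<omega>))) ^ p else 0) / real (k n)) 0"
proof -
  obtain K where K: "K \<ge> 0"
    "\<And>i j m q. 0 < q \<Longrightarrow> integrable M (\<lambda>\<omega>. indicator {\<omega> \<in> space M. u m (X 1 \<omega>) \<le> q} \<omega> * (ln (u i (X 1 \<omega>)) - ln (u j (X 1 \<omega>))) ^ 4)"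
    "\<And>i j m q. 0 < q \<Longrightarrow> expectation (\<lambda>\<omega>. indicator {\<omega> \<in> space M. u m (X 1 \<omega>) \<le> q} \<omega> * (ln (u i (X 1 \<omega>)) - ln (u j (X 1 \<omega>))) ^ 4) \<le> K * q"
    using fourth_moment_log_ratio by blast
  let ?c = "\<lambda>n. a * (real (k n) / real n)"
  let ?A = "\<lambda>n. {\<omega> \<in> space M. u m (X 1 \<omega>) \<le> ?c n}"
  let ?D = "\<lambda>x. ln (u i x) - ln (u j x)"
  define \<phi> where "\<phi> n x = (if u m x \<le> ?c n then ?D x ^ p else 0)" for n x
  have [measurable]: "\<phi> n \<in> borel_measurable N" for n unfolding \<phi>_def by measurable
  let ?G = "\<lambda>n \<omega>. indicator (?A n) \<omega> + indicator (?A n) \<omega> * ?D (X 1 \<omega>) ^ 4"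
  have pt: "(\<phi> n (X 1 \<omega>))\<^sup>2 \<le> ?G n \<omega>" if "\<omega> \<in> space M" for n \<omega>
  proof -
    have "(x ^ p)\<^sup>2 \<le> 1 + x ^ 4" for x :: real
    proof -
      consider "p = 0" | "p = 1" | "p = 2" using p by linarith
      then show ?thesis
      proof cases
        case 2
        have "2 * x\<^sup>2 \<le> 1 + (x\<^sup>2)\<^sup>2" using zero_le_power2[of "x\<^sup>2 - 1"] by (simp add: power2_eq_square algebra_simps)
        moreover have "0 \<le> x\<^sup>2" by simp
        ultimately have "x\<^sup>2 \<le> 1 + (x\<^sup>2)\<^sup>2" by linarith
        then show ?thesis using 2 by (simp flip: power_mult)
      qed (auto simp flip: power_mult)
    qed
    then show ?thesis using that by (simp add: \<phi>_def)
  qed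
  have int4: "integrable M (\<lambda>\<omega>. indicator (?A n) \<omega> * ?D (X 1 \<omega>) ^ 4)" for n
  proof (cases "?c n > 0")
    case False
    \<comment> \<open>Only \<open>n = 0\<close> has no positive level, since division by zero gives
      0, and a margin at most 0 is a null event.\<close>
    have "AE \<omega> in M. indicator (?A n) \<omega> * ?D (X 1 \<omega>) ^ 4 = 0"
      using AE_U_pos[of m] by eventually_elim (use False in auto)
    then show ?thesis by (subst integrable_cong_AE[of _ _ "\<lambda>_. 0"]) auto
  qed (rule K(2))
  have intG: "integrable M (?G n)" for n using int4 by (intro Bochner_Integration.integrable_add) (auto simp: less_top[symmetric])
  have int: "integrable M (\<lambda>\<omega>. (\<phi> n (X 1 \<omega>))\<^sup>2)" for n
    by (rule Bochner_Integration.integrable_bound[OF intG]) (use pt[of _ n] in \<open>auto intro!: AE_I2 intro: order.trans\<close>)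
  have bnd: "expectation (\<lambda>\<omega>. (\<phi> n (X 1 \<omega>))\<^sup>2) \<le> (a * (1 + K)) * (real (k n) / real n)" if n: "n \<ge> 1" for n
  proof -
    have c: "?c n > 0" using n k_pos[OF n] a by simp
    have "expectation (\<lambda>\<omega>. (\<phi> n (X 1 \<omega>))\<^sup>2) \<le> expectation (?G n)" by (rule integral_mono[OF int intG pt])
    also have "\<dots> = prob (?A n) + expectation (\<lambda>\<omega>. indicator (?A n) \<omega> * ?D (X 1 \<omega>) ^ 4)"
      using int4 by (subst Bochner_Integration.integral_add) (auto simp: less_top[symmetric])
    also have "\<dots> \<le> ?c n + K * ?c n" by (intro add_mono prob_U_le_le K(3) c less_imp_le)
    also have "\<dots> = (a * (1 + K)) * (real (k n) / real n)"
    proof -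
      have "a * r + K * (a * r) = (a * (1 + K)) * r" for r by (simp add: algebra_simps)
      then show ?thesis .
    qed
    finally show ?thesis .
  qed
  show ?thesis using conv_prob_lln[of \<phi>, OF _ int bnd] unfolding \<phi>_def by simp
qed

end

section \<open>Selected and threshold samples for fixed coordinates\<close>

context extremal_sample_k
begin

context
  fixes m i j :: 'd
begin

definition ratio :: "'b \<Rightarrow> real" where "ratio x = ln (u i x) - ln (u j x)"

lemma ratio_measurable[measurable]: "ratio \<in> borel_measurable N"
  unfolding ratio_def by measurable

definition trunc_mean :: "nat \<Rightarrow> real \<Rightarrow> real" where
  "trunc_mean p c = expectation (\<lambda>\<omega>. if u m (X 1 \<omega>) \<le> c then ratio (X 1 \<omega>) ^ p else 0)"

definition target :: real where
  "target = (if q = 0 then ext_variogram \<mu>Y m i j else cond_var_ev M (exc m q) (\<lambda>\<omega>. ratio (X 1 \<omega>)))"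

lemma trunc_mean_eq:
  assumes c: "0 < c" "c \<le> 1"
  shows "trunc_mean p c = c * cond_exp_ev M (exc m c) (\<lambda>\<omega>. ratio (X 1 \<omega>) ^ p)"
proof -
  have "trunc_mean p c = expectation (\<lambda>\<omega>. indicator (exc m c) \<omega> * ratio (X 1 \<omega>) ^ p)"
    unfolding trunc_mean_def
  proof (rule integral_cong_AE)
    have "AE \<omega> in M. u m (X 1 \<omega>) \<noteq> c" using c by (intro AE_U_neq) auto
    with AE_space show "AE \<omega> in M. (if u m (X 1 \<omega>) \<le> c then ratio (X 1 \<omega>) ^ p else 0) = indicator (exc m c) \<omega> * ratio (X 1 \<omega>) ^ p"
      by eventually_elim (auto simp: exc_def indicator_def)
  qed measurable
  then show ?thesis using c by (simp add: cond_exp_ev_def prob_exc)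
qed

lemma ratio_fourth_integrable: "integrable M (\<lambda>\<omega>. ratio (X 1 \<omega>) ^ 4)"
proof -
  obtain K where K: "K \<ge> 0"
    "\<And>i j m q. 0 < q \<Longrightarrow> integrable M (\<lambda>\<omega>. indicator {\<omega> \<in> space M. u m (X 1 \<omega>) \<le> q} \<omega> * (ln (u i (X 1 \<omega>)) - ln (u j (X 1 \<omega>))) ^ 4)"
    "\<And>i j m q. 0 < q \<Longrightarrow> expectation (\<lambda>\<omega>. indicator {\<omega> \<in> space M. u m (X 1 \<omega>) \<le> q} \<omega> * (ln (u i (X 1 \<omega>)) - ln (u j (X 1 \<omega>))) ^ 4) \<le> K * q"
    using fourth_moment_log_ratio by blast
  have "integrable M (\<lambda>\<omega>. indicator {\<omega> \<in> space M. u m (X 1 \<omega>) \<le> 1} \<omega> * (ln (u i (X 1 \<omega>)) - ln (u j (X 1 \<omega>))) ^ 4)"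
    by (rule K(2)) simp
  then show ?thesis
    by (rule Bochner_Integration.integrable_cong[THEN iffD1, rotated 2]) (auto simp: u_range ratio_def)
qed

lemma ratio_power_integrable:
  assumes "p \<le> 2"
  shows "integrable M (\<lambda>\<omega>. ratio (X 1 \<omega>) ^ p)"
proof (rule Bochner_Integration.integrable_bound)
  show "integrable M (\<lambda>\<omega>. 1 + ratio (X 1 \<omega>) ^ 4)" using ratio_fourth_integrable by simp
  show "AE \<omega> in M. norm (ratio (X 1 \<omega>) ^ p) \<le> norm (1 + ratio (X 1 \<omega>) ^ 4)"
    using abs_power_le_1_plus_fourth[OF assms] by (intro AE_I2) (auto intro: order.trans)
qed measurable

text \<open>Two regimes. For \<open>q = 0\<close> the levels vanish and the moments approach those
  of the multivariate Pareto law. For \<open>q > 0\<close> the levels stay away from 0, the powers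
  of the log-ratio are integrable under \<open>M\<close> itself, and dominated convergence is enough
  because a margin equal to \<open>q\<close> is a null event.\<close>

lemma tendsto_trunc_mean:
  obtains L1 L2 where
    "(\<lambda>n. real n * trunc_mean 0 (real (k n) / real n) / real (k n)) \<longlonglongrightarrow> 1"
    "(\<lambda>n. real n * trunc_mean 1 (real (k n) / real n) / real (k n)) \<longlonglongrightarrow> L1"
    "(\<lambda>n. real n * trunc_mean 2 (real (k n) / real n) / real (k n)) \<longlonglongrightarrow> L2"
    "target = L2 - L1\<^sup>2"
proof -
  define c where "c n = real (k n) / real n" for n
  have c_lim: "c \<longlonglongrightarrow> q" using k_lim by (simp add: c_def[abs_def])
  have c_pos: "0 < c n" if "n \<ge> 1" for n using k_pos[OF that] that by (simp add: c_def)
  have eq: "real n * trunc_mean p (real (k n) / real n) / real (k n) = trunc_mean p (c n) / c n" for n p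
    by (simp add: c_def mult.commute)
  show thesis
  proof (cases "q = 0")
    case True
    \<comment> \<open>The moment limits expect levels in \<open>(0, 1]\<close> at every index, while
      \<open>c\<close> may leave this range for finitely many \<open>n\<close>; the substitute
      \<open>1 / (n + 1)\<close> affects only those.\<close>
    define c' where "c' n = (if 0 < c n \<and> c n \<le> 1 then c n else 1 / (real n + 1))" for n
    have "q < 1" using True by simp
    have ev: "\<forall>\<^sub>F n in sequentially. 0 < c n \<and> c n \<le> 1 \<and> c' n = c n"
      using order_tendstoD(2)[OF c_lim \<open>q < 1\<close>] eventually_ge_at_top[of 1]
    proof eventually_elim
      case (elim n)
      then show ?case using c_pos[OF elim(2)] by (simp add: c'_def)
    qed
    have "0 < c' n" "c' n \<le> 1" for n by (auto simp: c'_def)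
    moreover have "c' \<longlonglongrightarrow> 0"
      by (rule Lim_transform_eventually[OF c_lim[unfolded True]]) (use ev in eventually_elim, auto)
    ultimately have c': "\<And>n. 0 < c' n" "\<And>n. c' n \<le> 1" "c' \<longlonglongrightarrow> 0" by blast+
    note mom = tendsto_cond_moments[OF c', where m=m and i=i and j=j]
    define E1 where "E1 = cond_exp_ev \<mu>Y {y. y $ m > 1} (\<lambda>y. ln (y $ i) - ln (y $ j))"
    define E2 where "E2 = cond_exp_ev \<mu>Y {y. y $ m > 1} (\<lambda>y. (ln (y $ i) - ln (y $ j))\<^sup>2)"
    have ev_eq: "\<forall>\<^sub>F n in sequentially. cond_exp_ev M (exc m (c' n)) (\<lambda>\<omega>. ratio (X 1 \<omega>) ^ p) = trunc_mean p (c n) / c n" for p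
      using ev by eventually_elim (simp add: trunc_mean_eq)
    show thesis
    proof (rule that[of "- E1" E2]; (unfold eq)?)
      have "\<forall>\<^sub>F n in sequentially. trunc_mean 0 (c n) / c n = 1"
        using ev by eventually_elim (simp add: trunc_mean_eq cond_exp_ev_def prob_exc)
      then show "(\<lambda>n. trunc_mean 0 (c n) / c n) \<longlonglongrightarrow> 1" by (rule tendsto_eventually)
      show "(\<lambda>n. trunc_mean 1 (c n) / c n) \<longlonglongrightarrow> - E1"
        by (rule Lim_transform_eventually[OF _ ev_eq]) (use mom(1) in \<open>simp add: ratio_def E1_def\<close>)
      show "(\<lambda>n. trunc_mean 2 (c n) / c n) \<longlonglongrightarrow> E2"
        by (rule Lim_transform_eventually[OF _ ev_eq]) (use mom(2) in \<open>simp add: ratio_def E2_def\<close>)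
      show "target = E2 - (- E1)\<^sup>2"
        unfolding target_def using mom(3) True by (simp add: E1_def E2_def)
    qed
  next
    case False
    then have q: "0 < q" "q \<le> 1" using q01 by auto
    have lim: "(\<lambda>n. trunc_mean p (c n) / c n) \<longlonglongrightarrow> cond_exp_ev M (exc m q) (\<lambda>\<omega>. ratio (X 1 \<omega>) ^ p)" if p: "p \<le> 2" for p
    proof -
      have "(\<lambda>n. trunc_mean p (c n)) \<longlonglongrightarrow> trunc_mean p q"
        unfolding trunc_mean_def
      proof (rule integral_dominated_convergence)
        show "integrable M (\<lambda>\<omega>. \<bar>ratio (X 1 \<omega>) ^ p\<bar>)" using ratio_power_integrable[OF p] by simp
        show "AE \<omega> in M. norm (if u m (X 1 \<omega>) \<le> c n then ratio (X 1 \<omega>) ^ p else 0) \<le> \<bar>ratio (X 1 \<omega>) ^ p\<bar>" for n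
          by (intro AE_I2) auto
        have "AE \<omega> in M. u m (X 1 \<omega>) \<noteq> q" using q by (intro AE_U_neq) auto
        then show "AE \<omega> in M. (\<lambda>n. if u m (X 1 \<omega>) \<le> c n then ratio (X 1 \<omega>) ^ p else 0)
          \<longlonglongrightarrow> (if u m (X 1 \<omega>) \<le> q then ratio (X 1 \<omega>) ^ p else 0)"
        proof eventually_elim
          case (elim \<omega>)
          show ?case
          proof (cases "u m (X 1 \<omega>) < q")
            case True
            from order_tendstoD(1)[OF c_lim True] show ?thesis
              by (intro tendsto_eventually, eventually_elim) (use True in simp)
          next
            case False
            then have "q < u m (X 1 \<omega>)" using elim by simp
            from order_tendstoD(2)[OF c_lim this] show ?thesis
              by (intro tendsto_eventually, eventually_elim) (use \<open>q < u m (X 1 \<omega>)\<close> in simp)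
          qed
        qed
      qed measurable
      then have "(\<lambda>n. trunc_mean p (c n) / c n) \<longlonglongrightarrow> trunc_mean p q / q"
        using q by (intro tendsto_divide c_lim) auto
      then show ?thesis using q by (simp add: trunc_mean_eq)
    qed
    interpret Q: prob_space "cond_measure M (exc m q)" by (rule cond_exc[OF q])
    have iq: "integrable (cond_measure M (exc m q)) (\<lambda>\<omega>. ratio (X 1 \<omega>) ^ p)" if "p \<le> 2" for p
      using integrable_mult_indicator[OF exc_measurable ratio_power_integrable[OF that]]
      by (subst cond_exc(6)[OF q]) (auto simp: mult.commute)
    have "cond_var_ev M (exc m q) (\<lambda>\<omega>. ratio (X 1 \<omega>)) = Q.variance (\<lambda>\<omega>. ratio (X 1 \<omega>))"
      unfolding cond_var_ev_def by (simp add: cond_exc(5)[OF q])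
    also have "\<dots> = Q.expectation (\<lambda>\<omega>. (ratio (X 1 \<omega>))\<^sup>2) - (Q.expectation (\<lambda>\<omega>. ratio (X 1 \<omega>)))\<^sup>2"
      using iq[of 1] iq[of 2] by (intro Q.variance_eq) auto
    also have "\<dots> = cond_exp_ev M (exc m q) (\<lambda>\<omega>. ratio (X 1 \<omega>) ^ 2) - (cond_exp_ev M (exc m q) (\<lambda>\<omega>. ratio (X 1 \<omega>) ^ 1))\<^sup>2"
      by (simp add: cond_exc(5)[OF q])
    finally have var: "target = \<dots>" using False by (simp add: target_def)
    show thesis
    proof (rule that[OF _ _ _ var]; (unfold eq)?)
      have "cond_exp_ev M (exc m q) (\<lambda>\<omega>. ratio (X 1 \<omega>) ^ 0) = 1" using q by (simp add: cond_exp_ev_def prob_exc)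
      with lim[of 0] show "(\<lambda>n. trunc_mean 0 (c n) / c n) \<longlonglongrightarrow> 1" by simp
    qed (rule lim; simp)+
  qed
qed

definition sel :: "nat \<Rightarrow> 'a \<Rightarrow> nat set" where
  "sel n \<omega> = {t \<in> {1..n}. rank (key m) n t \<omega> \<le> k n}"

definition low :: "real \<Rightarrow> nat \<Rightarrow> 'a \<Rightarrow> nat set" where
  "low c n \<omega> = {t \<in> {1..n}. u m (X t \<omega>) \<le> c}"

text \<open>Both sets are closed upwards in \<open>key m\<close>: a larger key has no larger rank
  and no larger margin. Upward closed sets of a total preorder are always comparable, with or
  without ties.\<close>

lemma sel_low_nested: "sel n \<omega> \<subseteq> low c n \<omega> \<or> low c n \<omega> \<subseteq> sel n \<omega>"
proof (rule disjCI)
  assume "\<not> low c n \<omega> \<subseteq> sel n \<omega>"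
  then obtain s where s: "s \<in> low c n \<omega>" "s \<notin> sel n \<omega>" by blast
  show "sel n \<omega> \<subseteq> low c n \<omega>"
  proof
    fix t assume t: "t \<in> sel n \<omega>"
    have sn: "s \<in> {1..n}" "rank (key m) n s \<omega> > k n" "u m (X s \<omega>) \<le> c" using s by (auto simp: low_def sel_def)
    have tn: "t \<in> {1..n}" "rank (key m) n t \<omega> \<le> k n" using t by (auto simp: sel_def)
    have "key m (X s \<omega>) \<le> key m (X t \<omega>)"
    proof (rule ccontr)
      assume "\<not> key m (X s \<omega>) \<le> key m (X t \<omega>)"
      then have "rank (key m) n s \<omega> \<le> rank (key m) n t \<omega>" unfolding rank_def by (intro card_mono) auto
      then show False using sn tn by simp
    qed
    then have "u m (X t \<omega>) \<le> u m (X s \<omega>)" unfolding u_eq_surv by (intro surv_antimono key_measurable)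
    then show "t \<in> low c n \<omega>" using sn tn by (auto simp: low_def)
  qed
qed

lemma card_sel:
  assumes "inj_on (\<lambda>t. key m (X t \<omega>)) {1..n}"
  shows "card (sel n \<omega>) = min (k n) n"
  using card_rank_le[OF assms, of "k n"] by (simp add: sel_def rank_def)

lemma sum_low: "(\<Sum>t=1..n. if u m (X t \<omega>) \<le> c then f t else (0::real)) = (\<Sum>t\<in>low c n \<omega>. f t)"
  unfolding low_def by (rule sum.mono_neutral_cong_right) auto

text \<open>If the selection were not contained in the threshold sample at level
  \<open>2 * k / n\<close>, nestedness would put that sample inside the selection, so it would have
  at most \<open>k\<close> members; but its size divided by \<open>k\<close> concentrates at 2. Ties
  form a null event, adjoined to the exceptional set.\<close>

lemma regular_event:
  obtains A where "\<And>n. A n \<in> sets M" "(\<lambda>n. measure M (A n)) \<longlonglongrightarrow> 0"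
    "\<And>n \<omega>. n \<ge> 1 \<Longrightarrow> \<omega> \<in> space M \<Longrightarrow> \<omega> \<notin> A n \<Longrightarrow> card (sel n \<omega>) = min (k n) n"
    "\<And>n \<omega>. n \<ge> 1 \<Longrightarrow> \<omega> \<in> space M \<Longrightarrow> \<omega> \<notin> A n \<Longrightarrow> sel n \<omega> \<subseteq> low (2 * (real (k n) / real n)) n \<omega>"
proof -
  have "\<exists>Z. Z \<in> sets M \<and> measure M Z = 0 \<and> (\<forall>\<omega>\<in>space M - Z. inj_on (\<lambda>t. key m (X t \<omega>)) {1..n})" for n
  proof -
    have "AE \<omega> in M. \<forall>s\<in>{1..n}. \<forall>t\<in>{1..n}. s \<noteq> t \<longrightarrow> key m (X s \<omega>) \<noteq> key m (X t \<omega>)"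
      by (intro AE_finite_allI AE_impI AE_no_ties atomless) auto
    then obtain Z where Z: "{\<omega> \<in> space M. \<not> (\<forall>s\<in>{1..n}. \<forall>t\<in>{1..n}. s \<noteq> t \<longrightarrow> key m (X s \<omega>) \<noteq> key m (X t \<omega>))} \<subseteq> Z"
      "emeasure M Z = 0" "Z \<in> sets M" by (rule AE_E)
    show ?thesis
    proof (intro exI[of _ Z] conjI ballI Z(3))
      show "measure M Z = 0" using Z(2) by (simp add: measure_def)
      fix \<omega> assume "\<omega> \<in> space M - Z"
      then have "\<forall>s\<in>{1..n}. \<forall>t\<in>{1..n}. s \<noteq> t \<longrightarrow> key m (X s \<omega>) \<noteq> key m (X t \<omega>)" using Z(1) by blast
      then show "inj_on (\<lambda>t. key m (X t \<omega>)) {1..n}" unfolding inj_on_def by blast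
    qed
  qed
  then have "\<forall>n. \<exists>Z. Z \<in> sets M \<and> measure M Z = 0 \<and> (\<forall>\<omega>\<in>space M - Z. inj_on (\<lambda>t. key m (X t \<omega>)) {1..n})" by blast
  from choice[OF this] obtain Z where Z: "\<And>n. Z n \<in> sets M" "\<And>n. measure M (Z n) = 0"
    "\<And>n \<omega>. \<omega> \<in> space M - Z n \<Longrightarrow> inj_on (\<lambda>t. key m (X t \<omega>)) {1..n}" by blast
  have "conv_prob M (\<lambda>n \<omega>. (\<Sum>t=1..n. (if u m (X t \<omega>) \<le> 2 * (real (k n) / real n) then 1 else 0)) / real (k n)
      - real n * expectation (\<lambda>\<omega>. if u m (X 1 \<omega>) \<le> 2 * (real (k n) / real n) then 1 else 0) / real (k n)) 0"
    using conv_prob_exceedance_sum[of 2 0 m i j] unfolding power_0 by simp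
  then obtain B where B: "\<And>n. B n \<in> sets M" and
    B0: "\<And>n \<omega>. \<omega> \<in> space M \<Longrightarrow> \<omega> \<notin> B n \<Longrightarrow> dist ((\<Sum>t=1..n. (if u m (X t \<omega>) \<le> 2 * (real (k n) / real n) then 1 else 0)) / real (k n)
      - real n * expectation (\<lambda>\<omega>. if u m (X 1 \<omega>) \<le> 2 * (real (k n) / real n) then 1 else 0) / real (k n)) 0 < 1"
    and B_lim: "(\<lambda>n. measure M (B n)) \<longlonglongrightarrow> 0"
    by (rule conv_probE[OF _ zero_less_one]) (rule that)
  from B0 have B1: "\<And>n \<omega>. \<omega> \<in> space M \<Longrightarrow> \<omega> \<notin> B n \<Longrightarrow> \<bar>(\<Sum>t=1..n. (if u m (X t \<omega>) \<le> 2 * (real (k n) / real n) then 1 else 0)) / real (k n)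
      - real n * expectation (\<lambda>\<omega>. if u m (X 1 \<omega>) \<le> 2 * (real (k n) / real n) then 1 else 0) / real (k n)\<bar> < 1"
    unfolding dist_real_def diff_0_right .
  have card: "card (sel n \<omega>) = min (k n) n" if "n \<ge> 1" "\<omega> \<in> space M" "\<omega> \<notin> Z n \<union> B n" for n \<omega>
    by (rule card_sel[OF Z(3)]) (use that in auto)
  have sub: "sel n \<omega> \<subseteq> low (2 * (real (k n) / real n)) n \<omega>" if n: "n \<ge> 1" and \<omega>: "\<omega> \<in> space M" "\<omega> \<notin> Z n \<union> B n" for n \<omega>
  proof (rule ccontr)
    let ?c = "2 * (real (k n) / real n)"
    assume neg: "\<not> sel n \<omega> \<subseteq> low ?c n \<omega>"
    then have low: "low ?c n \<omega> \<subseteq> sel n \<omega>" using sel_low_nested by blast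
    have fin: "finite (sel n \<omega>)" by (simp add: sel_def)
    have "card (low ?c n \<omega>) \<le> k n" using card_mono[OF fin low] card[OF n \<omega>] by simp
    then have ck: "real (card (low ?c n \<omega>)) \<le> real (k n)" by simp
    \<comment> \<open>A margin above the level shows that the level is at most 1. The exceedance
      probability is then the level itself and the normalised mean exactly 2, at distance at least 1
      from the normalised count.\<close>
    from neg obtain t where "t \<in> {1..n}" "\<not> u m (X t \<omega>) \<le> ?c" by (auto simp: sel_def low_def)
    then have c1: "?c \<le> 1" using u_range(2)[of m "X t \<omega>"] by linarith
    have kn: "real (k n) > 0" using k_pos[OF n] by simp
    have "expectation (\<lambda>\<omega>. if u m (X 1 \<omega>) \<le> ?c then 1 else 0) = expectation (indicator {\<omega> \<in> space M. u m (X 1 \<omega>) \<le> ?c})"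
      by (intro Bochner_Integration.integral_cong) auto
    also have "\<dots> = prob {\<omega> \<in> space M. u m (X 1 \<omega>) \<le> ?c}" by simp
    also have "\<dots> = ?c" using c1 by (intro prob_U_le) auto
    finally have "real n * expectation (\<lambda>\<omega>. if u m (X 1 \<omega>) \<le> ?c then 1 else 0) / real (k n) = 2"
      using n kn by simp
    moreover have "(\<Sum>t=1..n. (if u m (X t \<omega>) \<le> ?c then 1 else 0)) / real (k n) \<le> 1"
      using ck kn unfolding sum_low by simp
    ultimately show False using B1[of \<omega> n] \<omega> by auto
  qed
  show thesis
  proof (rule that[of "\<lambda>n. Z n \<union> B n"])
    show "(\<lambda>n. measure M (Z n \<union> B n)) \<longlonglongrightarrow> 0"
      by (rule measure_Un_tendsto_0) (use Z B B_lim in auto)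
    show "Z n \<union> B n \<in> sets M" for n using Z(1) B by (intro sets.Un)
  qed (rule card sub, assumption+)+
qed

definition emp_ratio :: "nat \<Rightarrow> nat \<Rightarrow> 'a \<Rightarrow> real" where
  "emp_ratio n t \<omega> = ln (emp i n t \<omega>) - ln (emp j n t \<omega>)"

lemma conv_prob_replacement:
  "conv_prob M (\<lambda>n \<omega>. (\<Sum>t=1..n. (emp_ratio n t \<omega> - ratio (X t \<omega>))\<^sup>2) / real (k n)) 0"
proof -
  obtain C where C: "C \<ge> 0"
    "\<And>l n t. t \<in> {1..n} \<Longrightarrow> integrable M (\<lambda>\<omega>. (ln (emp l n t \<omega>) - ln (u l (X t \<omega>)))\<^sup>2)"
    "\<And>l n t. t \<in> {1..n} \<Longrightarrow> expectation (\<lambda>\<omega>. (ln (emp l n t \<omega>) - ln (u l (X t \<omega>)))\<^sup>2) \<le> C * (1 + ln (real n)) ^ 3 / real n"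
    using emp_log_error by blast
  let ?e = "\<lambda>l n t \<omega>. (ln (emp l n t \<omega>) - ln (u l (X t \<omega>)))\<^sup>2"
  let ?Z = "\<lambda>n \<omega>. (\<Sum>t=1..n. 2 * ?e i n t \<omega> + 2 * ?e j n t \<omega>) / real (k n)"
  have Z: "conv_prob M ?Z 0"
  proof (rule conv_prob_L1)
    have int: "integrable M (\<lambda>\<omega>. \<Sum>t=1..n. 2 * ?e i n t \<omega> + 2 * ?e j n t \<omega>)" for n
      by (intro Bochner_Integration.integrable_sum Bochner_Integration.integrable_add integrable_mult_right C(2))
    then show "integrable M (?Z n)" for n by (intro integrable_divide_zero)
    have lim: "(\<lambda>n. 4 * C * ((1 + ln (real n)) ^ 3 / real n powr \<theta>)) \<longlonglongrightarrow> 0"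
      using \<theta> by (intro tendsto_mult_right_zero) real_asymp
    show "(\<lambda>n. expectation (?Z n)) \<longlonglongrightarrow> 0"
    proof (rule tendsto_sandwich[OF _ _ tendsto_const lim])
      show "\<forall>\<^sub>F n in sequentially. 0 \<le> expectation (?Z n)"
        by (intro always_eventually allI Bochner_Integration.integral_nonneg divide_nonneg_nonneg sum_nonneg) auto
      show "\<forall>\<^sub>F n in sequentially. expectation (?Z n) \<le> 4 * C * ((1 + ln (real n)) ^ 3 / real n powr \<theta>)"
        using eventually_ge_at_top[of 1]
      proof eventually_elim
        case (elim n)
        have kn: "real (k n) > 0" using k_pos[OF elim] by simp
        have L: "0 \<le> (1 + ln (real n)) ^ 3" using elim by simp
        have "expectation (?Z n) = (\<Sum>t=1..n. 2 * expectation (?e i n t) + 2 * expectation (?e j n t)) / real (k n)"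
        proof -
          have "expectation (\<lambda>\<omega>. 2 * ?e i n t \<omega> + 2 * ?e j n t \<omega>) = 2 * expectation (?e i n t) + 2 * expectation (?e j n t)" if "t \<in> {1..n}" for t
            using C(2)[OF that] by (subst Bochner_Integration.integral_add) auto
          moreover have "expectation (\<lambda>\<omega>. \<Sum>t=1..n. 2 * ?e i n t \<omega> + 2 * ?e j n t \<omega>) = (\<Sum>t=1..n. expectation (\<lambda>\<omega>. 2 * ?e i n t \<omega> + 2 * ?e j n t \<omega>))"
            by (rule Bochner_Integration.integral_sum) (intro Bochner_Integration.integrable_add integrable_mult_right C(2))
          ultimately show ?thesis by simp
        qed
        also have "\<dots> \<le> (\<Sum>t=1..n. 2 * (C * (1 + ln (real n)) ^ 3 / real n) + 2 * (C * (1 + ln (real n)) ^ 3 / real n)) / real (k n)"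
          by (intro divide_right_mono sum_mono add_mono mult_left_mono C(3)) auto
        also have "\<dots> = 4 * C * ((1 + ln (real n)) ^ 3 / real (k n))"
          using elim by (simp add: field_simps)
        also have "\<dots> \<le> 4 * C * ((1 + ln (real n)) ^ 3 / real n powr \<theta>)"
          using k_lower[of n] C(1) L elim kn by (intro mult_left_mono divide_left_mono) auto
        finally show ?case .
      qed
    qed
  qed (auto intro!: divide_nonneg_nonneg sum_nonneg)
  show ?thesis
  proof (rule conv_prob_squeeze'[OF Z])
    fix n \<omega>
    have "(\<Sum>t=1..n. (emp_ratio n t \<omega> - ratio (X t \<omega>))\<^sup>2) / real (k n) \<le> ?Z n \<omega>"
    proof (intro divide_right_mono sum_mono)
      fix t
      have "emp_ratio n t \<omega> - ratio (X t \<omega>) = (ln (emp i n t \<omega>) - ln (u i (X t \<omega>))) - (ln (emp j n t \<omega>) - ln (u j (X t \<omega>)))"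
        by (simp add: emp_ratio_def ratio_def)
      then show "(emp_ratio n t \<omega> - ratio (X t \<omega>))\<^sup>2 \<le> 2 * ?e i n t \<omega> + 2 * ?e j n t \<omega>" by (simp only: power2_diff_le)
    qed simp
    moreover have "0 \<le> (\<Sum>t=1..n. (emp_ratio n t \<omega> - ratio (X t \<omega>))\<^sup>2) / real (k n)" by (intro divide_nonneg_nonneg sum_nonneg) auto
    ultimately show "dist ((\<Sum>t=1..n. (emp_ratio n t \<omega> - ratio (X t \<omega>))\<^sup>2) / real (k n)) 0 \<le> ?Z n \<omega>" by simp
  qed
qed

text \<open>At most \<open>n\<close> observations can be selected, and \<open>k\<close> may exceed
  \<open>n\<close>; but for infinitely many indices this happens only if \<open>q = 1\<close>, and
  then \<open>n / k\<close> tends to 1 as well.\<close>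

lemma tendsto_min_k_div_k: "(\<lambda>n. real (min (k n) n) / real (k n)) \<longlonglongrightarrow> 1"
proof (cases "q < 1")
  case True
  have "\<forall>\<^sub>F n in sequentially. real (min (k n) n) / real (k n) = 1"
    using order_tendstoD(2)[OF k_lim True] eventually_ge_at_top[of 1]
  proof eventually_elim
    case (elim n)
    then have "k n \<le> n" by (simp add: divide_less_eq)
    then show ?case using k_pos[OF elim(2)] by (simp add: min_def)
  qed
  then show ?thesis by (rule tendsto_eventually)
next
  case False
  then have q1: "q = 1" using q01 by simp
  have "(\<lambda>n. min 1 (1 / (real (k n) / real n))) \<longlonglongrightarrow> min 1 (1 / 1)"
    by (intro tendsto_min tendsto_divide tendsto_const k_lim[unfolded q1]) auto
  then have lim: "(\<lambda>n. min 1 (1 / (real (k n) / real n))) \<longlonglongrightarrow> 1" by simp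
  have "\<forall>\<^sub>F n in sequentially. min 1 (1 / (real (k n) / real n)) = real (min (k n) n) / real (k n)"
    using eventually_ge_at_top[of 1]
    by eventually_elim (use k_pos in \<open>fastforce simp: min_def field_simps\<close>)
  then show ?thesis by (rule Lim_transform_eventually[OF lim])
qed

end

end

section \<open>Convergence of the empirical variance\<close>

context extremal_sample_k
begin

lemma conv_prob_emp_variance:
  fixes m i j :: 'd
  defines "emean \<equiv> \<lambda>n \<omega>. (\<Sum>t\<in>sel m n \<omega>. emp_ratio i j n t \<omega>) / real (card (sel m n \<omega>))"
  shows "conv_prob M (\<lambda>n \<omega>. (\<Sum>t\<in>sel m n \<omega>. (emp_ratio i j n t \<omega> - emean n \<omega>)\<^sup>2) / real (card (sel m n \<omega>))) (target m i j)"
proof -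
  let ?R = "ratio i j" and ?E = "emp_ratio i j"
  obtain K where K: "K \<ge> 0"
    "\<And>i j m q. 0 < q \<Longrightarrow> integrable M (\<lambda>\<omega>. indicator {\<omega> \<in> space M. u m (X 1 \<omega>) \<le> q} \<omega> * (ln (u i (X 1 \<omega>)) - ln (u j (X 1 \<omega>))) ^ 4)"
    "\<And>i j m q. 0 < q \<Longrightarrow> expectation (\<lambda>\<omega>. indicator {\<omega> \<in> space M. u m (X 1 \<omega>) \<le> q} \<omega> * (ln (u i (X 1 \<omega>)) - ln (u j (X 1 \<omega>))) ^ 4) \<le> K * q"
    using fourth_moment_log_ratio by blast
  obtain L1 L2 where L:
    "(\<lambda>n. real n * trunc_mean m i j 0 (real (k n) / real n) / real (k n)) \<longlonglongrightarrow> 1"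
    "(\<lambda>n. real n * trunc_mean m i j 1 (real (k n) / real n) / real (k n)) \<longlonglongrightarrow> L1"
    "(\<lambda>n. real n * trunc_mean m i j 2 (real (k n) / real n) / real (k n)) \<longlonglongrightarrow> L2"
    "target m i j = L2 - L1\<^sup>2" by (rule tendsto_trunc_mean)
  obtain A where A: "\<And>n. A n \<in> sets M" "(\<lambda>n. measure M (A n)) \<longlonglongrightarrow> 0"
    and A_card: "\<And>n \<omega>. n \<ge> 1 \<Longrightarrow> \<omega> \<in> space M \<Longrightarrow> \<omega> \<notin> A n \<Longrightarrow> card (sel m n \<omega>) = min (k n) n"
    and A_sub: "\<And>n \<omega>. n \<ge> 1 \<Longrightarrow> \<omega> \<in> space M \<Longrightarrow> \<omega> \<notin> A n \<Longrightarrow> sel m n \<omega> \<subseteq> low m (2 * (real (k n) / real n)) n \<omega>"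
    by (rule regular_event[where m=m]) (rule that)

  \<comment> \<open>Three layers of averages, all divided by \<open>k\<close>: \<open>AT\<close>
    runs over the threshold sample with true margins, \<open>AS\<close> over the selection with true
    margins, and \<open>AE1\<close>, \<open>AE2\<close> over the selection with ranks. The actual
    sample size enters only at the end.\<close>
  define AT where "AT p n \<omega> = (\<Sum>t\<in>low m (real (k n) / real n) n \<omega>. ?R (X t \<omega>) ^ p) / real (k n)" for p n \<omega>
  have AT: "conv_prob M (AT p) l" if p: "p \<le> 2"
    and lim: "(\<lambda>n. real n * trunc_mean m i j p (real (k n) / real n) / real (k n)) \<longlonglongrightarrow> l" for p l
  proof -
    have "conv_prob M (\<lambda>n \<omega>. AT p n \<omega> - real n * trunc_mean m i j p (real (k n) / real n) / real (k n)) 0"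
      using conv_prob_exceedance_sum[OF zero_less_one p, of m i j]
      unfolding mult_1 ratio_def[symmetric] sum_low trunc_mean_def[symmetric] AT_def[symmetric] .
    from conv_prob_add[OF this conv_prob_tendsto[OF lim]] show ?thesis by simp
  qed

  \<comment> \<open>Relative difference in size between selection and threshold sample:
    \<open>AT 0\<close> is the normalised size of the latter, and the former has
    \<open>min (k n) n\<close> elements off the exceptional sets.\<close>
  define \<delta> where "\<delta> n \<omega> = \<bar>real (min (k n) n) / real (k n) - AT 0 n \<omega>\<bar>" for n \<omega>
  have \<delta>: "conv_prob M \<delta> 0"
  proof -
    have "conv_prob M (\<lambda>n \<omega>. real (min (k n) n) / real (k n) - AT 0 n \<omega>) (1 - 1)"
      by (intro conv_prob_diff conv_prob_tendsto[OF tendsto_min_k_div_k] AT L) simp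
    from conv_prob_compose[OF this, of abs] show ?thesis
      unfolding \<delta>_def[abs_def] by (simp add: continuous_at_imp_continuous_on isCont_rabs)
  qed
  have sqrt\<delta>: "conv_prob M (\<lambda>n \<omega>. sqrt (\<delta> n \<omega>)) 0"
    using conv_prob_compose[OF \<delta>, of sqrt] isCont_real_sqrt by simp

  \<comment> \<open>For \<open>Q\<close> a bound on the mean, uniform in \<open>n\<close>, is
    enough: it is only multiplied by \<open>sqrt \<delta>\<close>, which vanishes in
    probability.\<close>
  define Q where "Q n \<omega> = (\<Sum>t\<in>low m (2 * (real (k n) / real n)) n \<omega>. ?R (X t \<omega>) ^ 4) / real (k n)" for n \<omega>
  have Q_nonneg: "0 \<le> Q n \<omega>" for n \<omega> unfolding Q_def by (intro divide_nonneg_nonneg sum_nonneg) auto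
  let ?g = "\<lambda>c x. if u m x \<le> c then ?R x ^ 4 else 0"
  have Q_eq: "Q n \<omega> = (\<Sum>t=1..n. ?g (2 * (real (k n) / real n)) (X t \<omega>)) / real (k n)" for n \<omega>
    unfolding Q_def sum_low ..
  have g_int1: "integrable M (\<lambda>\<omega>. ?g c (X 1 \<omega>))" for c
    by (rule Bochner_Integration.integrable_bound[OF ratio_fourth_integrable[of i j]]) auto
  have g_int: "integrable M (\<lambda>\<omega>. ?g c (X t \<omega>))" if "t \<ge> 1" for c t
    using g_int1[of c] expectation_X(2)[OF that, of "?g c"] by simp
  have Q_int: "integrable M (Q n)" for n
    unfolding Q_eq[abs_def] by (intro integrable_divide_zero Bochner_Integration.integrable_sum g_int) auto
  have Q_mean: "expectation (Q n) \<le> 2 * K" for n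
  proof (cases "n \<ge> 1")
    case True
    let ?c = "2 * (real (k n) / real n)"
    have kn: "real (k n) > 0" using k_pos[OF True] by simp
    have c: "?c > 0" using kn True by simp
    have "expectation (Q n) = (\<Sum>t=1..n. expectation (\<lambda>\<omega>. ?g ?c (X t \<omega>))) / real (k n)"
      unfolding Q_eq[abs_def] integral_divide_zero
      by (subst Bochner_Integration.integral_sum) (auto intro: g_int)
    also have "\<dots> = (\<Sum>t=1..n. expectation (\<lambda>\<omega>. ?g ?c (X 1 \<omega>))) / real (k n)"
      by (intro arg_cong2[where f="(/)"] sum.cong refl expectation_X(1)[of _ "?g ?c"]) auto
    also have "expectation (\<lambda>\<omega>. ?g ?c (X 1 \<omega>)) = expectation (\<lambda>\<omega>. indicator {\<omega> \<in> space M. u m (X 1 \<omega>) \<le> ?c} \<omega> * (ln (u i (X 1 \<omega>)) - ln (u j (X 1 \<omega>))) ^ 4)"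
      by (intro Bochner_Integration.integral_cong) (auto simp: ratio_def)
    also have "(\<Sum>t=1..n. \<dots>) / real (k n) \<le> (\<Sum>t=1..n. K * ?c) / real (k n)"
      by (intro divide_right_mono sum_mono K(3) c) auto
    also have "\<dots> = 2 * K" using kn True by (simp add: field_simps)
    finally show ?thesis .
  next
    case False
    then have "n = 0" by simp
    then show ?thesis using K(1) by (simp add: Q_eq[abs_def])
  qed

  define AS where "AS p n \<omega> = (\<Sum>t\<in>sel m n \<omega>. ?R (X t \<omega>) ^ p) / real (k n)" for p n \<omega>
  have AS_AT: "\<bar>AS p n \<omega> - AT p n \<omega>\<bar> \<le> \<delta> n \<omega> + sqrt (\<delta> n \<omega>) * (1 + Q n \<omega>)"
    if p: "p \<le> 2" and n: "n \<ge> 1" and \<omega>: "\<omega> \<in> space M" "\<omega> \<notin> A n" for p n \<omega>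
  proof -
    let ?S = "sel m n \<omega>" and ?T = "low m (real (k n) / real n) n \<omega>" and ?T2 = "low m (2 * (real (k n) / real n)) n \<omega>"
    define kr where "kr = real (k n)"
    have kn: "kr > 0" using k_pos[OF n] by (simp add: kr_def)
    let ?d = "\<bar>real (card ?S) - real (card ?T)\<bar>" and ?q = "\<Sum>t\<in>?T2. ?R (X t \<omega>) ^ 4"
    have "0 \<le> real (k n) / real n" by simp
    then have c: "real (k n) / real n \<le> 2 * (real (k n) / real n)" by linarith
    have TT: "?T \<subseteq> ?T2" using order.trans[OF _ c] by (auto simp: low_def)
    have fin: "finite ?T2" by (simp add: low_def)
    have "\<bar>(\<Sum>t\<in>?S. ?R (X t \<omega>) ^ p) - (\<Sum>t\<in>?T. ?R (X t \<omega>) ^ p)\<bar> \<le> ?d + sqrt ?d * sqrt ?q"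
      by (rule sum_compare_nested[OF fin A_sub[OF n \<omega>] TT sel_low_nested p])
    then have "\<bar>(\<Sum>t\<in>?S. ?R (X t \<omega>) ^ p) - (\<Sum>t\<in>?T. ?R (X t \<omega>) ^ p)\<bar> / kr \<le> (?d + sqrt ?d * sqrt ?q) / kr"
      using kn by (intro divide_right_mono) auto
    also have "\<dots> = ?d / kr + sqrt (?d / kr) * sqrt (?q / kr)"
      using kn by (simp add: add_divide_distrib real_sqrt_divide)
    also have "?d / kr = \<delta> n \<omega>"
    proof -
      have "?d / kr = \<bar>real (card ?S) / kr - real (card ?T) / kr\<bar>" using kn by (simp add: diff_divide_distrib[symmetric])
      then show ?thesis unfolding \<delta>_def AT_def A_card[OF n \<omega>] by (simp add: kr_def)
    qed
    also have "?q / kr = Q n \<omega>" by (simp add: Q_def kr_def)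
    \<comment> \<open>The square root is replaced by \<open>1 + Q\<close>, whose mean is controlled
      directly.\<close>
    also have "sqrt (\<delta> n \<omega>) * sqrt (Q n \<omega>) \<le> sqrt (\<delta> n \<omega>) * (1 + Q n \<omega>)"
    proof (rule mult_left_mono)
      have "sqrt (Q n \<omega>) \<le> sqrt ((1 + Q n \<omega>)\<^sup>2)"
        using Q_nonneg[of n \<omega>] by (intro real_sqrt_le_mono) (simp add: power2_eq_square algebra_simps)
      then show "sqrt (Q n \<omega>) \<le> 1 + Q n \<omega>" using Q_nonneg[of n \<omega>] by simp
    qed (simp add: \<delta>_def)
    finally show ?thesis using kn unfolding AS_def AT_def kr_def[symmetric] by (simp add: diff_divide_distrib[symmetric])
  qed
  have gap: "conv_prob M (\<lambda>n \<omega>. \<delta> n \<omega> + sqrt (\<delta> n \<omega>) * (1 + Q n \<omega>)) 0"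
  proof -
    have "conv_prob M (\<lambda>n \<omega>. sqrt (\<delta> n \<omega>) * (1 + Q n \<omega>)) 0"
    proof (rule conv_prob_mult_bounded[OF sqrt\<delta>])
      show "integrable M (\<lambda>\<omega>. 1 + Q n \<omega>)" for n using Q_int by simp
      show "0 \<le> 1 + Q n \<omega>" for n \<omega> using Q_nonneg[of n \<omega>] by simp
      show "expectation (\<lambda>\<omega>. 1 + Q n \<omega>) \<le> 1 + 2 * K" for n
        using Q_int[of n] Q_mean[of n] by (simp add: prob_space)
    qed
    from conv_prob_add[OF \<delta> this] show ?thesis by simp
  qed
  have AS: "conv_prob M (AS p) l" if p: "p \<le> 2" and at: "conv_prob M (AT p) l" for p l
  proof -
    have "conv_prob M (\<lambda>n \<omega>. AS p n \<omega> - AT p n \<omega>) 0"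
    proof (rule conv_prob_squeeze[OF gap A])
      show "\<forall>\<^sub>F n in sequentially. \<forall>\<omega>\<in>space M - A n. dist (AS p n \<omega> - AT p n \<omega>) 0 \<le> \<delta> n \<omega> + sqrt (\<delta> n \<omega>) * (1 + Q n \<omega>)"
        using eventually_ge_at_top[of 1] by eventually_elim (use AS_AT[OF p] in \<open>auto simp: dist_real_def\<close>)
    qed
    from conv_prob_add[OF this at] show ?thesis by simp
  qed
  have AS1: "conv_prob M (AS 1) L1" and AS2: "conv_prob M (AS 2) L2"
    using AS[OF _ AT[OF _ L(2)]] AS[OF _ AT[OF _ L(3)]] by simp_all

  define e where "e n \<omega> = (\<Sum>t=1..n. (?E n t \<omega> - ?R (X t \<omega>))\<^sup>2) / real (k n)" for n \<omega>
  have e: "conv_prob M e 0" unfolding e_def[abs_def] by (rule conv_prob_replacement)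
  have sqrte: "conv_prob M (\<lambda>n \<omega>. sqrt (e n \<omega>)) 0"
    using conv_prob_compose[OF e, of sqrt] isCont_real_sqrt by simp
  have card_le: "real (card (sel m n \<omega>)) \<le> real (k n)" if "n \<ge> 1" "\<omega> \<in> space M" "\<omega> \<notin> A n" for n \<omega>
    using A_card[OF that] by simp
  have sel_sub: "sel m n \<omega> \<subseteq> {1..n}" for n \<omega> by (auto simp: sel_def)
  define AE1 where "AE1 n \<omega> = (\<Sum>t\<in>sel m n \<omega>. ?E n t \<omega>) / real (k n)" for n \<omega>
  define AE2 where "AE2 n \<omega> = (\<Sum>t\<in>sel m n \<omega>. (?E n t \<omega>)\<^sup>2) / real (k n)" for n \<omega>
  have AE1: "conv_prob M AE1 L1"
  proof -
    have "conv_prob M (\<lambda>n \<omega>. AE1 n \<omega> - AS 1 n \<omega>) 0"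
    proof (rule conv_prob_squeeze[OF sqrte A])
      show "\<forall>\<^sub>F n in sequentially. \<forall>\<omega>\<in>space M - A n. dist (AE1 n \<omega> - AS 1 n \<omega>) 0 \<le> sqrt (e n \<omega>)"
      proof (rule eventually_mono[OF eventually_ge_at_top[of 1]], rule ballI)
        fix n \<omega> assume n: "1 \<le> n" and \<omega>: "\<omega> \<in> space M - A n"
        have kn: "real (k n) > 0" using k_pos[OF n] by simp
        from sum_perturbation(1)[OF finite_atLeastAtMost sel_sub kn card_le[OF n], of \<omega> "\<lambda>t. ?E n t \<omega>" "\<lambda>t. ?R (X t \<omega>)"] \<omega>
        show "dist (AE1 n \<omega> - AS 1 n \<omega>) 0 \<le> sqrt (e n \<omega>)" by (simp add: AE1_def AS_def e_def dist_real_def)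
      qed
    qed
    from conv_prob_add[OF this AS1] show ?thesis by simp
  qed
  have AE2: "conv_prob M AE2 L2"
  proof -
    have "conv_prob M (\<lambda>n \<omega>. sqrt (AS 2 n \<omega>)) (sqrt L2)" by (rule conv_prob_compose[OF AS2]) (rule isCont_real_sqrt)
    from conv_prob_add[OF conv_prob_mult[OF conv_prob_mult[OF conv_prob_tendsto[OF tendsto_const, of 2] this] sqrte] e]
    have b: "conv_prob M (\<lambda>n \<omega>. 2 * sqrt (AS 2 n \<omega>) * sqrt (e n \<omega>) + e n \<omega>) 0" by simp
    have "conv_prob M (\<lambda>n \<omega>. AE2 n \<omega> - AS 2 n \<omega>) 0"
    proof (rule conv_prob_squeeze[OF b A])
      show "\<forall>\<^sub>F n in sequentially. \<forall>\<omega>\<in>space M - A n. dist (AE2 n \<omega> - AS 2 n \<omega>) 0 \<le> 2 * sqrt (AS 2 n \<omega>) * sqrt (e n \<omega>) + e n \<omega>"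
      proof (rule eventually_mono[OF eventually_ge_at_top[of 1]], rule ballI)
        fix n \<omega> assume n: "1 \<le> n" and \<omega>: "\<omega> \<in> space M - A n"
        have kn: "real (k n) > 0" using k_pos[OF n] by simp
        from sum_perturbation(2)[OF finite_atLeastAtMost sel_sub kn card_le[OF n], of \<omega> "\<lambda>t. ?E n t \<omega>" "\<lambda>t. ?R (X t \<omega>)"] \<omega>
        show "dist (AE2 n \<omega> - AS 2 n \<omega>) 0 \<le> 2 * sqrt (AS 2 n \<omega>) * sqrt (e n \<omega>) + e n \<omega>"
          by (simp add: AE2_def AS_def e_def dist_real_def mult.assoc)
      qed
    qed
    from conv_prob_add[OF this AS2] show ?thesis by simp
  qed

  \<comment> \<open>Converts the divisor \<open>k\<close> into the size of the selection, so that
    \<open>?V\<close> is the empirical variance itself off the exceptional sets.\<close>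
  let ?s = "\<lambda>n. real (min (k n) n) / real (k n)"
  let ?V = "\<lambda>n \<omega>. AE2 n \<omega> / ?s n - (AE1 n \<omega> / ?s n) * (AE1 n \<omega> / ?s n)"
  have s: "conv_prob M (\<lambda>n _. ?s n) 1" by (rule conv_prob_tendsto[OF tendsto_min_k_div_k])
  have "conv_prob M ?V (L2 / 1 - (L1 / 1) * (L1 / 1))"
    by (intro conv_prob_diff conv_prob_mult conv_prob_divide AE1 AE2 s) auto
  then have V: "conv_prob M ?V (target m i j)" by (simp add: L(4) power2_eq_square)
  have "conv_prob M (\<lambda>n \<omega>. \<bar>?V n \<omega> - target m i j\<bar>) 0"
    using conv_prob_compose[OF conv_prob_diff[OF V conv_prob_tendsto[OF tendsto_const, of "target m i j"]], of abs] isCont_rabs[OF continuous_ident]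
    by simp
  then show ?thesis
  proof (rule conv_prob_squeeze[OF _ A])
    show "\<forall>\<^sub>F n in sequentially. \<forall>\<omega>\<in>space M - A n.
      dist ((\<Sum>t\<in>sel m n \<omega>. (?E n t \<omega> - emean n \<omega>)\<^sup>2) / real (card (sel m n \<omega>))) (target m i j) \<le> \<bar>?V n \<omega> - target m i j\<bar>"
    proof (rule eventually_mono[OF eventually_ge_at_top[of 1]], rule ballI)
      fix n \<omega> assume n: "1 \<le> n" and \<omega>: "\<omega> \<in> space M - A n"
      let ?S = "sel m n \<omega>"
      have kn: "real (k n) > 0" using k_pos[OF n] by simp
      define c where "c = real (card ?S)"
      have c: "c > 0" "?s n = c / real (k n)" using A_card[OF n, of \<omega>] \<omega> n k_pos[OF n] by (auto simp: c_def)
      define a where "a = (\<Sum>t\<in>?S. ?E n t \<omega>)"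
      have mean: "emean n \<omega> = a / c" by (simp add: emean_def a_def c_def)
      have "(\<Sum>t\<in>?S. (?E n t \<omega> - a / c)\<^sup>2) = (\<Sum>t\<in>?S. (?E n t \<omega>)\<^sup>2 - 2 * (a / c) * ?E n t \<omega> + (a / c)\<^sup>2)"
        by (intro sum.cong refl) (simp add: power2_diff)
      also have "\<dots> = (\<Sum>t\<in>?S. (?E n t \<omega>)\<^sup>2) - 2 * (a / c) * a + c * (a / c)\<^sup>2"
        by (simp only: sum.distrib sum_subtractf sum_distrib_left[symmetric] a_def[symmetric] sum_constant c_def[symmetric])
      also have "\<dots> = (\<Sum>t\<in>?S. (?E n t \<omega>)\<^sup>2) - c * (a / c)\<^sup>2"
        using c by (simp add: power2_eq_square)
      finally have "(\<Sum>t\<in>?S. (?E n t \<omega> - a / c)\<^sup>2) / c = (\<Sum>t\<in>?S. (?E n t \<omega>)\<^sup>2) / c - (a / c) * (a / c)"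
        using c by (simp add: diff_divide_distrib power2_eq_square)
      also have "\<dots> = ?V n \<omega>"
        unfolding c(2) AE1_def AE2_def a_def[symmetric] using kn c(1) by simp
      finally show "dist ((\<Sum>t\<in>?S. (?E n t \<omega> - emean n \<omega>)\<^sup>2) / real (card ?S)) (target m i j) \<le> \<bar>?V n \<omega> - target m i j\<bar>"
        unfolding mean c_def[symmetric] by (simp add: dist_real_def)
    qed
  qed
qed

end

section \<open>Specialisation to coordinates and their distribution functions\<close>

theorem theorem1:
  fixes M :: "'a measure"
    and X :: "nat \<Rightarrow> 'a \<Rightarrow> real^'d::finite"
    and ell :: "real^'d \<Rightarrow> real"
    and \<mu>Y :: "(real^'d) measure"
    and k :: "nat \<Rightarrow> nat"
    and q :: real
    and m i j :: 'd
  assumes M: "prob_space M"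
    and rv: "\<And>t. t \<ge> 1 \<Longrightarrow> X t \<in> borel_measurable M"
    and indep: "prob_space.indep_vars M (\<lambda>_. borel) X {1..}"
    and ident: "\<And>t. t \<ge> 1 \<Longrightarrow> distr M borel (X t) = distr M borel (X 1)"
    and cont: "\<And>l. continuous_on UNIV (marg_cdf M (X 1) l)"
    and mda: "\<And>x. (\<forall>l. 0 \<le> x $ l) \<Longrightarrow>
               ((\<lambda>s. exc_prob M (X 1) UNIV s x / s) \<longlongrightarrow> ell x) (at_right 0)"
    and Y: "is_mpareto_law ell \<mu>Y"
    and B: "\<exists>\<xi>>0. \<forall>I::'d set. card I \<in> {2, 3} \<longrightarrow>
              (\<exists>C. \<forall>\<^sub>F s in at_right 0. \<forall>x::real^'d. (\<forall>l\<in>I. 0 \<le> x $ l \<and> x $ l \<le> 1) \<longrightarrow>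
                 \<bar>exc_prob M (X 1) I s x / s - stdf M (X 1) I x\<bar> \<le> C * s powr \<xi>)"
    and T: "\<exists>\<gamma>>0. \<forall>m' i'::'d. \<exists>\<mu>W. is_W_law \<mu>Y m' \<mu>W \<and>
              (\<integral>\<^sup>+ w. (if w $ i' > 0 then ennreal ((w $ i') powr (- \<gamma>)) else \<infinity>) \<partial>\<mu>W) < \<infinity>"
    and k_lower: "\<exists>\<theta>>0. \<forall>n. real (k n) \<ge> real n powr \<theta>"
    and k_lim: "(\<lambda>n. real (k n) / real n) \<longlonglongrightarrow> q"
    and q: "0 \<le> q" "q \<le> 1"
  shows "\<forall>\<epsilon>>0. (\<lambda>n. measure M {\<omega> \<in> space M.
            \<bar>emp_variogram (\<lambda>t. X t \<omega>) n (k n) m i j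
             - (if q = 0 then ext_variogram \<mu>Y m i j else pre_variogram M (X 1) m i j q)\<bar> > \<epsilon>})
         \<longlonglongrightarrow> 0"
proof -
  interpret M: prob_space M by (rule M)
  let ?u = "\<lambda>l (x::real^'d). 1 - marg_cdf M (X 1) l (x $ l)"
  let ?key = "\<lambda>l (x::real^'d). x $ l"
  have X1: "X 1 \<in> borel_measurable M" using rv by simp
  have nth[measurable]: "(\<lambda>x::real^'d. x $ l) \<in> borel_measurable borel" for l by (rule borel_measurable_nth)
  have [measurable]: "(\<lambda>\<omega>. X 1 \<omega> $ l) \<in> borel_measurable M" for l by (rule measurable_compose[OF X1 nth])
  have exc: "exc_prob M (X 1) I s x = M.prob {\<omega> \<in> space M. \<exists>l\<in>I. ?u l (X 1 \<omega>) < s * x $ l}" for I s x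
    unfolding exc_prob_def by (intro arg_cong[where f=M.prob]) (auto simp: algebra_simps)
  \<comment> \<open>Continuity of the distribution functions not only makes the margins uniform: in
    this form it excludes ties and identifies \<open>surv\<close> with 1 minus the distribution
    function.\<close>
  have atomless: "M.prob {\<omega> \<in> space M. X 1 \<omega> $ l = c} = 0" for l c
  proof -
    interpret D: real_distribution "distr M borel (\<lambda>\<omega>. X 1 \<omega> $ l)" by (rule M.real_distribution_distr) measurable
    have "marg_cdf M (X 1) l = cdf (distr M borel (\<lambda>\<omega>. X 1 \<omega> $ l))"
    proof
      fix x
      have "measure (distr M borel (\<lambda>\<omega>. X 1 \<omega> $ l)) {..x} = M.prob ((\<lambda>\<omega>. X 1 \<omega> $ l) -` {..x} \<inter> space M)"
        by (rule measure_distr) measurable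
      also have "\<dots> = marg_cdf M (X 1) l x"
        unfolding marg_cdf_def by (intro arg_cong[where f=M.prob]) auto
      finally show "marg_cdf M (X 1) l x = cdf (distr M borel (\<lambda>\<omega>. X 1 \<omega> $ l)) x" by (simp only: cdf_def)
    qed
    then have "isCont (cdf (distr M borel (\<lambda>\<omega>. X 1 \<omega> $ l))) c"
      using cont[of l] continuous_on_eq_continuous_at[OF open_UNIV] by auto
    then have z: "measure (distr M borel (\<lambda>\<omega>. X 1 \<omega> $ l)) {c} = 0" by (simp only: D.isCont_cdf)
    have "measure (distr M borel (\<lambda>\<omega>. X 1 \<omega> $ l)) {c} = M.prob ((\<lambda>\<omega>. X 1 \<omega> $ l) -` {c} \<inter> space M)"
      by (rule measure_distr) measurable
    also have "(\<lambda>\<omega>. X 1 \<omega> $ l) -` {c} \<inter> space M = {\<omega> \<in> space M. X 1 \<omega> $ l = c}" by auto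
    finally show ?thesis unfolding z by (rule sym)
  qed
  interpret iid: iid_sample M borel X
    using rv indep ident by unfold_locales
  interpret unif_margins M "\<lambda>l \<omega>. ?u l (X 1 \<omega>)" by (rule unif_margins_marg_cdf[OF M X1 cont])
  have "\<forall>x. (\<forall>l. 0 \<le> x $ l) \<longrightarrow> ((\<lambda>s. M.prob {\<omega> \<in> space M. \<exists>l. ?u l (X 1 \<omega>) < s * x $ l} / s) \<longlongrightarrow> ell x) (at_right 0)"
    using mda unfolding exc by simp
  then interpret mda_unif M "\<lambda>l \<omega>. ?u l (X 1 \<omega>)" ell \<mu>Y
    by unfold_locales (use Y in auto)
  interpret mda_unif_rate M "\<lambda>l \<omega>. ?u l (X 1 \<omega>)" ell \<mu>Y
    by unfold_locales (use B T in \<open>simp_all only: exc stdf_def\<close>)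
  interpret extremal_sample M borel X ?u ell \<mu>Y ?key
  proof
    fix l :: 'd and x :: "real^'d" and c :: real
    show "(\<lambda>x::real^'d. x $ l) \<in> borel_measurable borel" by (rule nth)
    show "M.prob {\<omega> \<in> space M. X 1 \<omega> $ l = c} = 0" by (rule atomless)
    have "iid.surv (?key l) (x $ l) = M.prob ({\<omega> \<in> space M. X 1 \<omega> $ l = x $ l} \<union> (space M - {\<omega> \<in> space M. X 1 \<omega> $ l \<le> x $ l}))"
      unfolding iid.surv_def by (intro arg_cong[where f=M.prob]) auto
    also have "\<dots> = 1 - M.prob {\<omega> \<in> space M. X 1 \<omega> $ l \<le> x $ l}"
      by (subst M.finite_measure_Union) (auto simp: atomless[simplified] M.prob_compl[simplified])
    finally show "?u l x = iid.surv (?key l) (x $ l)" by (simp add: marg_cdf_def)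
  qed
  from k_lower obtain \<theta> where \<theta>: "\<theta> > 0" "\<And>n. real (k n) \<ge> real n powr \<theta>" by blast
  interpret extremal_sample_k M borel X ?u ell \<mu>Y ?key k \<theta> q
    by unfold_locales (use \<theta> k_lim q in auto)
  have target: "target m i j = (if q = 0 then ext_variogram \<mu>Y m i j else pre_variogram M (X 1) m i j q)"
  proof -
    have "{\<omega> \<in> space M. marg_cdf M (X 1) m (X 1 \<omega> $ m) > 1 - q} = exc m q"
      by (auto simp: exc_def)
    then show ?thesis unfolding target_def pre_variogram_def ratio_def by simp
  qed
  have empU: "emp_U (\<lambda>t. X t \<omega>) n t l = emp l n t \<omega>" for \<omega> n t l
    by (simp add: emp_U_def emp_def iid.rank_def)
  \<comment> \<open>For \<open>n = 0\<close> both sets are empty; otherwise the common divisor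
    \<open>n\<close> cancels.\<close>
  have S: "{t \<in> {1..n}. emp m n t \<omega> \<le> real (k n) / real n} = sel m n \<omega>" for n \<omega>
    by (cases "n = 0") (auto simp: sel_def emp_def divide_le_cancel)
  have "conv_prob M (\<lambda>n \<omega>. emp_variogram (\<lambda>t. X t \<omega>) n (k n) m i j) (target m i j)"
    using conv_prob_emp_variance[of i j m] unfolding emp_variogram_def Let_def empU S emp_ratio_def[symmetric] .
  then show ?thesis unfolding target using M.conv_probD by blast
qed

end
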